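(* Let $d,N\ge1$, $U\in\mathcal{U}_d$, $\delta\in[0,1]$. For an adaptive scenario $\Xi$ (defined in the context) and a measurement $\mathcal{P}\in\{\mathcal{P}_{\mathbb 1},\mathcal{P}_U\}$, let $\Xi(\mathcal{P}^{(N)})$ denote its output state, and let \[ \tilde p^{(N)}_{\mathrm{II}}(\Xi)=\min\Big\{\operatorname{tr}\big(\Omega\,\Xi(\mathcal{P}_U^{(N)})\big):\ 0\le\Omega\le\mathbb 1,\ \operatorname{tr}\big((\mathbb 1-\Omega)\,\Xi(\mathcal{P}_{\mathbb 1}^{(N)})\big)\le\delta\Big\}. \] Let $p^{(N)}_{\mathrm{II}}$ be the minimal type II error of the parallel scenario, i.e. the minimum of $\operatorname{tr}(\Omega(\mathcal{P}_U^{\otimes N}\otimes\mathrm{id})(\ket\psi\bra\psi))$ over unit vectors $\ket\psi\in(\mathbb C^d)^{\otimes N}\otimes\mathbb C^{d'}$ (any finite $d'$) and $0\le\Omega\le\mathbb 1$ with $\operatorname{tr}((\mathbb 1-\Omega)(\mathcal{P}_{\mathbb 1}^{\otimes N}\otimes\mathrm{id})(\ket\psi\bra\psi))\le\delta$. Then for every adaptive scenario $\Xi$, $\tilde p^{(N)}_{\mathrm{II}}(\Xi)\ge p^{(N)}_{\mathrm{II}}$; that is, the parallel scenario is optimal for certification of von Neumann measurements.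
   Context: $\mathcal U_d$ is the set of $d\times d$ unitaries. For $U\in\mathcal U_d$ with columns $\ket{u_i}$, $\mathcal{P}_U(\rho)=\sum_{i=1}^d\bra{u_i}\rho\ket{u_i}\ket i\bra i$ is the von Neumann measurement channel; $\mathcal P_{\mathbb 1}$ is the computational-basis measurement. An adaptive scenario $\Xi$ using $N$ copies of a measurement $\mathcal P$ is specified by: natural numbers $d_1\le d_2\le\dots\le d_N$ with $d_N=d_N'd_N''$; a unit vector $\ket{\psi_0}\in\mathbb C^{d^N}\otimes\mathbb C^{d_1}$; and for each $i\in\{1,\dots,N-1\}$ a channel $\Xi_i(X)=W_iXW_i^\dagger$ with $W_i=\sum_{k_1,\dots,k_i}\ket{k_1,\dots,k_i}\bra{k_1,\dots,k_i}\otimes V_{k_1,\dots,k_i}$, where each $V_{k_1,\dots,k_i}$ is an isometry from $\mathbb C^{d^{N-i}}\otimes\mathbb C^{d_i}$ into $\mathbb C^{d^{N-i}}\otimes\mathbb C^{d_{i+1}}$ (the first $i$ registers of dimension $d$ hold the classical outcomes of the first $i$ uses). The output is \[ \Xi(\mathcal P^{(N)})=(\mathbb 1_{d^{N-1}}\otimes\mathcal P\otimes\mathbb 1_{d_N'}\otimes\operatorname{tr}_{d_N''})\circ\Xi_{N-1}\circ\cdots\circ(\mathbb 1_d\otimes\mathcal P\otimes\mathbb 1_{d^{N-2}d_2})\circ\Xi_1\circ(\mathcal P\otimes\mathbb 1_{d^{N-1}d_1})(\ket{\psi_0}\bra{\psi_0}), \] where $\mathbb 1_m$ denotes the identity channel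 on an $m$-dimensional system and $\operatorname{tr}_{d_N''}$ traces out the $d_N''$-dimensional subsystem. *)

theory Defs
  imports "Jordan_Normal_Form.Matrix" "HOL-Library.Complex_Order"
begin

text \<open>Finite-dimensional quantum formalism with complex matrices (Jordan_Normal_Form).
 Composite systems use the Kronecker (row-major) index convention: a basis index of
 C^a \<otimes> C^n \<otimes> C^b is (x,i,y) \<mapsto> (x*n + i)*b + y. In particular the computational basis
 state |k_1,...,k_N> of (C^d)^{\<otimes>N} has index \<Sum>_j k_j d^(N-j) (first register most significant).\<close>

definition adj :: "complex mat \<Rightarrow> complex mat" where
  "adj A = mat (dim_col A) (dim_row A) (\<lambda>(i,j). cnj (A $$ (j,i)))"

definition outer :: "complex vec \<Rightarrow> complex vec \<Rightarrow> complex mat" where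
  "outer v w = mat (dim_vec v) (dim_vec w) (\<lambda>(i,j). v $ i * cnj (w $ j))"

definition trace :: "complex mat \<Rightarrow> complex" where
  "trace A = (\<Sum>i<dim_row A. A $$ (i,i))"

definition braket :: "complex vec \<Rightarrow> complex mat \<Rightarrow> complex vec \<Rightarrow> complex" where
  "braket v A w = (\<Sum>i<dim_vec v. cnj (v $ i) * (A *\<^sub>v w) $ i)"

definition unit_vec :: "nat \<Rightarrow> complex vec \<Rightarrow> bool" where
  "unit_vec n v \<longleftrightarrow> v \<in> carrier_vec n \<and> (\<Sum>i<n. cmod (v $ i) ^ 2) = 1"

definition unitary :: "nat \<Rightarrow> complex mat \<Rightarrow> bool" where
  "unitary n U \<longleftrightarrow> U \<in> carrier_mat n n \<and> adj U * U = 1\<^sub>m n \<and> U * adj U = 1\<^sub>m n"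

definition isometry :: "nat \<Rightarrow> nat \<Rightarrow> complex mat \<Rightarrow> bool" where
  "isometry m n V \<longleftrightarrow> V \<in> carrier_mat m n \<and> adj V * V = 1\<^sub>m n"

text \<open>positive semidefinite (over complex numbers, this includes hermiticity)\<close>
definition psd :: "nat \<Rightarrow> complex mat \<Rightarrow> bool" where
  "psd n A \<longleftrightarrow> A \<in> carrier_mat n n \<and> (\<forall>v \<in> carrier_vec n. 0 \<le> braket v A v)"

definition effect :: "nat \<Rightarrow> complex mat \<Rightarrow> bool" where
  "effect n \<Omega> \<longleftrightarrow> psd n \<Omega> \<and> psd n (1\<^sub>m n - \<Omega>)"

definition meas :: "complex mat \<Rightarrow> complex mat \<Rightarrow> complex mat" where
  "meas U \<rho> = mat (dim_col U) (dim_col U)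
     (\<lambda>(i,j). if i = j then braket (col U i) \<rho> (col U i) else 0)"

text \<open>(1_a \<otimes> \<Phi> \<otimes> 1_b)(X) for a linear map \<Phi> on n\<times>n matrices, defined blockwise:
 the (x,y;x',y') block of the output is \<Phi> applied to the (x,y;x',y') block of X.\<close>
definition lift_mid :: "nat \<Rightarrow> nat \<Rightarrow> nat \<Rightarrow> (complex mat \<Rightarrow> complex mat) \<Rightarrow> complex mat \<Rightarrow> complex mat" where
  "lift_mid a n b \<Phi> X = mat (a*n*b) (a*n*b) (\<lambda>(p,q).
     (\<Phi> (mat n n (\<lambda>(j,j'). X $$ (((p div b) div n * n + j) * b + p mod b,
                                   ((q div b) div n * n + j') * b + q mod b))))
       $$ ((p div b) mod n, (q div b) mod n))"

definition ptrace_last :: "nat \<Rightarrow> nat \<Rightarrow> complex mat \<Rightarrow> complex mat" where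
  "ptrace_last m n X = mat m m (\<lambda>(i,j). \<Sum>k<n. X $$ (i*n + k, j*n + k))"

definition ctrl :: "nat \<Rightarrow> nat \<Rightarrow> nat \<Rightarrow> (nat \<Rightarrow> complex mat) \<Rightarrow> complex mat" where
  "ctrl K r c V = mat (K*r) (K*c) (\<lambda>(p,q).
     if p div r = q div c then V (p div r) $$ (p mod r, q mod c) else 0)"

text \<open>Adaptive scenario: d, N, dimensions dims 1..N (d_i = dims i), initial vector psi0,
 isometries V i k (i = 1..N-1, k < d^i encodes the outcomes k_1..k_i).
 adapt_state ... i is the state after the i-th use of the measurement.\<close>
fun adapt_state :: "nat \<Rightarrow> nat \<Rightarrow> (nat \<Rightarrow> nat) \<Rightarrow> complex vec \<Rightarrow> (nat \<Rightarrow> nat \<Rightarrow> complex mat)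
                     \<Rightarrow> complex mat \<Rightarrow> nat \<Rightarrow> complex mat" where
  "adapt_state d N dims psi0 V P 0 = outer psi0 psi0"
| "adapt_state d N dims psi0 V P (Suc i) =
     lift_mid (d^i) d (d^(N - Suc i) * dims (Suc i)) (meas P)
       (if i = 0 then adapt_state d N dims psi0 V P 0
        else (let W = ctrl (d^i) (d^(N-i) * dims (Suc i)) (d^(N-i) * dims i) (V i)
              in W * adapt_state d N dims psi0 V P i * adj W))"

definition adapt_output :: "nat \<Rightarrow> nat \<Rightarrow> (nat \<Rightarrow> nat) \<Rightarrow> nat \<Rightarrow> nat \<Rightarrow> complex vec
                     \<Rightarrow> (nat \<Rightarrow> nat \<Rightarrow> complex mat) \<Rightarrow> complex mat \<Rightarrow> complex mat" where
  "adapt_output d N dims d1 d2 psi0 V P = ptrace_last (d^N * d1) d2 (adapt_state d N dims psi0 V P N)"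

definition adaptive_scenario :: "nat \<Rightarrow> nat \<Rightarrow> (nat \<Rightarrow> nat) \<Rightarrow> nat \<Rightarrow> nat \<Rightarrow> complex vec
                     \<Rightarrow> (nat \<Rightarrow> nat \<Rightarrow> complex mat) \<Rightarrow> bool" where
  "adaptive_scenario d N dims d1 d2 psi0 V \<longleftrightarrow>
     (\<forall>i j. 1 \<le> i \<longrightarrow> i \<le> j \<longrightarrow> j \<le> N \<longrightarrow> dims i \<le> dims j) \<and>
     dims N = d1 * d2 \<and>
     unit_vec (d^N * dims 1) psi0 \<and>
     (\<forall>i k. 1 \<le> i \<longrightarrow> i < N \<longrightarrow> k < d^i \<longrightarrow>
        isometry (d^(N-i) * dims (Suc i)) (d^(N-i) * dims i) (V i k))"

definition p2_adaptive :: "real \<Rightarrow> complex mat \<Rightarrow> nat \<Rightarrow> nat \<Rightarrow> (nat \<Rightarrow> nat) \<Rightarrow> nat \<Rightarrow> nat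
                     \<Rightarrow> complex vec \<Rightarrow> (nat \<Rightarrow> nat \<Rightarrow> complex mat) \<Rightarrow> real" where
  "p2_adaptive \<delta> U d N dims d1 d2 psi0 V = Inf {Re (trace (\<Omega> * adapt_output d N dims d1 d2 psi0 V U)) | \<Omega>.
      effect (d^N * d1) \<Omega> \<and>
      Re (trace ((1\<^sub>m (d^N * d1) - \<Omega>) * adapt_output d N dims d1 d2 psi0 V (1\<^sub>m d))) \<le> \<delta>}"

fun par_apply :: "nat \<Rightarrow> nat \<Rightarrow> nat \<Rightarrow> complex mat \<Rightarrow> nat \<Rightarrow> complex mat \<Rightarrow> complex mat" where
  "par_apply d N d' P 0 X = X"
| "par_apply d N d' P (Suc i) X = lift_mid (d^i) d (d^(N - Suc i) * d') (meas P) (par_apply d N d' P i X)"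

definition par_output :: "nat \<Rightarrow> nat \<Rightarrow> nat \<Rightarrow> complex mat \<Rightarrow> complex vec \<Rightarrow> complex mat" where
  "par_output d N d' P psi = par_apply d N d' P N (outer psi psi)"

definition p2_parallel :: "real \<Rightarrow> complex mat \<Rightarrow> nat \<Rightarrow> nat \<Rightarrow> real" where
  "p2_parallel \<delta> U d N = Inf {Re (trace (\<Omega> * par_output d N d' U psi)) | d' psi \<Omega>.
      unit_vec (d^N * d') psi \<and> effect (d^N * d') \<Omega> \<and>
      Re (trace ((1\<^sub>m (d^N * d') - \<Omega>) * par_output d N d' (1\<^sub>m d) psi)) \<le> \<delta>}"

end

theory Submission
  imports Defs "HOL-Analysis.Function_Topology" "Jordan_Normal_Form.Determinant"
begin

text \<open>
  A measurement does not see the phases of its basis vectors, so \<open>U\<close> may be replaced by \<open>Q = U E\<close>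
  for any diagonal unitary \<open>E\<close>, and \<open>P\<^sub>U\<close> is the rotation by \<open>Q\<^sup>\<dagger>\<close> followed by dephasing.
  If the real part of \<open>Q\<close> is at least \<open>cos t\<close>, each use of the measurement turns the pure vector that
  describes a scenario by an angle of at most \<open>t\<close>, so after \<open>N\<close> adaptive uses the two hypotheses
  are at an angle of at most \<open>N t\<close>. By the Cauchy-Schwarz inequality for the test and its
  complement, the type II error is then at least \<open>cos\<^sup>2 (N t + \<beta>)\<close> with \<open>sin\<^sup>2 \<beta> = \<delta>\<close>.

  For the matching parallel scenario, minimise \<open>\<Sum>\<^sub>k |(\<rho> U)\<^sub>k\<^sub>k|\<close> over density matrices \<open>\<rho>\<close>. By
  minimax duality the minimiser is accompanied by a diagonal contraction whose phases are an optimal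
  \<open>E\<close>. If the minimum is \<open>0\<close>, the input \<open>\<rho>\<close> discriminates perfectly. Otherwise the minimum is
  \<open>cos t\<close>, the support of \<open>\<rho>\<close> is spanned by eigenvectors of \<open>Q\<close> with the eigenvalues
  \<open>cis t\<close> and \<open>cis (-t)\<close>, and the two spectral parts of \<open>\<rho>\<close> have equal diagonals. Hence
  products of these parts produce the same outcome distribution under both hypotheses and differ
  only in a phase, and a mixture of products has conditional overlap \<open>cos (min (N t) (\<pi> / 2))\<close> for
  every outcome, which attains the bound.
\<close>

section \<open>Density matrices as Gram matrices of columns\<close>

text \<open>Purify \<open>\<rho>\<close>. Given outcome \<open>k\<close>, one use of the measurement
  leaves two ancilla vectors, one per hypothesis, whose overlap has modulus
  \<open>|(\<rho> U)\<^sub>k\<^sub>k|\<close>, so the minimised sum is the root fidelity of the two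
  outputs. Adaptivity cannot beat the angle bound because the controlled isometries are common to
  both hypotheses and respect the recorded outcomes: a whole run is one evolving vector, and
  dephasing is remembered only as a block length. The modulus has no derivative at \<open>0\<close>,
  so the duality is obtained from a smoothed objective, whose first-order condition supplies the
  contraction; compactness then removes the smoothing. A small fidelity for one use does not yet
  handle \<open>N\<close> uses, since the overlaps might differ between outcomes. The equal
  diagonals of the two spectral parts resolve this, and they come from the phase alignment, which
  makes every diagonal entry of \<open>\<rho> Q\<close> real. A single product of spectral parts
  only acquires a global phase; superposing products under an ancilla label makes these phases
  relative, and their weighted mean is the overlap. The weights can be chosen to reach
  \<open>0\<close> once \<open>N t\<close> exceeds \<open>\<pi> / 2\<close>.\<close>

definition sqn :: "nat \<Rightarrow> (nat \<Rightarrow> complex) \<Rightarrow> real" where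
  "sqn d x = (\<Sum>k<d. (cmod (x k))\<^sup>2)"

text \<open>The density matrix with columns \<open>\<Psi> a\<close>. With columns as the variables,
  positivity need not be imposed as a constraint.\<close>

definition gram :: "nat \<Rightarrow> (nat \<Rightarrow> nat \<Rightarrow> complex) \<Rightarrow> nat \<Rightarrow> nat \<Rightarrow> complex" where
  "gram m \<Psi> k j = (\<Sum>a<m. \<Psi> a k * cnj (\<Psi> a j))"

text \<open>The diagonal entry \<open>(k,k)\<close> of \<open>x x\<^sup>\<dagger> M\<close>. Summed
  over columns it is that of \<open>\<rho> M\<close>.\<close>

definition diag_form :: "nat \<Rightarrow> (nat \<Rightarrow> nat \<Rightarrow> complex) \<Rightarrow> (nat \<Rightarrow> complex) \<Rightarrow> nat \<Rightarrow> complex" where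
  "diag_form d M x k = x k * (\<Sum>j<d. M j k * cnj (x j))"

lemma sqn_nonneg [simp]: "0 \<le> sqn d x"
  by (simp add: sqn_def sum_nonneg)

text \<open>The columns enter only through their Gram matrix, and linearly, so these sums follow
  convex mixtures of density matrices.\<close>

lemma sum_diag_form_gram:
  "(\<Sum>a<m. diag_form d M (\<Psi> a) k) = (\<Sum>j<d. M j k * gram m \<Psi> k j)"
proof -
  have "(\<Sum>a<m. diag_form d M (\<Psi> a) k) = (\<Sum>a<m. \<Sum>j<d. M j k * (\<Psi> a k * cnj (\<Psi> a j)))"
    by (simp add: diag_form_def sum_distrib_left mult_ac)
  also have "\<dots> = (\<Sum>j<d. \<Sum>a<m. M j k * (\<Psi> a k * cnj (\<Psi> a j)))"
    by (rule sum.swap)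
  finally show ?thesis by (simp add: gram_def sum_distrib_left)
qed

lemma sum_sqn_gram: "complex_of_real (\<Sum>a<m. sqn d (\<Psi> a)) = (\<Sum>k<d. gram m \<Psi> k k)"
proof -
  have "(\<Sum>a<m. sqn d (\<Psi> a)) = (\<Sum>k<d. \<Sum>a<m. (cmod (\<Psi> a k))\<^sup>2)"
    unfolding sqn_def by (rule sum.swap)
  then show ?thesis by (simp only: gram_def complex_norm_square of_real_sum)
qed

lemma unit_kernel_vector:
  fixes \<Psi> :: "nat \<Rightarrow> nat \<Rightarrow> complex"
  shows "\<exists>\<alpha>. (\<Sum>a<Suc d. (cmod (\<alpha> a))\<^sup>2) = 1 \<and> (\<forall>k<d. (\<Sum>a<Suc d. \<alpha> a * \<Psi> a k) = 0)"
proof -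
  let ?n = "Suc d"
  \<comment> \<open>The \<open>d\<close> equations in \<open>Suc d\<close> unknowns are padded with
    a zero row, which makes the matrix square and singular.\<close>
  define A where "A = mat ?n ?n (\<lambda>(k,a). if k < d then \<Psi> a k else 0)"
  have A: "A \<in> carrier_mat ?n ?n" by (simp add: A_def)
  have "A = mat\<^sub>r ?n ?n (\<lambda>i. if i = d then 0\<^sub>v ?n else row A i)"
    by (rule eq_matI) (auto simp: A_def)
  then have "det A = det (mat\<^sub>r ?n ?n (\<lambda>i. if i = d then 0\<^sub>v ?n else row A i))"
    by (rule arg_cong)
  also have "\<dots> = 0" by (rule det_row_0) (auto simp: A_def)
  finally have "det A = 0" .
  then obtain v where v: "v \<in> carrier_vec ?n" "v \<noteq> 0\<^sub>v ?n" "A *\<^sub>v v = 0\<^sub>v ?n"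
    using det_0_iff_vec_prod_zero_field[OF A] by blast
  define r where "r = (\<Sum>a<?n. (cmod (v $ a))\<^sup>2)"
  obtain b where "b < ?n" "v $ b \<noteq> 0" using v(1,2) by (metis carrier_vecD eq_vecI index_zero_vec)
  then have r: "r > 0" unfolding r_def by (intro sum_pos2[of _ b]) simp_all
  have ker: "(\<Sum>a<?n. v $ a * \<Psi> a k) = 0" if "k < d" for k
  proof -
    have "0 = (A *\<^sub>v v) $ k" using v(3) that by simp
    also have "\<dots> = (\<Sum>a<?n. v $ a * \<Psi> a k)"
      using that v(1) A by (simp add: scalar_prod_def A_def atLeast0LessThan mult.commute)
    finally show ?thesis by simp
  qed
  show ?thesis
  proof (intro exI[of _ "\<lambda>a. v $ a / complex_of_real (sqrt r)"] conjI allI impI)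
    have "(\<Sum>a<?n. (cmod (v $ a / complex_of_real (sqrt r)))\<^sup>2) = r / r"
      using r by (simp add: norm_divide power_divide sum_divide_distrib[symmetric] r_def[symmetric] del: sum.lessThan_Suc)
    then show "(\<Sum>a<?n. (cmod (v $ a / complex_of_real (sqrt r)))\<^sup>2) = 1" using r by simp
    fix k assume "k < d"
    then show "(\<Sum>a<?n. v $ a / complex_of_real (sqrt r) * \<Psi> a k) = 0"
      using ker[of k] by (simp add: sum_divide_distrib[symmetric] del: sum.lessThan_Suc)
  qed
qed

text \<open>A family of more than \<open>d\<close> columns has a kernel vector, which makes room to mix the
  rank-one matrix of \<open>y\<close> into the Gram matrix without adding a column.\<close>

lemma gram_mix:
  fixes \<epsilon> :: real
  assumes "0 \<le> \<epsilon>" "\<epsilon> \<le> 1"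
  shows "\<exists>\<Phi>. \<forall>k<d. \<forall>j<d. gram (Suc d) \<Phi> k j = (1 - \<epsilon>) * gram (Suc d) \<Psi> k j + \<epsilon> * (y k * cnj (y j))"
proof -
  obtain \<alpha> where a1: "(\<Sum>a<Suc d. (cmod (\<alpha> a))\<^sup>2) = 1"
    and a0: "\<And>k. k < d \<Longrightarrow> (\<Sum>a<Suc d. \<alpha> a * \<Psi> a k) = 0"
    using unit_kernel_vector[of d \<Psi>] by blast
  define s t where "s = complex_of_real (sqrt (1 - \<epsilon>))" and "t = complex_of_real (sqrt \<epsilon>)"
  have s: "s * s = 1 - \<epsilon>" "cnj s = s" and t: "t * t = \<epsilon>" "cnj t = t"
    using assms by (simp_all add: s_def t_def of_real_mult[symmetric] del: of_real_mult)
  have a1': "(\<Sum>a<Suc d. cnj (\<alpha> a) * \<alpha> a) = 1"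
  proof -
    have "(\<Sum>a<Suc d. cnj (\<alpha> a) * \<alpha> a) = complex_of_real (\<Sum>a<Suc d. (cmod (\<alpha> a))\<^sup>2)"
      by (simp only: of_real_sum complex_norm_square mult.commute)
    then show ?thesis by (simp only: a1 of_real_1)
  qed
  have a0': "(\<Sum>a<Suc d. cnj (\<alpha> a) * cnj (\<Psi> a k)) = 0" if "k < d" for k
    using arg_cong[OF a0[OF that], of cnj] by (simp only: cnj_sum complex_cnj_mult complex_cnj_zero)
  \<comment> \<open>The new columns spread \<open>y\<close> along the conjugate of the kernel
    vector. Each cross term then contains a kernel equation and vanishes, while the norm of
    \<open>\<alpha>\<close> gives the last term exactly the weight
    \<open>\<epsilon>\<close>.\<close>
  have "gram (Suc d) (\<lambda>a k. s * \<Psi> a k + t * y k * cnj (\<alpha> a)) k j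
      = (1 - \<epsilon>) * gram (Suc d) \<Psi> k j + \<epsilon> * (y k * cnj (y j))" if "k < d" "j < d" for k j
  proof -
    have "gram (Suc d) (\<lambda>a k. s * \<Psi> a k + t * y k * cnj (\<alpha> a)) k j
      = (\<Sum>a<Suc d. (s * s) * (\<Psi> a k * cnj (\<Psi> a j)) + (s * t * cnj (y j)) * (\<alpha> a * \<Psi> a k)
          + (s * t * y k) * (cnj (\<alpha> a) * cnj (\<Psi> a j)) + (t * t) * (y k * cnj (y j)) * (cnj (\<alpha> a) * \<alpha> a))"
      unfolding gram_def by (intro sum.cong refl) (simp add: s(2) t(2) algebra_simps)
    also have "\<dots> = (s * s) * gram (Suc d) \<Psi> k j + (t * t) * (y k * cnj (y j))"
      unfolding sum.distrib sum_distrib_left[symmetric] a0[OF that(1)] a0'[OF that(2)] a1' gram_def by simp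
    finally show ?thesis by (simp add: s t)
  qed
  then show ?thesis by blast
qed

section \<open>Compactness of the set of column families\<close>

lemma compact_fun_bounded:
  assumes "compact S"
  shows "compact {x :: 'a \<Rightarrow> 'b::topological_space. \<forall>i. x i \<in> S}"
proof -
  have "compactin (product_topology (\<lambda>_. euclidean) UNIV) (PiE (UNIV :: 'a set) (\<lambda>_. S))"
    using assms by (simp add: compactin_PiE)
  moreover have "PiE UNIV (\<lambda>_. S) = {x :: 'a \<Rightarrow> 'b. \<forall>i. x i \<in> S}" by (auto simp: PiE_def)
  ultimately show ?thesis by (simp add: euclidean_product_topology)
qed

lemma continuous_on_entry: "continuous_on S (\<lambda>\<Psi> :: nat \<Rightarrow> nat \<Rightarrow> complex. \<Psi> a k)"
  by (rule continuous_on_product_then_coordinatewise)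
    (rule continuous_on_subset[OF continuous_on_product_coordinates], simp)

text \<open>The disc is a closed part of the continuous image of a square, which is a product of
  compact intervals.\<close>

lemma compact_unit_disc: "compact {z. cmod z \<le> 1}"
proof -
  let ?S = "(\<lambda>p. complex_of_real (fst p) + \<i> * complex_of_real (snd p)) ` ({-1..1} \<times> {-1..1})"
  have "compact ?S"
    by (intro compact_continuous_image compact_Times compact_Icc continuous_intros)
  moreover have "closed {z. cmod z \<le> 1}" by (intro closed_Collect_le continuous_intros)
  ultimately have "compact (?S \<inter> {z. cmod z \<le> 1})" by (rule compact_Int_closed)
  moreover have "z \<in> ?S" if "cmod z \<le> 1" for z
    using that abs_Re_le_cmod[of z] abs_Im_le_cmod[of z]
    by (intro image_eqI[of _ _ "(Re z, Im z)"]) (auto simp: complex_eq[symmetric] abs_le_iff)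
  ultimately show ?thesis by (elim back_subst[of compact]) auto
qed

lemma compact_polydisc: "compact {x :: 'a \<Rightarrow> complex. \<forall>i. cmod (x i) \<le> 1}"
  using compact_fun_bounded[OF compact_unit_disc] by simp

text \<open>One column more than the dimension, so that \<open>gram_mix\<close> applies without
  enlarging the family. The bound covers all indices, including those beyond \<open>d\<close>,
  because compactness in the product topology needs every coordinate confined.\<close>

definition columns :: "nat \<Rightarrow> (nat \<Rightarrow> nat \<Rightarrow> complex) set" where
  "columns d = {\<Psi>. (\<forall>a k. cmod (\<Psi> a k) \<le> 1) \<and> (\<Sum>a<Suc d. sqn d (\<Psi> a)) = 1}"

lemma compact_columns: "compact (columns d)"
proof -
  have "compact {\<Psi> :: nat \<Rightarrow> nat \<Rightarrow> complex. \<forall>a. \<Psi> a \<in> {x. \<forall>i. cmod (x i) \<le> 1}}"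
    by (intro compact_fun_bounded compact_polydisc)
  moreover have "closed {\<Psi> :: nat \<Rightarrow> nat \<Rightarrow> complex. (\<Sum>a<Suc d. sqn d (\<Psi> a)) = 1}"
    unfolding sqn_def by (intro closed_Collect_eq continuous_intros continuous_on_entry)
  ultimately show ?thesis unfolding columns_def by (subst Collect_conj_eq, intro compact_Int_closed) simp_all
qed

section \<open>A saddle point\<close>

text \<open>The right-hand side is the tangent at \<open>A\<close> of the concave square
  root.\<close>

lemma sqrt_add_le:
  assumes "0 < A" "0 \<le> A + B"
  shows "sqrt (A + B) \<le> sqrt A + B / (2 * sqrt A)"
proof (rule real_le_lsqrt)
  have *: "sqrt A + B / (2 * sqrt A) = (2 * A + B) / (2 * sqrt A)"
    using assms(1) by (simp add: field_simps)
  show "0 \<le> sqrt A + B / (2 * sqrt A)" unfolding * using assms by simp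
  have "(2 * A + B)\<^sup>2 = 4 * A * (A + B) + B\<^sup>2" by (simp add: power2_eq_square algebra_simps)
  then have "4 * A * (A + B) \<le> (2 * A + B)\<^sup>2" by simp
  then show "A + B \<le> (sqrt A + B / (2 * sqrt A))\<^sup>2" unfolding * using assms(1)
    by (simp add: field_simps)
qed

text \<open>Adding \<open>s\<^sup>2\<close> makes the modulus smooth at \<open>0\<close>. The
  tangent bound with its explicit quadratic remainder takes the place of a derivative.\<close>

lemma sqrt_add_le_complex:
  fixes z u :: complex and s \<epsilon> :: real
  assumes "0 < s"
  defines "R \<equiv> sqrt ((cmod z)\<^sup>2 + s\<^sup>2)"
  shows "sqrt ((cmod (z + \<epsilon> * u))\<^sup>2 + s\<^sup>2) \<le> R + \<epsilon> * Re (cnj z * u) / R + \<epsilon>\<^sup>2 * ((cmod u)\<^sup>2 / (2 * R))"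
proof -
  have A: "0 < (cmod z)\<^sup>2 + s\<^sup>2" using assms(1) by (simp add: add_nonneg_pos)
  have eq: "(cmod (z + \<epsilon> * u))\<^sup>2 + s\<^sup>2 = ((cmod z)\<^sup>2 + s\<^sup>2) + (2 * \<epsilon> * Re (cnj z * u) + \<epsilon>\<^sup>2 * (cmod u)\<^sup>2)"
    unfolding cmod_power2 by (simp add: power2_eq_square algebra_simps)
  have "sqrt ((cmod (z + \<epsilon> * u))\<^sup>2 + s\<^sup>2) \<le> R + (2 * \<epsilon> * Re (cnj z * u) + \<epsilon>\<^sup>2 * (cmod u)\<^sup>2) / (2 * R)"
    unfolding eq R_def by (rule sqrt_add_le[OF A]) (simp only: eq[symmetric] sum_power2_ge_zero)
  also have "\<dots> = R + \<epsilon> * Re (cnj z * u) / R + \<epsilon>\<^sup>2 * ((cmod u)\<^sup>2 / (2 * R))"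
    by (simp add: add_divide_distrib)
  finally show ?thesis .
qed

text \<open>The first-order test at a minimum: after division by the step, the increase is a slope
  \<open>P\<close> plus a remainder proportional to the step. The same limit argument also lets the
  smoothing tend to \<open>0\<close>.\<close>

lemma nonneg_of_linear_perturbation:
  fixes P R :: real
  assumes "\<And>\<epsilon>. 0 < \<epsilon> \<Longrightarrow> \<epsilon> \<le> 1 \<Longrightarrow> 0 \<le> P + \<epsilon> * R"
  shows "0 \<le> P"
proof (rule ccontr)
  assume "\<not> 0 \<le> P"
  then have P: "P < 0" by simp
  define e where "e = min 1 (- P / (2 * (\<bar>R\<bar> + 1)))"
  have e: "0 < e" "e \<le> 1" using P unfolding e_def by (auto simp: divide_neg_pos)
  have "e * R \<le> e * (\<bar>R\<bar> + 1)" using e by (intro mult_left_mono) auto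
  also have "\<dots> \<le> - P / (2 * (\<bar>R\<bar> + 1)) * (\<bar>R\<bar> + 1)"
    unfolding e_def by (intro mult_right_mono) auto
  also have "\<dots> = - P / 2" by (simp add: field_simps)
  finally show False using assms[OF e] P by simp
qed

lemma continuous_on_diag_form [continuous_intros]:
  "continuous_on S (\<lambda>\<Psi> :: nat \<Rightarrow> nat \<Rightarrow> complex. \<Sum>a<m. diag_form d M (\<Psi> a) k)"
  unfolding diag_form_def by (intro continuous_intros continuous_on_entry)

lemma columns_nonempty: "0 < d \<Longrightarrow> columns d \<noteq> {}"
proof -
  assume "0 < d"
  have "sqn d (\<lambda>k. if a = 0 \<and> k = 0 then 1 else 0) = (if a = 0 then 1 else 0)" for a :: nat
  proof -
    have "sqn d (\<lambda>k. if a = 0 \<and> k = 0 then 1 else 0) = (\<Sum>k<d. if k = 0 then if a = 0 then 1 else 0 else 0)"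
      unfolding sqn_def by (intro sum.cong) auto
    then show ?thesis using \<open>0 < d\<close> by simp
  qed
  then have "(\<lambda>a k. if a = 0 \<and> k = 0 then 1 else 0) \<in> columns d"
    by (simp add: columns_def del: sum.lessThan_Suc)
  then show ?thesis by blast
qed

lemma columns_mix:
  fixes \<epsilon> :: real
  assumes \<Psi>: "\<Psi> \<in> columns d" and y: "sqn d y = 1" and \<epsilon>: "0 \<le> \<epsilon>" "\<epsilon> \<le> 1"
  shows "\<exists>\<Phi>\<in>columns d. \<forall>k<d. (\<Sum>a<Suc d. diag_form d M (\<Phi> a) k)
     = (\<Sum>a<Suc d. diag_form d M (\<Psi> a) k) + \<epsilon> * (diag_form d M y k - (\<Sum>a<Suc d. diag_form d M (\<Psi> a) k))"
proof -
  obtain \<Phi> where \<Phi>: "\<And>k j. k < d \<Longrightarrow> j < d \<Longrightarrow>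
      gram (Suc d) \<Phi> k j = (1 - \<epsilon>) * gram (Suc d) \<Psi> k j + \<epsilon> * (y k * cnj (y j))"
    using gram_mix[OF \<epsilon>, of d \<Psi> y] by blast
  \<comment> \<open>\<open>gram_mix\<close> does not control entries outside the relevant range, but
    \<open>columns\<close> bounds them too; hence they are reset to \<open>0\<close>.\<close>
  define \<Phi>' where "\<Phi>' = (\<lambda>a k. if a < Suc d \<and> k < d then \<Phi> a k else 0)"
  have \<Phi>': "gram (Suc d) \<Phi>' k j = (1 - \<epsilon>) * gram (Suc d) \<Psi> k j + \<epsilon> * (y k * cnj (y j))"
    if "k < d" "j < d" for k j
    using \<Phi>[OF that] that by (simp add: gram_def \<Phi>'_def del: sum.lessThan_Suc)
  have y': "(\<Sum>k<d. y k * cnj (y k)) = 1"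
  proof -
    have "(\<Sum>k<d. y k * cnj (y k)) = complex_of_real (sqn d y)"
      by (simp only: sqn_def of_real_sum complex_norm_square)
    then show ?thesis using y by simp
  qed
  have "complex_of_real (\<Sum>a<Suc d. sqn d (\<Phi>' a)) =
      (1 - \<epsilon>) * complex_of_real (\<Sum>a<Suc d. sqn d (\<Psi> a)) + \<epsilon> * (\<Sum>k<d. y k * cnj (y k))"
    unfolding sum_sqn_gram by (simp add: \<Phi>' sum.distrib sum_distrib_left)
  also have "\<dots> = 1" unfolding y' using \<Psi> by (simp add: columns_def del: sum.lessThan_Suc)
  finally have norm: "(\<Sum>a<Suc d. sqn d (\<Phi>' a)) = 1" using of_real_eq_1_iff by blast
  have "cmod (\<Phi>' a k) \<le> 1" for a k
  proof (cases "a < Suc d \<and> k < d")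
    case True
    then have "(cmod (\<Phi>' a k))\<^sup>2 \<le> sqn d (\<Phi>' a)"
      unfolding sqn_def by (intro member_le_sum) auto
    also have "\<dots> \<le> (\<Sum>a<Suc d. sqn d (\<Phi>' a))"
      using True by (intro member_le_sum[where f = "\<lambda>a. sqn d (\<Phi>' a)"]) auto
    finally show ?thesis using norm by (simp add: power_le_one_iff abs_square_le_1)
  qed (auto simp: \<Phi>'_def)
  then have "\<Phi>' \<in> columns d" using norm by (simp add: columns_def)
  moreover have "(\<Sum>a<Suc d. diag_form d M (\<Phi>' a) k)
     = (\<Sum>a<Suc d. diag_form d M (\<Psi> a) k) + \<epsilon> * (diag_form d M y k - (\<Sum>a<Suc d. diag_form d M (\<Psi> a) k))"
    if "k < d" for k
  proof -
    have "(\<Sum>a<Suc d. diag_form d M (\<Phi>' a) k) = (\<Sum>j<d. (1 - \<epsilon>) * (M j k * gram (Suc d) \<Psi> k j) + \<epsilon> * (y k * (M j k * cnj (y j))))"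
      unfolding sum_diag_form_gram using that by (intro sum.cong refl) (simp add: \<Phi>' algebra_simps)
    also have "\<dots> = (1 - \<epsilon>) * (\<Sum>a<Suc d. diag_form d M (\<Psi> a) k) + \<epsilon> * diag_form d M y k"
      unfolding sum_diag_form_gram by (simp only: sum.distrib sum_distrib_left diag_form_def)
    finally show ?thesis by (simp add: algebra_simps)
  qed
  ultimately show ?thesis by blast
qed

text \<open>The gradient of the smoothed objective at its minimiser is the contraction
  \<open>D\<close>. Smoothing costs at most \<open>s\<close> for each outcome, whence the loss
  \<open>d * s\<close>.\<close>

lemma approximate_saddle_point:
  fixes M :: "nat \<Rightarrow> nat \<Rightarrow> complex" and s :: real
  assumes d: "0 < d" and s: "0 < s"
  shows "\<exists>\<Psi>\<in>columns d. \<exists>D. (\<forall>k. cmod (D k) \<le> 1) \<and> (\<forall>y. sqn d y = 1 \<longrightarrow>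
     (\<Sum>k<d. cmod (\<Sum>a<Suc d. diag_form d M (\<Psi> a) k)) - d * s \<le> Re (\<Sum>k<d. D k * diag_form d M y k))"
proof -
  let ?J = "\<lambda>\<Psi> k. (\<Sum>a<Suc d. diag_form d M (\<Psi> a) k)"
  let ?F = "\<lambda>\<Psi>. \<Sum>k<d. sqrt ((cmod (?J \<Psi> k))\<^sup>2 + s\<^sup>2)"
  have "continuous_on (columns d) ?F" by (intro continuous_intros)
  from continuous_attains_inf[OF compact_columns columns_nonempty[OF d] this]
  obtain \<Psi> where \<Psi>: "\<Psi> \<in> columns d" and min: "\<And>\<Phi>. \<Phi> \<in> columns d \<Longrightarrow> ?F \<Psi> \<le> ?F \<Phi>" by blast
  define z where "z = ?J \<Psi>"
  define R where "R = (\<lambda>k. sqrt ((cmod (z k))\<^sup>2 + s\<^sup>2))"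
  have R: "0 < R k" "cmod (z k) \<le> R k" "R k \<le> cmod (z k) + s" for k
  proof -
    show "0 < R k" unfolding R_def using s by (simp add: add_nonneg_pos)
    show "cmod (z k) \<le> R k" unfolding R_def by (rule real_le_rsqrt) simp
    show "R k \<le> cmod (z k) + s" unfolding R_def using s
      by (intro real_le_lsqrt) (simp_all add: power2_sum)
  qed
  \<comment> \<open>The gradient of the smoothed modulus at \<open>z k\<close>. Since
    \<open>R k\<close> lies between \<open>cmod (z k)\<close> and \<open>cmod (z k) + s\<close>, it
    is a contraction that almost rotates \<open>z k\<close> to its modulus.\<close>
  define D where "D = (\<lambda>k. cnj (z k) / R k)"
  have D1: "cmod (D k) \<le> 1" for k using R[of k] by (simp add: D_def norm_divide)
  have Dz: "cmod (z k) - s \<le> Re (D k * z k)" for k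
  proof -
    have "cmod (z k) - s \<le> (cmod (z k))\<^sup>2 / R k"
    proof -
      have "(cmod (z k) - s) * R k \<le> (cmod (z k))\<^sup>2"
      proof (cases "s \<le> cmod (z k)")
        case True
        then have "(cmod (z k) - s) * R k \<le> (cmod (z k) - s) * (cmod (z k) + s)"
          using R(3) by (intro mult_left_mono) auto
        then show ?thesis using s by (simp add: algebra_simps power2_eq_square) (smt (verit) mult_pos_pos)
      next
        case False
        then have "(cmod (z k) - s) * R k \<le> 0" using R(1)[of k] by (simp add: mult_nonpos_nonneg less_imp_le)
        then show ?thesis by (meson order_trans zero_le_power2)
      qed
      then show ?thesis using R(1) by (simp add: pos_le_divide_eq)
    qed
    moreover have "D k * z k = complex_of_real ((cmod (z k))\<^sup>2 / R k)"
      unfolding D_def of_real_divide complex_norm_square by simp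
    ultimately show ?thesis by simp
  qed
  \<comment> \<open>\<open>P\<close> is the slope of the smoothed objective when the minimiser is
    moved towards the pure state \<open>y\<close>. Its nonnegativity says that the linear functional
    given by \<open>D\<close> is not smaller at \<open>y\<close> than at the minimiser.\<close>
  have main: "Re (\<Sum>k<d. D k * z k) \<le> Re (\<Sum>k<d. D k * diag_form d M y k)" if y: "sqn d y = 1" for y
  proof -
    define u where "u = (\<lambda>k. diag_form d M y k - z k)"
    define P where "P = (\<Sum>k<d. Re (cnj (z k) * u k) / R k)"
    define Q where "Q = (\<Sum>k<d. (cmod (u k))\<^sup>2 / (2 * R k))"
    have "0 \<le> P"
    proof (rule nonneg_of_linear_perturbation)
      fix e :: real assume e: "0 < e" "e \<le> 1"
      obtain \<Phi> where \<Phi>: "\<Phi> \<in> columns d" "\<And>k. k < d \<Longrightarrow> ?J \<Phi> k = z k + e * u k"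
        using columns_mix[OF \<Psi> y, of e M] e unfolding z_def u_def by auto
      have "(\<Sum>k<d. R k) \<le> ?F \<Phi>" using min[OF \<Phi>(1)] by (simp only: R_def z_def)
      also have "\<dots> = (\<Sum>k<d. sqrt ((cmod (z k + e * u k))\<^sup>2 + s\<^sup>2))"
        by (intro sum.cong refl) (simp only: \<Phi>(2) lessThan_iff)
      also have "\<dots> \<le> (\<Sum>k<d. R k + e * Re (cnj (z k) * u k) / R k + e\<^sup>2 * ((cmod (u k))\<^sup>2 / (2 * R k)))"
        unfolding R_def by (intro sum_mono sqrt_add_le_complex[OF s])
      also have "\<dots> = (\<Sum>k<d. R k) + e * (P + e * Q)"
        by (simp add: P_def Q_def sum.distrib sum_distrib_left distrib_left power2_eq_square mult.assoc)
      finally have "0 \<le> e * (P + e * Q)" by simp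
      then show "0 \<le> P + e * Q" using e by (simp add: zero_le_mult_iff)
    qed
    moreover have "P = Re (\<Sum>k<d. D k * diag_form d M y k) - Re (\<Sum>k<d. D k * z k)"
      unfolding P_def Re_sum sum_subtractf[symmetric] D_def u_def
      by (intro sum.cong refl) (simp add: algebra_simps diff_divide_distrib add_divide_distrib)
    ultimately show ?thesis by simp
  qed
  have "(\<Sum>k<d. cmod (z k)) - d * s = (\<Sum>k<d. cmod (z k) - s)" by (simp add: sum_subtractf)
  also have "\<dots> \<le> Re (\<Sum>k<d. D k * z k)" unfolding Re_sum by (intro sum_mono Dz)
  finally have "(\<Sum>k<d. cmod (?J \<Psi> k)) - d * s \<le> Re (\<Sum>k<d. D k * z k)" by (simp only: z_def)
  then show ?thesis using \<Psi> D1 main by (meson order_trans)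
qed

lemma diag_form_scale: "diag_form d M (\<lambda>k. complex_of_real c * y k) k = c\<^sup>2 * diag_form d M y k"
  by (simp add: diag_form_def sum_distrib_left power2_eq_square mult_ac)

lemma sqn_scale: "sqn d (\<lambda>k. c * y k) = (cmod c)\<^sup>2 * sqn d y"
  by (simp add: sqn_def norm_mult power_mult_distrib sum_distrib_left)

lemma sqn_eq_0_iff: "sqn d y = 0 \<longleftrightarrow> (\<forall>k<d. y k = 0)"
  by (auto simp: sqn_def sum_nonneg_eq_0_iff)

text \<open>\<open>\<Psi>\<close> minimises the unsmoothed objective and \<open>D\<close> is a limit
  of approximate duals. They need not arise together, because only the minimal value enters the
  constraints on \<open>D\<close>. Homogeneity extends the bound from unit vectors to all
  \<open>y\<close>.\<close>

lemma saddle_point: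
  fixes M :: "nat \<Rightarrow> nat \<Rightarrow> complex"
  assumes d: "0 < d"
  obtains \<Psi> D where "(\<Sum>a<Suc d. sqn d (\<Psi> a)) = 1" "\<And>k. cmod (D k) \<le> 1"
    "\<And>y. (\<Sum>k<d. cmod (\<Sum>a<Suc d. diag_form d M (\<Psi> a) k)) * sqn d y \<le> Re (\<Sum>k<d. D k * diag_form d M y k)"
proof -
  let ?F = "\<lambda>\<Psi>. \<Sum>k<d. cmod (\<Sum>a<Suc d. diag_form d M (\<Psi> a) k)"
  have "continuous_on (columns d) ?F" by (intro continuous_intros)
  from continuous_attains_inf[OF compact_columns columns_nonempty[OF d] this]
  obtain \<Psi> where \<Psi>: "\<Psi> \<in> columns d" and min: "\<And>\<Phi>. \<Phi> \<in> columns d \<Longrightarrow> ?F \<Psi> \<le> ?F \<Phi>" by blast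
  define F where "F = ?F \<Psi>"
  \<comment> \<open>Contractions paired with a value that they guarantee on all unit vectors. The
    lower end \<open>F - d\<close> is the loss at \<open>s = 1\<close>, so every approximation with
    \<open>s \<le> 1\<close> lies in this compact set; the largest value in it is then at least
    \<open>F\<close>.\<close>
  define T where "T = ({D :: nat \<Rightarrow> complex. \<forall>k. cmod (D k) \<le> 1} \<times> {F - d..F}) \<inter>
     (\<Inter>y\<in>{y. sqn d y = 1}. {p. snd p \<le> Re (\<Sum>k<d. fst p k * diag_form d M y k)})"
  have ge: "\<exists>D. (D, F - d * s) \<in> T" if s: "0 < s" "s \<le> 1" for s :: real
  proof -
    obtain \<Phi> D where \<Phi>: "\<Phi> \<in> columns d" "\<forall>k. cmod (D k) \<le> 1"
      "\<And>y. sqn d y = 1 \<Longrightarrow> ?F \<Phi> - d * s \<le> Re (\<Sum>k<d. D k * diag_form d M y k)"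
      using approximate_saddle_point[OF d s(1), of M] by blast
    have "F - d * s \<le> ?F \<Phi> - d * s" using min[OF \<Phi>(1)] by (simp only: F_def)
    then have "F - d * s \<le> Re (\<Sum>k<d. D k * diag_form d M y k)" if "sqn d y = 1" for y
      using \<Phi>(3)[OF that] by (rule order_trans)
    then show ?thesis using \<Phi>(2) s by (auto simp: T_def intro!: exI[of _ D] mult_left_le)
  qed
  have cont: "continuous_on UNIV (\<lambda>p :: (nat \<Rightarrow> complex) \<times> real. fst p k)" for k
    by (rule continuous_on_product_then_coordinatewise) (rule continuous_on_fst[OF continuous_on_id])
  have "compact T" unfolding T_def
    by (intro compact_Int_closed compact_Times compact_polydisc compact_Icc closed_INT ballI closed_Collect_le
        continuous_intros cont)
  moreover have "T \<noteq> {}" using ge[of 1] by auto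
  ultimately obtain p where "p \<in> T" "\<forall>p'\<in>T. snd p' \<le> snd p"
    using continuous_attains_sup[of T snd] continuous_on_snd[OF continuous_on_id, of T] by auto
  then obtain D c where D: "(D, c) \<in> T" and max: "\<And>p. p \<in> T \<Longrightarrow> snd p \<le> c" by (cases p) auto
  have "0 \<le> (c - F) + s * d" if "0 < s" "s \<le> 1" for s :: real
    using ge[OF that] max by (fastforce simp: mult.commute)
  from nonneg_of_linear_perturbation[OF this] have cF: "F \<le> c" by simp
  have "F * sqn d y \<le> Re (\<Sum>k<d. D k * diag_form d M y k)" for y
  proof (cases "sqn d y = 0")
    case True
    then have "y k = 0" if "k < d" for k using that sqn_eq_0_iff by blast
    then show ?thesis using True by (simp add: diag_form_def)
  next
    case False
    define r where "r = sqrt (sqn d y)"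
    have r: "0 < r" "r\<^sup>2 = sqn d y" using False sqn_nonneg[of d y] by (simp_all add: r_def less_eq_real_def)
    define x where "x = (\<lambda>k. complex_of_real (1 / r) * y k)"
    have yx: "y = (\<lambda>k. complex_of_real r * x k)" using r by (auto simp: x_def)
    have "sqn d x = 1" unfolding x_def sqn_scale using r False by (simp add: norm_divide power_divide)
    then have "c \<le> Re (\<Sum>k<d. D k * diag_form d M x k)" using D by (simp add: T_def)
    then have "F \<le> Re (\<Sum>k<d. D k * diag_form d M x k)" using cF by simp
    then have "sqn d y * F \<le> r\<^sup>2 * Re (\<Sum>k<d. D k * diag_form d M x k)"
      unfolding r(2)[symmetric] by (intro mult_left_mono) auto
    also have "\<dots> = Re (\<Sum>k<d. D k * diag_form d M y k)"
      unfolding yx diag_form_scale Re_sum sum_distrib_left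
      by (intro sum.cong refl) (simp add: algebra_simps power2_eq_square)
    finally show ?thesis by (simp add: mult.commute)
  qed
  then show thesis using that[of \<Psi> D] \<Psi> D unfolding F_def by (simp add: columns_def T_def)
qed

section \<open>Functions as vectors and unitary matrices\<close>

definition mapp :: "nat \<Rightarrow> (nat \<Rightarrow> nat \<Rightarrow> complex) \<Rightarrow> (nat \<Rightarrow> complex) \<Rightarrow> nat \<Rightarrow> complex" where
  "mapp d M x i = (\<Sum>k<d. M i k * x k)"

definition madj :: "(nat \<Rightarrow> nat \<Rightarrow> complex) \<Rightarrow> nat \<Rightarrow> nat \<Rightarrow> complex" where
  "madj M i k = cnj (M k i)"

definition cip :: "nat \<Rightarrow> (nat \<Rightarrow> complex) \<Rightarrow> (nat \<Rightarrow> complex) \<Rightarrow> complex" where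
  "cip d x y = (\<Sum>k<d. cnj (x k) * y k)"

definition unitary_fun :: "nat \<Rightarrow> (nat \<Rightarrow> nat \<Rightarrow> complex) \<Rightarrow> bool" where
  "unitary_fun d M \<longleftrightarrow>
     (\<forall>i<d. \<forall>k<d. (\<Sum>j<d. cnj (M j i) * M j k) = (if i = k then 1 else 0)) \<and>
     (\<forall>i<d. \<forall>k<d. (\<Sum>j<d. M i j * cnj (M k j)) = (if i = k then 1 else 0))"

lemma unitary_fun_madj: "unitary_fun d M \<Longrightarrow> unitary_fun d (madj M)"
  by (simp add: unitary_fun_def madj_def mult.commute)

lemma unitary_fun_phase:
  assumes "unitary_fun d M" and E: "\<And>k. cmod (E k) = 1"
  shows "unitary_fun d (\<lambda>j k. M j k * E k)"
proof -
  have E': "E k * cnj (E k) = 1" for k using E[of k] by (simp add: complex_norm_square[symmetric])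
  have "(\<Sum>j<d. cnj (M j i * E i) * (M j k * E k)) = cnj (E i) * E k * (\<Sum>j<d. cnj (M j i) * M j k)" for i k
    by (simp add: sum_distrib_left mult_ac)
  moreover have "M i j * E j * cnj (M k j * E j) = M i j * cnj (M k j)" for i j k
    using E'[of j] by (simp add: mult_ac)
  ultimately show ?thesis using assms(1) E' unfolding unitary_fun_def by (simp only:) (simp add: mult.commute)
qed

lemma mapp_cong: "(\<And>k. k < d \<Longrightarrow> x k = y k) \<Longrightarrow> mapp d M x i = mapp d M y i"
  by (simp add: mapp_def)

lemma mapp_add: "mapp d M (\<lambda>k. x k + y k) i = mapp d M x i + mapp d M y i"
  and mapp_diff: "mapp d M (\<lambda>k. x k - y k) i = mapp d M x i - mapp d M y i"
  and mapp_scale: "mapp d M (\<lambda>k. c * x k) i = c * mapp d M x i"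
  by (simp_all add: mapp_def distrib_left right_diff_distrib sum.distrib sum_subtractf sum_distrib_left mult_ac)

lemma cip_cong: "(\<And>k. k < d \<Longrightarrow> x k = x' k) \<Longrightarrow> (\<And>k. k < d \<Longrightarrow> y k = y' k) \<Longrightarrow> cip d x y = cip d x' y'"
  by (simp add: cip_def)

lemma cip_add_right: "cip d x (\<lambda>k. y k + z k) = cip d x y + cip d x z"
  and cip_diff_right: "cip d x (\<lambda>k. y k - z k) = cip d x y - cip d x z"
  and cip_scale_right: "cip d x (\<lambda>k. c * y k) = c * cip d x y"
  and cip_add_left: "cip d (\<lambda>k. y k + z k) x = cip d y x + cip d z x"
  and cip_diff_left: "cip d (\<lambda>k. y k - z k) x = cip d y x - cip d z x"
  and cip_scale_left: "cip d (\<lambda>k. c * y k) x = cnj c * cip d y x"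
  by (simp_all add: cip_def algebra_simps sum.distrib sum_subtractf sum_distrib_left)

lemmas cip_linear = cip_add_right cip_diff_right cip_scale_right cip_add_left cip_diff_left cip_scale_left

lemma cip_commute: "cip d y x = cnj (cip d x y)"
  by (simp add: cip_def mult.commute)

lemma cip_self: "cip d x x = complex_of_real (sqn d x)"
  by (simp only: cip_def sqn_def of_real_sum complex_norm_square mult.commute)

lemma cip_madj: "cip d (mapp d (madj M) x) y = cip d x (mapp d M y)"
proof -
  have "cip d (mapp d (madj M) x) y = (\<Sum>k<d. \<Sum>j<d. cnj (x j) * (M j k * y k))"
    by (simp add: cip_def mapp_def madj_def sum_distrib_left sum_distrib_right mult_ac)
  also have "\<dots> = (\<Sum>j<d. \<Sum>k<d. cnj (x j) * (M j k * y k))" by (rule sum.swap)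
  finally show ?thesis by (simp add: cip_def mapp_def sum_distrib_left)
qed

lemma madj_mapp_cancel:
  assumes "unitary_fun d M" "i < d"
  shows "mapp d (madj M) (mapp d M x) i = x i"
proof -
  have "mapp d (madj M) (mapp d M x) i = (\<Sum>j<d. \<Sum>k<d. cnj (M j i) * M j k * x k)"
    by (simp add: mapp_def madj_def sum_distrib_left mult_ac)
  also have "\<dots> = (\<Sum>k<d. \<Sum>j<d. cnj (M j i) * M j k * x k)" by (rule sum.swap)
  also have "\<dots> = (\<Sum>k<d. (if i = k then 1 else 0) * x k)"
    unfolding sum_distrib_right[symmetric] using assms by (intro sum.cong refl) (simp add: unitary_fun_def)
  also have "\<dots> = x i" using assms(2) by (simp add: if_distrib[of "\<lambda>c. c * _"] cong: if_cong)
  finally show ?thesis .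
qed

lemma sqn_mapp:
  assumes "unitary_fun d M"
  shows "sqn d (mapp d M x) = sqn d x"
proof -
  have "complex_of_real (sqn d (mapp d M x)) = cip d (mapp d (madj M) (mapp d M x)) x"
    unfolding cip_self[symmetric] by (simp only: cip_madj)
  also have "\<dots> = complex_of_real (sqn d x)"
    unfolding cip_self[symmetric] by (rule cip_cong) (simp_all add: madj_mapp_cancel[OF assms])
  finally show ?thesis by simp
qed

lemma sum_diag_form: "(\<Sum>k<d. diag_form d M x k) = cip d x (mapp d M x)"
proof -
  have "(\<Sum>k<d. diag_form d M x k) = (\<Sum>k<d. \<Sum>j<d. cnj (x j) * (M j k * x k))"
    by (simp add: diag_form_def sum_distrib_left mult_ac)
  also have "\<dots> = (\<Sum>j<d. \<Sum>k<d. cnj (x j) * (M j k * x k))" by (rule sum.swap)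
  finally show ?thesis by (simp add: cip_def mapp_def sum_distrib_left)
qed

text \<open>The amplitudes of outcome \<open>k\<close> are \<open>x k\<close> in the computational
  basis and \<open>mapp d (madj M) x k\<close> in the basis of the columns of \<open>M\<close>, so
  \<open>diag_form\<close> is, up to conjugation, the share of outcome \<open>k\<close> in the
  overlap of the two hypotheses.\<close>

lemma diag_form_madj: "diag_form d M x k = x k * cnj (mapp d (madj M) x k)"
  by (simp add: diag_form_def mapp_def madj_def)

lemma diag_form_phase: "diag_form d (\<lambda>j k. M j k * E k) x k = E k * diag_form d M x k"
  by (simp add: diag_form_def sum_distrib_left mult_ac)

lemma sqn_add: "sqn d (\<lambda>k. x k + y k) = sqn d x + 2 * Re (cip d x y) + sqn d y"
proof -
  have "complex_of_real (sqn d (\<lambda>k. x k + y k)) = cip d x x + cip d x y + cnj (cip d x y) + cip d y y"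
    unfolding cip_self[symmetric] cip_linear using cip_commute[of d x y] by simp
  from arg_cong[OF this, of Re] show ?thesis unfolding cip_self by simp
qed

text \<open>The hermitian form \<open>Re (cip d x (mapp d M x)) - c * sqn d x\<close> is nonnegative
  and vanishes at \<open>x\<close>, so its gradient vanishes there as well.\<close>

lemma real_part_minimizer:
  fixes c :: real and x :: "nat \<Rightarrow> complex"
  assumes ge: "\<And>x. c * sqn d x \<le> Re (cip d x (mapp d M x))"
    and eq: "Re (cip d x (mapp d M x)) = c * sqn d x" and "k < d"
  shows "mapp d M x k + mapp d (madj M) x k = 2 * c * x k"
proof -
  define g where "g = (\<lambda>k. mapp d M x k + mapp d (madj M) x k - 2 * c * x k)"
  have expand: "Re (cip d (\<lambda>k. x k + e * y k) (mapp d M (\<lambda>k. x k + e * y k))) - c * sqn d (\<lambda>k. x k + e * y k)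
     = e * Re (cip d y g) + e\<^sup>2 * (Re (cip d y (mapp d M y)) - c * sqn d y)" for e :: real and y :: "nat \<Rightarrow> complex"
  proof -
    have m: "cip d z (mapp d M (\<lambda>k. x k + e * y k)) = cip d z (mapp d M x) + e * cip d z (mapp d M y)" for z
      unfolding cip_scale_right[symmetric] cip_add_right[symmetric]
      by (rule cip_cong) (simp_all add: mapp_add mapp_scale)
    have a: "Re (cip d x (mapp d M y)) = Re (cip d y (mapp d (madj M) x))"
      using cip_commute[of d y "mapp d (madj M) x"] by (simp add: cip_madj)
    have g: "Re (cip d y g) = Re (cip d y (mapp d M x)) + Re (cip d y (mapp d (madj M) x)) - 2 * c * Re (cip d y x)"
      unfolding g_def by (simp add: cip_linear)
    have s: "sqn d (\<lambda>k. x k + e * y k) = sqn d x + 2 * e * Re (cip d y x) + e\<^sup>2 * sqn d y"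
      unfolding sqn_add sqn_scale by (simp add: cip_linear cip_commute[of d x y])
    show ?thesis unfolding s g m using eq a
      by (simp add: cip_linear algebra_simps power2_eq_square)
  qed
  \<comment> \<open>A step of length \<open>e\<close> against the gradient \<open>g\<close> has
    first-order effect \<open>- e * sqn d g\<close>.\<close>
  have "0 \<le> - sqn d g + e * (Re (cip d g (mapp d M g)) - c * sqn d g)" if "0 < e" "e \<le> 1" for e :: real
  proof -
    have "0 \<le> (- e) * sqn d g + (- e)\<^sup>2 * (Re (cip d g (mapp d M g)) - c * sqn d g)"
      using expand[of "- e" g] ge[of "\<lambda>k. x k + complex_of_real (- e) * g k"] unfolding cip_self by simp
    also have "\<dots> = e * (- sqn d g + e * (Re (cip d g (mapp d M g)) - c * sqn d g))"
      by (simp add: power2_eq_square algebra_simps)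
    finally show ?thesis using that by (simp add: zero_le_mult_iff)
  qed
  from nonneg_of_linear_perturbation[OF this] have "sqn d g = 0" using sqn_nonneg[of d g] by simp
  then have "g k = 0" using \<open>k < d\<close> sqn_eq_0_iff by blast
  then show ?thesis by (simp add: g_def)
qed

lemma real_part_minimizer_exists:
  assumes "0 < d"
  obtains x c where "sqn d x = 1" "Re (cip d x (mapp d M x)) = c"
    "\<And>y. c * sqn d y \<le> Re (cip d y (mapp d M y))"
proof -
  let ?S = "{x :: nat \<Rightarrow> complex. \<forall>i. cmod (x i) \<le> 1} \<inter> {x. sqn d x = 1}"
  let ?f = "\<lambda>x. Re (cip d x (mapp d M x))"
  have cp: "compact ?S" unfolding sqn_def
    by (intro compact_Int_closed compact_polydisc closed_Collect_eq continuous_intros continuous_on_product_coordinates)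
  have mem: "(\<lambda>k. if k = 0 then 1 else 0) \<in> ?S"
  proof -
    have "sqn d (\<lambda>k. if k = 0 then 1 else 0) = (\<Sum>k<d. if k = 0 then 1 else 0)"
      unfolding sqn_def by (intro sum.cong) auto
    then show ?thesis using assms by simp
  qed
  have ct: "continuous_on ?S ?f" unfolding cip_def mapp_def
    by (intro continuous_intros continuous_on_subset[OF continuous_on_product_coordinates]) auto
  have "?S \<noteq> {}" using mem by (metis empty_iff)
  from continuous_attains_inf[OF cp this ct] obtain x where x: "x \<in> ?S" and min: "\<And>y. y \<in> ?S \<Longrightarrow> ?f x \<le> ?f y" by blast
  have "?f x * sqn d y \<le> ?f y" for y
  proof (cases "sqn d y = 0")
    case True
    then have "y k = 0" if "k < d" for k using that sqn_eq_0_iff by blast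
    then show ?thesis using True by (simp add: cip_def)
  next
    case False
    define r where "r = sqrt (sqn d y)"
    have r: "0 < r" "r\<^sup>2 = sqn d y" using False sqn_nonneg[of d y] by (simp_all add: r_def less_eq_real_def)
    define z where "z = (\<lambda>k. if k < d then complex_of_real (1 / r) * y k else 0)"
    have "sqn d z = sqn d (\<lambda>k. complex_of_real (1 / r) * y k)" by (simp add: sqn_def z_def)
    then have z1: "sqn d z = 1" unfolding sqn_scale using r False by (simp add: norm_divide power_divide)
    have "cmod (z k) \<le> 1" for k
    proof (cases "k < d")
      case True
      then have "(cmod (z k))\<^sup>2 \<le> sqn d z" unfolding sqn_def by (intro member_le_sum) auto
      then show ?thesis using z1 by (simp add: power_le_one_iff abs_square_le_1)
    qed (simp add: z_def)
    then have "?f x \<le> ?f z" using z1 by (intro min) simp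
    moreover have "?f y = r\<^sup>2 * ?f z"
    proof -
      have yz: "y k = complex_of_real r * z k" if "k < d" for k using that r by (simp add: z_def)
      have "cip d y (mapp d M y) = cip d (\<lambda>k. complex_of_real r * z k) (mapp d M (\<lambda>k. complex_of_real r * z k))"
        by (rule cip_cong) (simp_all add: yz mapp_def)
      also have "\<dots> = complex_of_real r * cip d z (\<lambda>k. complex_of_real r * mapp d M z k)"
        unfolding cip_scale_left by (simp add: mapp_scale[abs_def])
      finally show ?thesis by (simp add: cip_linear power2_eq_square)
    qed
    ultimately have "sqn d y * ?f x \<le> ?f y" unfolding r(2)[symmetric] by (simp add: mult_left_mono)
    then show ?thesis by (simp add: mult.commute)
  qed
  then show thesis using that x by blast
qed

section \<open>Extremal eigenvectors with equal diagonals\<close>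

text \<open>Applying \<open>q\<close> to the assumption shows that
  \<open>(q - l) (q - cnj l)\<close> annihilates \<open>x\<close>. Hence
  \<open>(q - cnj l) x\<close> lies in the eigenspace of \<open>q\<close> for \<open>l\<close>,
  which is that of the adjoint for \<open>cnj l\<close>.\<close>

lemma adjoint_eigenvector_split:
  fixes l :: complex
  assumes u: "unitary_fun d q" and l: "l * cnj l = 1"
    and eq: "\<And>k. k < d \<Longrightarrow> mapp d q x k + mapp d (madj q) x k = (l + cnj l) * x k" and k: "k < d"
  shows "mapp d (madj q) (\<lambda>k. mapp d q x k - cnj l * x k) k = cnj l * (mapp d q x k - cnj l * x k)"
proof -
  have "mapp d (madj q) x k = (l + cnj l) * x k - mapp d q x k"
    using eq[OF k] by (metis add_diff_cancel_left')
  then have "mapp d (madj q) (\<lambda>k. mapp d q x k - cnj l * x k) k = x k - cnj l * ((l + cnj l) * x k - mapp d q x k)"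
    by (simp add: mapp_diff mapp_scale madj_mapp_cancel[OF u k])
  also have "\<dots> = x k - (l * cnj l) * x k + cnj l * (mapp d q x k - cnj l * x k)"
    by (simp add: algebra_simps)
  finally show ?thesis by (simp add: l)
qed

text \<open>The least real part is attained by a vector of norm one, at which the hermitian part
  acts as a multiple of the identity. Unitarity then splits this vector into eigenvectors for the
  two points of the unit circle with that real part, and at least one of the pieces is
  nonzero.\<close>

lemma unitary_extremal_eigenvector:
  assumes "0 < d" and u: "unitary_fun d q"
  obtains y l where "0 < sqn d y" "\<And>k. k < d \<Longrightarrow> mapp d (madj q) y k = cnj l * y k"
    "Re l \<le> 1" "\<And>x. Re l * sqn d x \<le> Re (cip d x (mapp d q x))"
proof -
  obtain x c where x: "sqn d x = 1" "Re (cip d x (mapp d q x)) = c"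
    and ge: "\<And>y. c * sqn d y \<le> Re (cip d y (mapp d q y))"
    using real_part_minimizer_exists[OF \<open>0 < d\<close>, of q] by blast
  have eq: "mapp d q x k + mapp d (madj q) x k = 2 * c * x k" if "k < d" for k
    using real_part_minimizer[OF ge _ that] x by simp
  have "0 \<le> sqn d (\<lambda>k. x k + mapp d q x k)" by simp
  then have c1: "- 1 \<le> c" unfolding sqn_add sqn_mapp[OF u] using x by simp
  have "0 \<le> sqn d (\<lambda>k. (- 1) * x k + mapp d q x k)" by (rule sqn_nonneg)
  then have c2: "c \<le> 1" unfolding sqn_add sqn_mapp[OF u] sqn_scale cip_scale_left using x by simp
  define l where "l = Complex c (sqrt (1 - c\<^sup>2))"
  have c3: "c\<^sup>2 \<le> 1" using c1 c2 by (simp add: abs_le_iff abs_square_le_1)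
  have l: "l * cnj l = 1" "l + cnj l = 2 * c" "Re l = c"
    using c3 by (simp_all add: l_def complex_eq_iff power2_eq_square)
  define y where "y = (\<lambda>k. mapp d q x k - cnj l * x k)"
  show thesis
  proof (cases "sqn d y = 0")
    case False
    then have "0 < sqn d y" using sqn_nonneg[of d y] by linarith
    moreover have "mapp d (madj q) y k = cnj l * y k" if "k < d" for k
      unfolding y_def by (rule adjoint_eigenvector_split[OF u l(1) _ that]) (simp add: eq l(2))
    ultimately show thesis using that l(3) c2 ge by blast
  next
    case True
    \<comment> \<open>The projection onto the eigenspace for \<open>l\<close> is zero, so
      \<open>x\<close> itself is an eigenvector, for the conjugate eigenvalue with the same real
      part.\<close>
    have "mapp d (madj q) x k = cnj (cnj l) * x k" if "k < d" for k
    proof -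
      have "mapp d q x k = cnj l * x k" using True that unfolding sqn_eq_0_iff y_def by simp
      then have "cnj l * x k + mapp d (madj q) x k = (l + cnj l) * x k" using eq[OF that] l(2) by simp
      then show ?thesis by (simp add: distrib_right)
    qed
    moreover have "0 < sqn d x" using x by simp
    ultimately show thesis using that[of x "cnj l"] l(3) c2 ge by simp
  qed
qed

lemma cmod_diff_mult_square:
  "(cmod (u - cnj l * v))\<^sup>2 = (cmod u)\<^sup>2 + (cmod l)\<^sup>2 * (cmod v)\<^sup>2 - 2 * Re (l * (u * cnj v))"
  unfolding cmod_power2 by (simp add: algebra_simps power2_eq_square)

text \<open>Each \<open>Re (D k * z k)\<close> is at most \<open>cmod (z k)\<close>, so the reverse
  inequality between the sums forces equality termwise. Where \<open>z k\<close> is nonzero this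
  makes \<open>D k\<close> unimodular and equal to its phase \<open>E k\<close>.\<close>

lemma phase_alignment:
  fixes D E z :: "nat \<Rightarrow> complex"
  assumes D1: "\<And>k. cmod (D k) \<le> 1" and le: "(\<Sum>k<d. cmod (z k)) \<le> Re (\<Sum>k<d. D k * z k)"
    and DE: "D k = cmod (D k) * E k" and E: "cmod (E k) = 1" and k: "k < d"
  shows "E k * z k = cmod (z k)"
proof -
  have le1: "cmod (D k * z k) \<le> cmod (z k)" for k
    using mult_right_mono[OF D1[of k] norm_ge_zero[of "z k"]] by (simp add: norm_mult)
  have le2: "Re (D k * z k) \<le> cmod (z k)" for k
    using complex_Re_le_cmod le1 order_trans by blast
  have "(\<Sum>k<d. cmod (z k) - Re (D k * z k)) \<le> 0" using le by (simp add: sum_subtractf)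
  moreover have "0 \<le> (\<Sum>k<d. cmod (z k) - Re (D k * z k))" using le2 by (intro sum_nonneg) simp
  ultimately have "(\<Sum>k<d. cmod (z k) - Re (D k * z k)) = 0" by simp
  then have eq: "Re (D k * z k) = cmod (z k)"
    using k le2 by (subst (asm) sum_nonneg_eq_0_iff) auto
  show ?thesis
  proof (cases "z k = 0")
    case False
    have "cmod (z k) \<le> cmod (D k) * cmod (z k)" using complex_Re_le_cmod[of "D k * z k"] eq by (simp add: norm_mult)
    then have "cmod (D k) = 1" using False D1[of k] by (simp add: le_less)
    then have "D k = E k" using DE by simp
    then have "Re (E k * z k) = cmod (E k * z k)" using eq E by (simp add: norm_mult)
    moreover have "Im (E k * z k) = 0" using calculation cmod_power2[of "E k * z k"] by simp
    ultimately have "E k * z k = cmod (E k * z k)" by (metis complex_eq_iff Im_complex_of_real Re_complex_of_real)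
    then show ?thesis using E by (simp add: norm_mult)
  qed simp
qed

text \<open>The cases are a vanishing and a positive minimum of the objective. In the second one
  \<open>b\<close> selects the eigenvalue; that \<open>p\<close> does not depend on \<open>b\<close>
  keeps the outcome statistics the same for every choice of spectral parts in a product.\<close>

lemma unitary_alternative:
  assumes d: "0 < d" and U: "unitary_fun d M"
  obtains (orthogonal) \<Psi> where "(\<Sum>a<Suc d. sqn d (\<Psi> a)) = 1"
      "\<And>k. k < d \<Longrightarrow> (\<Sum>a<Suc d. cnj (\<Psi> a k) * mapp d (madj M) (\<Psi> a) k) = 0"
  | (extremal) E t X p where "\<And>k. cmod (E k) = 1" "0 \<le> t" "t < pi / 2"
      "\<And>x. cos t * sqn d x \<le> Re (cip d x (mapp d (\<lambda>j k. M j k * E k) x))"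
      "(\<Sum>k<d. p k) = 1" "\<And>b k. k < d \<Longrightarrow> (\<Sum>a<Suc d. (cmod (X b a k))\<^sup>2) = p k"
      "\<And>b a k. k < d \<Longrightarrow> mapp d (madj (\<lambda>j k. M j k * E k)) (X b a) k = cis (if b then - t else t) * X b a k"
proof -
  obtain \<Psi> D where \<Psi>: "(\<Sum>a<Suc d. sqn d (\<Psi> a)) = 1" and D1: "\<And>k. cmod (D k) \<le> 1"
    and saddle: "\<And>y. (\<Sum>k<d. cmod (\<Sum>a<Suc d. diag_form d M (\<Psi> a) k)) * sqn d y \<le> Re (\<Sum>k<d. D k * diag_form d M y k)"
    using saddle_point[OF d, of M] by blast
  define z where "z = (\<lambda>k. \<Sum>a<Suc d. diag_form d M (\<Psi> a) k)"
  define c where "c = (\<Sum>k<d. cmod (z k))"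
  have saddle: "c * sqn d y \<le> Re (\<Sum>k<d. D k * diag_form d M y k)" for y
    unfolding c_def z_def by (rule saddle)
  have c0: "0 \<le> c" unfolding c_def by (simp add: sum_nonneg)
  show thesis
  proof (cases "c = 0")
    case True
    have "(\<Sum>a<Suc d. cnj (\<Psi> a k) * mapp d (madj M) (\<Psi> a) k) = 0" if "k < d" for k
    proof -
      have "z k = 0" using True that unfolding c_def by (simp add: sum_nonneg_eq_0_iff)
      moreover have "cnj (z k) = (\<Sum>a<Suc d. cnj (\<Psi> a k) * mapp d (madj M) (\<Psi> a) k)"
        unfolding z_def diag_form_madj by (simp only: cnj_sum complex_cnj_mult complex_cnj_cnj)
      ultimately show ?thesis by simp
    qed
    then show thesis using orthogonal \<Psi> by blast
  next
    case False
    then have c: "0 < c" using c0 by simp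
    \<comment> \<open>Where \<open>D\<close> vanishes any phase would do, and \<open>1\<close> is
      taken.\<close>
    define E where "E = (\<lambda>k. if D k = 0 then 1 else D k / cmod (D k))"
    have E: "cmod (E k) = 1" for k by (simp add: E_def norm_divide)
    have DE: "D k = cmod (D k) * E k" for k by (simp add: E_def)
    define q where "q = (\<lambda>j k. M j k * E k)"
    have u: "unitary_fun d q" unfolding q_def by (rule unitary_fun_phase[OF U E])
    have df: "diag_form d q x k = E k * diag_form d M x k" for x k
      unfolding q_def by (rule diag_form_phase)
    obtain y l where y: "0 < sqn d y" "\<And>k. k < d \<Longrightarrow> mapp d (madj q) y k = cnj l * y k"
      and l1: "Re l \<le> 1" and l: "\<And>x. Re l * sqn d x \<le> Re (cip d x (mapp d q x))"
      using unitary_extremal_eigenvector[OF d u] by blast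
    \<comment> \<open>On an eigenvector of \<open>q\<close> every term of the saddle inequality is
      \<open>l\<close> times the nonnegative weight
      \<open>cmod (D k) * (cmod (y k))\<^sup>2\<close>. These weights sum to at most
      \<open>sqn d y\<close>, so \<open>c \<le> Re l\<close>: replacing the contraction by its
      phases does not lower the guaranteed value.\<close>
    define r where "r = (\<Sum>k<d. cmod (D k) * (cmod (y k))\<^sup>2)"
    have "Re (\<Sum>k<d. D k * diag_form d M y k) = Re l * r"
    proof -
      have "D k * diag_form d M y k = l * complex_of_real (cmod (D k) * (cmod (y k))\<^sup>2)" if "k < d" for k
      proof -
        have "D k * diag_form d M y k = cmod (D k) * diag_form d q y k" unfolding df by (subst DE) simp
        also have "diag_form d q y k = l * (y k * cnj (y k))" unfolding diag_form_madj y(2)[OF that] by simp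
        finally show ?thesis unfolding of_real_mult complex_norm_square by simp
      qed
      then have "(\<Sum>k<d. D k * diag_form d M y k) = l * complex_of_real r"
        unfolding r_def of_real_sum sum_distrib_left by simp
      then show ?thesis by simp
    qed
    then have lr: "c * sqn d y \<le> Re l * r" using saddle[of y] by simp
    have r: "0 \<le> r" "r \<le> sqn d y"
      unfolding r_def sqn_def using D1 by (auto intro!: sum_nonneg sum_mono mult_left_le_one_le)
    have "0 < Re l" using lr mult_pos_pos[OF c y(1)] r(1) by (smt (verit) mult_nonneg_nonneg mult_nonpos_nonneg)
    then have "c * sqn d y \<le> Re l * sqn d y" using lr r(2) by (meson less_imp_le mult_left_mono order_trans)
    then have cl: "c \<le> Re l" using y(1) by simp
    have ge: "c * sqn d x \<le> Re (cip d x (mapp d q x))" for x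
      using l[of x] mult_right_mono[OF cl sqn_nonneg[of d x]] by linarith
    have Dz: "(\<Sum>k<d. cmod (z k)) \<le> Re (\<Sum>k<d. D k * z k)"
    proof -
      have "c = (\<Sum>a<Suc d. c * sqn d (\<Psi> a))" unfolding sum_distrib_left[symmetric] \<Psi> by simp
      also have "\<dots> \<le> (\<Sum>a<Suc d. Re (\<Sum>k<d. D k * diag_form d M (\<Psi> a) k))" by (intro sum_mono saddle)
      also have "\<dots> = Re (\<Sum>k<d. D k * z k)"
        unfolding z_def sum_distrib_left Re_sum[symmetric] by (subst sum.swap) simp
      finally show ?thesis by (simp add: c_def)
    qed
    have Ez: "E k * z k = cmod (z k)" if "k < d" for k
      by (rule phase_alignment[where D = D and E = E and k = k, OF D1 Dz DE E that])
    \<comment> \<open>With the phases aligned, the columns together attain the lower bound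
      \<open>c\<close>. None can fall below it, so each attains it and satisfies the eigenvalue
      equation of the hermitian part.\<close>
    have "(\<Sum>a<Suc d. Re (cip d (\<Psi> a) (mapp d q (\<Psi> a))) - c * sqn d (\<Psi> a)) = 0"
    proof -
      have "(\<Sum>a<Suc d. cip d (\<Psi> a) (mapp d q (\<Psi> a))) = (\<Sum>k<d. E k * z k)"
        unfolding sum_diag_form[symmetric] df z_def sum_distrib_left by (rule sum.swap)
      also have "\<dots> = complex_of_real c" using Ez by (simp add: c_def)
      finally have "(\<Sum>a<Suc d. Re (cip d (\<Psi> a) (mapp d q (\<Psi> a)))) = c"
        unfolding Re_sum[symmetric] by simp
      then show ?thesis unfolding sum_subtractf sum_distrib_left[symmetric] \<Psi> by simp
    qed
    then have min: "Re (cip d (\<Psi> a) (mapp d q (\<Psi> a))) = c * sqn d (\<Psi> a)" if "a < Suc d" for a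
      using that ge by (subst (asm) sum_nonneg_eq_0_iff) auto
    have eq: "mapp d q (\<Psi> a) k + mapp d (madj q) (\<Psi> a) k = 2 * c * \<Psi> a k" if "a < Suc d" "k < d" for a k
      by (rule real_part_minimizer[OF ge min[OF that(1)] that(2)])
    have c1: "c \<le> 1" using cl l1 by simp
    define t where "t = arccos c"
    have t: "0 \<le> t" "t < pi / 2" "cos t = c"
      using c c1 arccos_less_arccos[of 0 c] by (simp_all add: t_def arccos_lbound)
    have ge': "cos t * sqn d x \<le> Re (cip d x (mapp d (\<lambda>j k. M j k * E k) x))" for x
      using ge[of x] unfolding t(3) q_def .
    show thesis
    \<comment> \<open>At \<open>t = 0\<close> both eigenvalues are \<open>1\<close> and the
      projections used otherwise vanish; the columns are fixed by \<open>q\<close> and serve as both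
      spectral parts.\<close>
    proof (cases "t = 0")
      case True
      then have c_1: "c = 1" using t(3) by simp
      have fixed: "mapp d q (\<Psi> a) k = \<Psi> a k" if "a < Suc d" "k < d" for a k
      proof -
        have "sqn d (\<lambda>k. (- 1) * \<Psi> a k + mapp d q (\<Psi> a) k) = 0"
          unfolding sqn_add sqn_scale sqn_mapp[OF u] cip_scale_left using min[OF that(1)] by (simp add: c_1)
        then show ?thesis using that(2) unfolding sqn_eq_0_iff by auto
      qed
      define X where "X = (\<lambda>(b::bool) a k. if a < Suc d then \<Psi> a k else 0)"
      show thesis
      proof (rule extremal[OF E t(1,2) ge'])
        show "(\<Sum>k<d. \<Sum>a<Suc d. (cmod (\<Psi> a k))\<^sup>2) = 1"
          using \<Psi> unfolding sqn_def by (subst sum.swap)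
        show "(\<Sum>a<Suc d. (cmod (X b a k))\<^sup>2) = (\<Sum>a<Suc d. (cmod (\<Psi> a k))\<^sup>2)" for b k
          by (simp add: X_def)
        show "mapp d (madj (\<lambda>j k. M j k * E k)) (X b a) k = cis (if b then - t else t) * X b a k" if "k < d" for b a k
        proof (cases "a < Suc d")
          case True
          then show ?thesis using eq[OF True that] fixed[OF True that] \<open>t = 0\<close>
            unfolding q_def by (simp add: X_def c_1)
        qed (simp add: X_def mapp_def)
      qed
    next
      case False
      then have s: "sin t \<noteq> 0" using t by (intro sin_gt_zero[THEN less_imp_neq, THEN not_sym]) auto
      define l where "l = (\<lambda>b. cis (if b then t else - t))"
      have l: "l b * cnj (l b) = 1" "l b + cnj (l b) = 2 * c" "cmod (l b) = 1" "Re (l b) = c"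
          "cnj (l b) = cis (if b then - t else t)" for b
        by (simp_all add: l_def complex_eq_iff t(3) power2_eq_square[symmetric])
      \<comment> \<open>Up to a constant factor, the component of column \<open>a\<close> in the
        eigenspace of \<open>q\<close> for \<open>l b\<close>.\<close>
      define Y where "Y = (\<lambda>b a k. if a < Suc d then mapp d q (\<Psi> a) k - cnj (l b) * \<Psi> a k else 0)"
      have Y: "mapp d (madj q) (Y b a) k = cnj (l b) * Y b a k" if "k < d" for a b k
      proof (cases "a < Suc d")
        case True
        have *: "mapp d q (\<Psi> a) k + mapp d (madj q) (\<Psi> a) k = (l b + cnj (l b)) * \<Psi> a k" if "k < d" for k
          using eq[OF True that] l(2)[of b] by simp
        show ?thesis using adjoint_eigenvector_split[OF u l(1) * that] True by (simp add: Y_def)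
      qed (simp add: Y_def mapp_def)
      define p where "p = (\<lambda>b k. \<Sum>a<Suc d. (cmod (Y b a k))\<^sup>2)"
      have p: "p b k = (\<Sum>a<Suc d. (cmod (mapp d q (\<Psi> a) k))\<^sup>2) + (\<Sum>a<Suc d. (cmod (\<Psi> a k))\<^sup>2)
          - 2 * c * Re (\<Sum>a<Suc d. mapp d q (\<Psi> a) k * cnj (\<Psi> a k))" if "k < d" for b k
      proof -
        \<comment> \<open>The diagonals for the two values of \<open>b\<close> could differ only
          through \<open>Im w\<close>. By the eigenvalue equation, \<open>w\<close> is a real number
          minus the conjugate of the aligned entry \<open>E k * z k\<close>, which is real
          too.\<close>
        define w where "w = (\<Sum>a<Suc d. mapp d q (\<Psi> a) k * cnj (\<Psi> a k))"
        have "w = (\<Sum>a<Suc d. complex_of_real (2 * c * (cmod (\<Psi> a k))\<^sup>2) - cnj (diag_form d q (\<Psi> a) k))"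
          unfolding w_def
        proof (intro sum.cong refl)
          fix a assume "a \<in> {..<Suc d}"
          then have m: "mapp d q (\<Psi> a) k = 2 * c * \<Psi> a k - mapp d (madj q) (\<Psi> a) k"
            using eq[of a k] that by (simp add: algebra_simps)
          show "mapp d q (\<Psi> a) k * cnj (\<Psi> a k) = complex_of_real (2 * c * (cmod (\<Psi> a k))\<^sup>2) - cnj (diag_form d q (\<Psi> a) k)"
            unfolding m diag_form_madj of_real_mult complex_norm_square by (simp add: algebra_simps)
        qed
        also have "\<dots> = complex_of_real (\<Sum>a<Suc d. 2 * c * (cmod (\<Psi> a k))\<^sup>2) - cnj (E k * z k)"
          unfolding df z_def sum_subtractf of_real_sum cnj_sum sum_distrib_left ..
        also have "\<dots> = complex_of_real ((\<Sum>a<Suc d. 2 * c * (cmod (\<Psi> a k))\<^sup>2) - cmod (z k))"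
          unfolding Ez[OF that] by simp
        finally have w: "Im w = 0" by simp
        have "p b k = (\<Sum>a<Suc d. (cmod (mapp d q (\<Psi> a) k))\<^sup>2 + (cmod (\<Psi> a k))\<^sup>2
            - 2 * Re (l b * (mapp d q (\<Psi> a) k * cnj (\<Psi> a k))))"
          unfolding p_def Y_def by (intro sum.cong refl) (simp add: cmod_diff_mult_square l(3))
        also have "\<dots> = (\<Sum>a<Suc d. (cmod (mapp d q (\<Psi> a) k))\<^sup>2) + (\<Sum>a<Suc d. (cmod (\<Psi> a k))\<^sup>2) - 2 * Re (l b * w)"
          unfolding w_def sum_subtractf sum.distrib sum_distrib_left Re_sum by simp
        also have "Re (l b * w) = c * Re w" using w l(4) by simp
        finally show ?thesis by (simp add: w_def)
      qed
      define S where "S = (\<Sum>k<d. p True k)"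
      have pp: "p b k = p True k" if "k < d" for b k using p[OF that] by simp
      have SY: "S = (\<Sum>a<Suc d. sqn d (Y b a))" for b
        unfolding S_def sqn_def using pp[of _ b] by (subst sum.swap) (simp add: p_def)
      have "S \<noteq> 0"
      proof
        assume "S = 0"
        then have Y0: "Y b a k = 0" if "a < Suc d" "k < d" for a k b
          using that SY[of b] sum_nonneg_eq_0_iff[of "{..<Suc d}" "\<lambda>a. sqn d (Y b a)"] sqn_eq_0_iff by auto
        have "\<Psi> a k = 0" if "a < Suc d" "k < d" for a k
        proof -
          have "(cis t - cis (- t)) * \<Psi> a k = Y True a k - Y False a k"
            using that by (simp add: Y_def l(5) algebra_simps)
          then have "(cis t - cis (- t)) * \<Psi> a k = 0" using Y0[OF that] by simp
          moreover have "Im (cis t - cis (- t)) \<noteq> 0" using s by simp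
          ultimately show ?thesis by (metis mult_eq_0_iff zero_complex.sel(2))
        qed
        then have "(\<Sum>a<Suc d. sqn d (\<Psi> a)) = 0" by (simp add: sqn_def del: sum.lessThan_Suc)
        then show False using \<Psi> by simp
      qed
      moreover have "0 \<le> S" unfolding SY[of True] by (intro sum_nonneg) simp
      ultimately have S: "0 < S" by simp
      show thesis
      proof (rule extremal[OF E t(1,2) ge'])
        show "(\<Sum>k<d. p True k / S) = 1" using S by (simp add: S_def sum_divide_distrib[symmetric])
        show "(\<Sum>a<Suc d. (cmod (Y b a k / complex_of_real (sqrt S)))\<^sup>2) = p True k / S" if "k < d" for b k
        proof -
          have "(\<Sum>a<Suc d. (cmod (Y b a k / complex_of_real (sqrt S)))\<^sup>2) = p b k / S"
            unfolding p_def using S by (simp add: norm_divide power_divide sum_divide_distrib del: sum.lessThan_Suc)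
          then show ?thesis using pp[OF that, of b] by simp
        qed
        show "mapp d (madj (\<lambda>j k. M j k * E k)) (\<lambda>k. Y b a k / complex_of_real (sqrt S)) k
            = cis (if b then - t else t) * (Y b a k / complex_of_real (sqrt S))" if "k < d" for b a k
          using Y[OF that, of b a] mapp_scale[of d "madj q" "1 / complex_of_real (sqrt S)" "Y b a" k]
          unfolding q_def[symmetric] l(5)[symmetric] by simp
      qed
    qed
  qed
qed

section \<open>Block states and their evolution\<close>

lemma sum_lessThan_mult: "(\<Sum>m<K * c. f m) = (\<Sum>x<K. \<Sum>s<c. f (x * c + s))" for c :: nat
proof -
  have "(\<Sum>m<K * c. f m) = (\<Sum>x<K. sum f {x * c..<x * c + c})" by (rule sum.nat_group[symmetric])
  also have "\<dots> = (\<Sum>x<K. \<Sum>s<c. f (x * c + s))"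
    by (simp add: sum.atLeastLessThan_shift_0[of f] atLeast0LessThan comp_def add.commute)
  finally show ?thesis .
qed

text \<open>\<open>p div b\<close> encodes the outcomes recorded so far: the state is dephased in
  them and, for each of them, pure and unnormalised on the remaining \<open>b\<close>
  dimensions.\<close>

definition block_state :: "nat \<Rightarrow> nat \<Rightarrow> (nat \<Rightarrow> complex) \<Rightarrow> complex mat" where
  "block_state n b \<phi> = mat n n (\<lambda>(p,q). if p div b = q div b then \<phi> p * cnj (\<phi> q) else 0)"

text \<open>Only the rotation by the adjoint of \<open>Q\<close> on the middle register; the
  dephasing part of the measurement is expressed by a shorter block length.\<close>

definition meas_step :: "nat \<Rightarrow> nat \<Rightarrow> (nat \<Rightarrow> nat \<Rightarrow> complex) \<Rightarrow> (nat \<Rightarrow> complex) \<Rightarrow> nat \<Rightarrow> complex" where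
  "meas_step d b Q \<phi> p = mapp d (madj Q) (\<lambda>j. \<phi> ((p div b div d * d + j) * b + p mod b)) (p div b mod d)"

definition ctrl_step :: "nat \<Rightarrow> nat \<Rightarrow> (nat \<Rightarrow> complex mat) \<Rightarrow> (nat \<Rightarrow> complex) \<Rightarrow> nat \<Rightarrow> complex" where
  "ctrl_step r c V \<phi> p = mapp c (\<lambda>i j. V (p div r) $$ (i,j)) (\<lambda>s. \<phi> (p div r * c + s)) (p mod r)"

lemma mult_add_less: "x < a \<Longrightarrow> j < d \<Longrightarrow> x * d + j < a * d" for a :: nat
  by (metis add.commute add_less_cancel_right less_le_trans mult_Suc mult_le_mono1 Suc_leI)

text \<open>After the rotation the measurement deletes coherences between different outcomes, which
  shortens the blocks from \<open>d*b\<close> to \<open>b\<close>. Every surviving entry carries the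
  same outcome \<open>i\<close> on both sides, so the phases cancel as
  \<open>cnj (E i) * E i\<close>.\<close>

lemma lift_meas_block_state:
  assumes P: "P \<in> carrier_mat d d" and E: "\<And>i. cmod (E i) = 1"
    and Q: "\<And>j i. i < d \<Longrightarrow> j < d \<Longrightarrow> Q j i = P $$ (j,i) * E i"
  shows "lift_mid a d b (meas P) (block_state (a*d*b) (d*b) \<phi>) = block_state (a*d*b) b (meas_step d b Q \<phi>)"
proof (rule eq_matI)
  fix p q assume "p < dim_row (block_state (a*d*b) b (meas_step d b Q \<phi>))"
    "q < dim_col (block_state (a*d*b) b (meas_step d b Q \<phi>))"
  then have pq: "p < a*d*b" "q < a*d*b" by (simp_all add: block_state_def)
  then have pos: "0 < a" "0 < d" "0 < b" by (auto intro!: Nat.gr0I)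
  define x i y where "x = p div b div d" and "i = p div b mod d" and "y = p mod b"
  define x' i' y' where "x' = q div b div d" and "i' = q div b mod d" and "y' = q mod b"
  have r: "x < a" "i < d" "y < b" "x' < a" "i' < d" "y' < b"
    using pq pos by (simp_all add: x_def i_def y_def x'_def i'_def y'_def less_mult_imp_div_less)
  define f f' where "f = (\<lambda>j. \<phi> ((x * d + j) * b + y))" and "f' = (\<lambda>j. \<phi> ((x' * d + j) * b + y'))"
  define X where "X = mat d d (\<lambda>(j,j'). block_state (a*d*b) (d*b) \<phi> $$ ((x * d + j) * b + y, (x' * d + j') * b + y'))"
  have bl: "((x * d + j) * b + y) div (d * b) = x" "(x * d + j) * b + y < a * d * b" if "x < a" "j < d" "y < b" for x j y
    using that pos by (simp_all add: div_mult2_eq mult.commute[of d b] mult_add_less)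
  have X: "X $$ (j,j') = (if x = x' then f j * cnj (f' j') else 0)" if "j < d" "j' < d" for j j'
    using that r by (simp add: X_def block_state_def bl f_def f'_def)
  have braket: "braket (col P i) X (col P i) = (if x = x' then mapp d (madj Q) f i * cnj (mapp d (madj Q) f' i) else 0)"
  proof -
    have "braket (col P i) X (col P i) = (\<Sum>j<d. cnj (P $$ (j,i)) * (\<Sum>j'<d. X $$ (j,j') * P $$ (j',i)))"
      unfolding braket_def using P r(2) by (simp add: scalar_prod_def atLeast0LessThan X_def)
    also have "\<dots> = (\<Sum>j<d. cnj (P $$ (j,i)) * (\<Sum>j'<d. (if x = x' then f j * cnj (f' j') else 0) * P $$ (j',i)))"
      by (simp add: X)
    also have "\<dots> = (if x = x' then (\<Sum>j<d. cnj (P $$ (j,i)) * f j) * (\<Sum>j'<d. cnj (f' j') * P $$ (j',i)) else 0)"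
      unfolding sum_product by (cases "x = x'") (simp_all add: sum_distrib_left mult_ac)
    also have "(\<Sum>j<d. cnj (P $$ (j,i)) * f j) * (\<Sum>j'<d. cnj (f' j') * P $$ (j',i))
        = mapp d (madj Q) f i * cnj (mapp d (madj Q) f' i)"
    proof -
      have e: "cnj (E i) * E i = 1" using E[of i] by (simp add: complex_norm_square[symmetric] mult.commute)
      have "mapp d (madj Q) f i = cnj (E i) * (\<Sum>j<d. cnj (P $$ (j,i)) * f j)"
        using r(2) by (simp add: mapp_def madj_def Q sum_distrib_left mult_ac)
      moreover have "cnj (mapp d (madj Q) f' i) = E i * (\<Sum>j'<d. cnj (f' j') * P $$ (j',i))"
        using r(2) by (simp add: mapp_def madj_def Q sum_distrib_left mult_ac)
      ultimately show ?thesis using e by (simp add: mult_ac)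
    qed
    finally show ?thesis .
  qed
  have same: "p div b = q div b \<longleftrightarrow> x = x' \<and> i = i'"
    unfolding x_def x'_def i_def i'_def by (metis div_mult_mod_eq)
  have "lift_mid a d b (meas P) (block_state (a*d*b) (d*b) \<phi>) $$ (p, q) = meas P X $$ (i, i')"
    using pq by (simp add: lift_mid_def X_def x_def x'_def i_def i'_def y_def y'_def)
  also have "\<dots> = (if i = i' then braket (col P i) X (col P i) else 0)"
    using r P by (simp add: meas_def)
  also have "\<dots> = block_state (a*d*b) b (meas_step d b Q \<phi>) $$ (p, q)"
  proof -
    have "meas_step d b Q \<phi> p = mapp d (madj Q) f i" "meas_step d b Q \<phi> q = mapp d (madj Q) f' i'"
      by (simp_all add: meas_step_def f_def f'_def x_def x'_def i_def i'_def y_def y'_def)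
    then show ?thesis using pq unfolding braket block_state_def by (simp add: same)
  qed
  finally show "lift_mid a d b (meas P) (block_state (a*d*b) (d*b) \<phi>) $$ (p, q)
      = block_state (a*d*b) b (meas_step d b Q \<phi>) $$ (p, q)" .
qed (simp_all add: lift_mid_def block_state_def)

lemma ctrl_sum:
  assumes "p < K * r"
  shows "(\<Sum>m<K * c. ctrl K r c V $$ (p,m) * g m) = (\<Sum>s<c. V (p div r) $$ (p mod r, s) * g (p div r * c + s))"
proof -
  have x: "p div r < K" using assms by (simp add: less_mult_imp_div_less)
  have "(\<Sum>m<K * c. ctrl K r c V $$ (p,m) * g m)
      = (\<Sum>x<K. \<Sum>s<c. ctrl K r c V $$ (p, x * c + s) * g (x * c + s))" by (rule sum_lessThan_mult)
  also have "\<dots> = (\<Sum>x<K. if p div r = x then (\<Sum>s<c. V (p div r) $$ (p mod r, s) * g (p div r * c + s)) else 0)"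
    by (intro sum.cong refl) (auto simp: ctrl_def assms mult_add_less intro!: sum.cong)
  also have "\<dots> = (\<Sum>s<c. V (p div r) $$ (p mod r, s) * g (p div r * c + s))" using x by simp
  finally show ?thesis .
qed

text \<open>The controlled operator is block diagonal in the recorded outcomes, so it acts within
  blocks and creates no coherence between them.\<close>

lemma ctrl_block_state:
  "ctrl K r c V * block_state (K*c) c \<phi> * adj (ctrl K r c V) = block_state (K*r) r (ctrl_step r c V \<phi>)"
proof (rule eq_matI)
  let ?W = "ctrl K r c V" and ?S = "block_state (K*c) c \<phi>"
  have W: "?W \<in> carrier_mat (K*r) (K*c)" by (simp add: ctrl_def)
  have S: "?S \<in> carrier_mat (K*c) (K*c)" by (simp add: block_state_def)
  fix p q assume "p < dim_row (block_state (K*r) r (ctrl_step r c V \<phi>))"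
    "q < dim_col (block_state (K*r) r (ctrl_step r c V \<phi>))"
  then have pq: "p < K*r" "q < K*r" by (simp_all add: block_state_def)
  have pK: "p div r < K" "q div r < K" using pq by (simp_all add: less_mult_imp_div_less)
  let ?v = "\<lambda>p s. V (p div r) $$ (p mod r, s)"
  have WS: "(?W * ?S) $$ (p,k) = (\<Sum>s<c. ?v p s * ?S $$ (p div r * c + s, k))" if "k < K*c" for k
    using that pq W S ctrl_sum[OF pq(1), of c V "\<lambda>m. ?S $$ (m,k)"] by (simp add: scalar_prod_def atLeast0LessThan)
  have "(?W * ?S * adj ?W) $$ (p,q) = (\<Sum>k<K*c. (?W * ?S) $$ (p,k) * cnj (?W $$ (q,k)))"
    using pq W S by (simp add: scalar_prod_def atLeast0LessThan adj_def)
  also have "\<dots> = cnj (\<Sum>k<K*c. ?W $$ (q,k) * cnj ((?W * ?S) $$ (p,k)))" by (simp add: mult.commute)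
  also have "\<dots> = (\<Sum>s'<c. cnj (?v q s') * (?W * ?S) $$ (p, q div r * c + s'))"
    unfolding ctrl_sum[OF pq(2)] by simp
  also have "\<dots> = (\<Sum>s'<c. cnj (?v q s') * (\<Sum>s<c. ?v p s * ?S $$ (p div r * c + s, q div r * c + s')))"
    using pK by (intro sum.cong refl) (simp add: WS mult_add_less)
  also have "\<dots> = (\<Sum>s'<c. cnj (?v q s') * (\<Sum>s<c. ?v p s *
      (if p div r = q div r then \<phi> (p div r * c + s) * cnj (\<phi> (q div r * c + s')) else 0)))"
    using pK by (intro sum.cong refl arg_cong2[where f = "(*)"]) (simp add: block_state_def mult_add_less)
  also have "\<dots> = (if p div r = q div r then ctrl_step r c V \<phi> p * cnj (ctrl_step r c V \<phi> q) else 0)"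
  proof (cases "p div r = q div r")
    case True
    then show ?thesis
      unfolding ctrl_step_def mapp_def cnj_sum sum_product
      by (subst sum.swap) (simp add: sum_distrib_left mult_ac)
  qed simp
  finally show "(?W * ?S * adj ?W) $$ (p,q) = block_state (K*r) r (ctrl_step r c V \<phi>) $$ (p,q)"
    using pq by (simp add: block_state_def)
qed (simp_all add: block_state_def ctrl_def adj_def)

lemma outer_block_state:
  assumes "v \<in> carrier_vec n"
  shows "outer v v = block_state n n (\<lambda>p. v $ p)"
  using assms by (intro eq_matI) (auto simp: outer_def block_state_def)

section \<open>Inner products under isometries and measurement rotations\<close>

lemma cip_isometry:
  assumes "\<And>s s'. s < c \<Longrightarrow> s' < c \<Longrightarrow> (\<Sum>p<r. cnj (M p s) * M p s') = (if s = s' then 1 else 0)"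
  shows "cip r (mapp c M x) (mapp c M y) = cip c x y"
proof -
  have "cip r (mapp c M x) (mapp c M y) = (\<Sum>p<r. \<Sum>s<c. \<Sum>s'<c. cnj (M p s) * M p s' * (cnj (x s) * y s'))"
    unfolding cip_def mapp_def cnj_sum sum_product by (simp add: mult_ac)
  also have "\<dots> = (\<Sum>s<c. \<Sum>p<r. \<Sum>s'<c. cnj (M p s) * M p s' * (cnj (x s) * y s'))" by (rule sum.swap)
  also have "\<dots> = (\<Sum>s<c. \<Sum>s'<c. \<Sum>p<r. cnj (M p s) * M p s' * (cnj (x s) * y s'))"
    by (intro sum.cong refl sum.swap)
  also have "\<dots> = (\<Sum>s<c. \<Sum>s'<c. (if s = s' then 1 else 0) * (cnj (x s) * y s'))"
    unfolding sum_distrib_right[symmetric] by (intro sum.cong refl) (simp add: assms)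
  also have "\<dots> = cip c x y"
    by (simp add: cip_def if_distrib[of "\<lambda>z. z * _"] cong: if_cong)
  finally show ?thesis .
qed

lemma cip_lessThan_mult: "cip (K * c) \<phi> \<chi> = (\<Sum>x<K. cip c (\<lambda>s. \<phi> (x * c + s)) (\<lambda>s. \<chi> (x * c + s)))"
  unfolding cip_def by (rule sum_lessThan_mult)

lemma cip_ctrl_step:
  assumes "\<And>x. x < K \<Longrightarrow> isometry r c (V x)"
  shows "cip (K * r) (ctrl_step r c V \<phi>) (ctrl_step r c V \<chi>) = cip (K * c) \<phi> \<chi>"
  unfolding cip_lessThan_mult
proof (intro sum.cong refl)
  fix x assume "x \<in> {..<K}"
  then have "isometry r c (V x)" using assms by simp
  then have V: "V x \<in> carrier_mat r c" and VV: "adj (V x) * V x = 1\<^sub>m c" by (simp_all add: isometry_def)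
  have iso: "(\<Sum>p<r. cnj (V x $$ (p,s)) * V x $$ (p,s')) = (if s = s' then 1 else 0)" if "s < c" "s' < c" for s s'
  proof -
    have "(adj (V x) * V x) $$ (s,s') = (\<Sum>p<r. cnj (V x $$ (p,s)) * V x $$ (p,s'))"
      using that V by (simp add: scalar_prod_def adj_def atLeast0LessThan)
    then show ?thesis using that by (simp add: VV)
  qed
  have "cip r (\<lambda>s. ctrl_step r c V \<phi> (x * r + s)) (\<lambda>s. ctrl_step r c V \<chi> (x * r + s)) =
     cip r (mapp c (\<lambda>i j. V x $$ (i,j)) (\<lambda>s. \<phi> (x * c + s))) (mapp c (\<lambda>i j. V x $$ (i,j)) (\<lambda>s. \<chi> (x * c + s)))"
    by (rule cip_cong) (simp_all add: ctrl_step_def)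
  also have "\<dots> = cip c (\<lambda>s. \<phi> (x * c + s)) (\<lambda>s. \<chi> (x * c + s))" by (rule cip_isometry[OF iso])
  finally show "cip r (\<lambda>s. ctrl_step r c V \<phi> (x * r + s)) (\<lambda>s. ctrl_step r c V \<chi> (x * r + s))
      = cip c (\<lambda>s. \<phi> (x * c + s)) (\<lambda>s. \<chi> (x * c + s))" .
qed

lemma cip_lessThan_mult2:
  "cip (a * d * b) \<phi> \<chi> = (\<Sum>x<a. \<Sum>y<b. cip d (\<lambda>j. \<phi> ((x * d + j) * b + y)) (\<lambda>j. \<chi> ((x * d + j) * b + y)))"
proof -
  have "cip (a * d * b) \<phi> \<chi> = (\<Sum>x<a. \<Sum>j<d. \<Sum>y<b. cnj (\<phi> ((x * d + j) * b + y)) * \<chi> ((x * d + j) * b + y))"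
    unfolding cip_def sum_lessThan_mult ..
  also have "\<dots> = (\<Sum>x<a. \<Sum>y<b. \<Sum>j<d. cnj (\<phi> ((x * d + j) * b + y)) * \<chi> ((x * d + j) * b + y))"
    by (intro sum.cong refl sum.swap)
  finally show ?thesis by (simp add: cip_def)
qed

lemma meas_step_index:
  assumes "j < d" "y < b"
  shows "meas_step d b Q \<phi> ((x * d + j) * b + y) = mapp d (madj Q) (\<lambda>j. \<phi> ((x * d + j) * b + y)) j"
  using assms by (simp add: meas_step_def)

lemma meas_step_identity:
  assumes I: "\<And>j k. I j k = (if j = k then 1 else 0)" and "p < a * d * b"
  shows "meas_step d b I \<phi> p = \<phi> p"
proof -
  have "0 < d" "0 < b" using assms(2) by (auto intro!: Nat.gr0I)
  then show ?thesis
    by (simp add: meas_step_def mapp_def madj_def I if_distrib[of "\<lambda>z. z * _"] if_distrib[of cnj] cong: if_cong)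
qed

lemma cip_meas_step:
  assumes "unitary_fun d Q"
  shows "cip (a * d * b) (meas_step d b Q \<phi>) (meas_step d b Q \<chi>) = cip (a * d * b) \<phi> \<chi>"
proof -
  have "cip (a * d * b) (meas_step d b Q \<phi>) (meas_step d b Q \<chi>) = (\<Sum>x<a. \<Sum>y<b.
     cip d (mapp d (madj Q) (\<lambda>j. \<phi> ((x * d + j) * b + y))) (mapp d (madj Q) (\<lambda>j. \<chi> ((x * d + j) * b + y))))"
    unfolding cip_lessThan_mult2 by (intro sum.cong refl cip_cong) (simp_all add: meas_step_index)
  also have "\<dots> = cip (a * d * b) \<phi> \<chi>"
    unfolding cip_lessThan_mult2 using unitary_fun_madj[OF assms]
    by (intro sum.cong refl cip_isometry) (simp add: unitary_fun_def)
  finally show ?thesis .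
qed

text \<open>The bound for \<open>Q\<close> is applied to each fibre of the middle register and
  summed; passing to the adjoint only conjugates the inner product.\<close>

lemma Re_cip_meas_step_ge:
  assumes "\<And>x. c * sqn d x \<le> Re (cip d x (mapp d Q x))"
  shows "c * sqn (a * d * b) \<phi> \<le> Re (cip (a * d * b) \<phi> (meas_step d b Q \<phi>))"
proof -
  have "complex_of_real (sqn (a * d * b) \<phi>) = (\<Sum>x<a. \<Sum>y<b. complex_of_real (sqn d (\<lambda>j. \<phi> ((x * d + j) * b + y))))"
    unfolding cip_self[symmetric] cip_lessThan_mult2 ..
  then have "sqn (a * d * b) \<phi> = (\<Sum>x<a. \<Sum>y<b. sqn d (\<lambda>j. \<phi> ((x * d + j) * b + y)))"
    unfolding of_real_sum[symmetric] of_real_eq_iff .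
  then have "c * sqn (a * d * b) \<phi> = (\<Sum>x<a. \<Sum>y<b. c * sqn d (\<lambda>j. \<phi> ((x * d + j) * b + y)))"
    by (simp add: sum_distrib_left)
  also have "\<dots> \<le> (\<Sum>x<a. \<Sum>y<b. Re (cip d (\<lambda>j. \<phi> ((x * d + j) * b + y)) (mapp d (madj Q) (\<lambda>j. \<phi> ((x * d + j) * b + y)))))"
  proof (intro sum_mono)
    fix x y
    let ?f = "\<lambda>j. \<phi> ((x * d + j) * b + y)"
    have "cip d ?f (mapp d (madj Q) ?f) = cnj (cip d ?f (mapp d Q ?f))"
      using cip_madj[of d Q ?f ?f] cip_commute[of d ?f "mapp d (madj Q) ?f"] by simp
    then show "c * sqn d ?f \<le> Re (cip d ?f (mapp d (madj Q) ?f))" using assms[of ?f] by simp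
  qed
  also have "\<dots> = Re (cip (a * d * b) \<phi> (meas_step d b Q \<phi>))"
    unfolding cip_lessThan_mult2 Re_sum
    by (intro sum.cong refl arg_cong[where f = Re] cip_cong) (simp_all add: meas_step_index)
  finally show ?thesis .
qed

section \<open>Angles and the type II error\<close>

lemma quadratic_nonneg_discriminant:
  fixes A B C :: real
  assumes "\<And>s. 0 \<le> A + 2 * s * B + s\<^sup>2 * C" and C: "0 \<le> C"
  shows "B\<^sup>2 \<le> A * C"
proof (cases "C = 0")
  case True
  have "B = 0"
  proof (rule ccontr)
    assume "B \<noteq> 0"
    then show False using assms(1)[of "- (A + 1) / (2 * B)"] True by (simp add: field_simps)
  qed
  then show ?thesis using True by simp
next
  case False
  then have "0 < C" using C by simp
  have "A + 2 * (- B / C) * B + (- B / C)\<^sup>2 * C = A - B\<^sup>2 / C"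
    using False by (simp add: field_simps power2_eq_square)
  then have "0 \<le> A - B\<^sup>2 / C" using assms(1)[of "- B / C"] by (simp only:)
  then show ?thesis using \<open>0 < C\<close> by (simp add: field_simps)
qed

lemma Re_cip_Cauchy_Schwarz: "(Re (cip n x y))\<^sup>2 \<le> sqn n x * sqn n y"
proof (rule quadratic_nonneg_discriminant)
  fix s :: real
  have "0 \<le> sqn n (\<lambda>k. x k + s * y k)" by simp
  then show "0 \<le> sqn n x + 2 * s * Re (cip n x y) + s\<^sup>2 * sqn n y"
    unfolding sqn_add sqn_scale cip_scale_right by simp
qed simp

text \<open>\<open>pos\<close> concerns the hermitian part of \<open>G\<close>, so the cross term
  appears in symmetrised form.\<close>

lemma form_Cauchy_Schwarz:
  fixes x y :: "nat \<Rightarrow> complex"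
  assumes pos: "\<And>x. 0 \<le> Re (cip n x (mapp n G x))"
  shows "((Re (cip n x (mapp n G y)) + Re (cip n y (mapp n G x))) / 2)\<^sup>2
    \<le> Re (cip n x (mapp n G x)) * Re (cip n y (mapp n G y))"
proof (rule quadratic_nonneg_discriminant)
  fix s :: real
  have "cip n z (mapp n G (\<lambda>k. x k + s * y k)) = cip n z (mapp n G x) + s * cip n z (mapp n G y)" for z
    unfolding cip_scale_right[symmetric] cip_add_right[symmetric]
    by (rule cip_cong) (simp_all add: mapp_add mapp_scale)
  then show "0 \<le> Re (cip n x (mapp n G x)) + 2 * s * ((Re (cip n x (mapp n G y)) + Re (cip n y (mapp n G x))) / 2)
      + s\<^sup>2 * Re (cip n y (mapp n G y))"
    using pos[of "\<lambda>k. x k + s * y k"] by (simp add: cip_add_left cip_scale_left algebra_simps power2_eq_square add_divide_distrib)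
qed (rule pos)

text \<open>The triangle inequality for angles on the unit sphere of the real inner product: apply
  Cauchy-Schwarz to what remains of \<open>x\<close> and \<open>z\<close> after removing their
  components along \<open>y\<close>.\<close>

lemma cos_angle_add_le:
  assumes u: "sqn n x = 1" "sqn n y = 1" "sqn n z = 1"
    and xy: "cos A \<le> Re (cip n x y)" and yz: "cos B \<le> Re (cip n y z)"
    and AB: "0 \<le> A" "0 \<le> B" "A + B \<le> pi"
  shows "cos (A + B) \<le> Re (cip n x z)"
proof -
  define a b g where "a = Re (cip n x y)" and "b = Re (cip n y z)" and "g = Re (cip n x z)"
  have a1: "a\<^sup>2 \<le> 1" and b1: "b\<^sup>2 \<le> 1"
    using Re_cip_Cauchy_Schwarz[of n x y] Re_cip_Cauchy_Schwarz[of n y z] u by (simp_all add: a_def b_def)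
  then have ab: "\<bar>a\<bar> \<le> 1" "\<bar>b\<bar> \<le> 1" by (simp_all add: abs_square_le_1)
  have cyx: "Re (cip n y x) = a" and czy: "Re (cip n z y) = b"
    using cip_commute[of n y x] cip_commute[of n z y] by (simp_all add: a_def b_def)
  have s: "sqn n (\<lambda>k. w k + complex_of_real (- c) * y k) = 1 - c\<^sup>2"
    if "sqn n w = 1" "Re (cip n w y) = c" for w c
    unfolding sqn_add sqn_scale cip_scale_right using that u by (simp add: power2_eq_square)
  have "Re (cip n (\<lambda>k. x k + complex_of_real (- a) * y k) (\<lambda>k. z k + complex_of_real (- b) * y k)) = g - a * b"
    unfolding cip_add_left cip_add_right cip_scale_left cip_scale_right cip_self
    using cyx czy u by (simp add: a_def[symmetric] b_def[symmetric] g_def[symmetric])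
  then have "(g - a * b)\<^sup>2 \<le> (1 - a\<^sup>2) * (1 - b\<^sup>2)"
    using Re_cip_Cauchy_Schwarz[of n "\<lambda>k. x k + complex_of_real (- a) * y k" "\<lambda>k. z k + complex_of_real (- b) * y k"]
      s[OF u(1), of a] s[OF u(3), of b] czy by (simp only: a_def)
  then have "\<bar>g - a * b\<bar> \<le> sqrt ((1 - a\<^sup>2) * (1 - b\<^sup>2))"
    using real_le_rsqrt[of "\<bar>g - a * b\<bar>"] by simp
  then have "a * b - sqrt (1 - a\<^sup>2) * sqrt (1 - b\<^sup>2) \<le> g" by (simp add: real_sqrt_mult)
  moreover have "a * b - sqrt (1 - a\<^sup>2) * sqrt (1 - b\<^sup>2) = cos (arccos a + arccos b)"
    using ab by (simp add: cos_add cos_arccos_abs sin_arccos_abs)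
  moreover have "arccos a \<le> A"
  proof -
    have "arccos a \<le> arccos (cos A)" using xy ab by (intro arccos_le_arccos) (auto simp: a_def)
    then show ?thesis using AB by (simp add: arccos_cos)
  qed
  moreover have "arccos b \<le> B"
  proof -
    have "arccos b \<le> arccos (cos B)" using yz ab by (intro arccos_le_arccos) (auto simp: b_def)
    then show ?thesis using AB by (simp add: arccos_cos)
  qed
  moreover have "0 \<le> arccos a + arccos b" using ab by (simp add: arccos_lbound abs_le_iff)
  ultimately have "cos (A + B) \<le> g" using cos_monotone_0_pi_le[of "arccos a + arccos b" "A + B"] AB by linarith
  then show ?thesis by (simp add: g_def)
qed

text \<open>With \<open>\<alpha>\<close> and \<open>\<gamma>\<close> the angles whose squared
  cosines are the acceptance probabilities of \<open>x\<close> and \<open>y\<close>, splitting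
  \<open>cip n x y\<close> along \<open>G\<close> and its complement gives
  \<open>cos \<tau> \<le> cos (\<gamma> - \<alpha>)\<close>. The type I constraint is
  \<open>\<alpha> \<le> \<beta>\<close>, hence
  \<open>\<gamma> \<le> \<tau> + \<beta>\<close>.\<close>

lemma type_two_error_ge:
  fixes G :: "nat \<Rightarrow> nat \<Rightarrow> complex"
  assumes pos: "\<And>x. 0 \<le> Re (cip n x (mapp n G x))" and le: "\<And>x. Re (cip n x (mapp n G x)) \<le> sqn n x"
    and u: "sqn n x = 1" "sqn n y = 1" and overlap: "cos \<tau> \<le> Re (cip n x y)"
    and type_one: "cos \<beta> ^ 2 \<le> Re (cip n x (mapp n G x))"
    and ang: "0 \<le> \<tau>" "0 \<le> \<beta>" "\<tau> + \<beta> \<le> pi / 2"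
  shows "cos (\<tau> + \<beta>) ^ 2 \<le> Re (cip n y (mapp n G y))"
proof -
  define a b where "a = Re (cip n x (mapp n G x))" and "b = Re (cip n y (mapp n G y))"
  have ab: "0 \<le> a" "a \<le> 1" "0 \<le> b" "b \<le> 1"
    using pos le[of x] le[of y] u by (simp_all add: a_def b_def)
  define I where "I = (\<lambda>i j :: nat. (if i = j then 1 else 0) - G i j)"
  have I: "cip n v (mapp n I w) = cip n v w - cip n v (mapp n G w)" for v w
    unfolding cip_diff_right[symmetric]
  proof (rule cip_cong)
    fix k assume "k < n"
    then show "mapp n I w k = w k - mapp n G w k"
      by (simp add: mapp_def I_def left_diff_distrib sum_subtractf if_distrib[of "\<lambda>c. c * _"] cong: if_cong)
  qed simp
  have Ipos: "0 \<le> Re (cip n w (mapp n I w))" for w using le[of w] unfolding I cip_self by simp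
  define S T where "S = (Re (cip n x (mapp n G y)) + Re (cip n y (mapp n G x))) / 2"
    and "T = (Re (cip n x (mapp n I y)) + Re (cip n y (mapp n I x))) / 2"
  have "S + T = Re (cip n x y)"
    unfolding S_def T_def I using cip_commute[of n y x] by (simp add: field_simps)
  moreover have "S \<le> sqrt a * sqrt b"
    using form_Cauchy_Schwarz[of n G x y, OF pos] unfolding S_def[symmetric] a_def[symmetric] b_def[symmetric]
    by (simp add: real_sqrt_mult[symmetric] real_le_rsqrt)
  moreover have "T \<le> sqrt (1 - a) * sqrt (1 - b)"
    using form_Cauchy_Schwarz[of n I x y, OF Ipos] unfolding T_def[symmetric]
    unfolding I cip_self using u by (simp add: real_sqrt_mult[symmetric] real_le_rsqrt a_def b_def)
  moreover define \<alpha> \<gamma> where "\<alpha> = arccos (sqrt a)" and "\<gamma> = arccos (sqrt b)"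
  have trig: "cos \<alpha> = sqrt a" "sin \<alpha> = sqrt (1 - a)" "cos \<gamma> = sqrt b" "sin \<gamma> = sqrt (1 - b)"
    using ab by (simp_all add: \<alpha>_def \<gamma>_def cos_arccos_abs sin_arccos_abs)
  ultimately have "cos \<tau> \<le> cos (\<gamma> - \<alpha>)" using overlap by (simp add: cos_diff mult.commute)
  have rng: "0 \<le> \<alpha>" "0 \<le> \<gamma>" "\<gamma> \<le> pi / 2" "\<alpha> \<le> pi / 2"
    using ab arccos_lbound[of "sqrt a"] arccos_lbound[of "sqrt b"] arccos_le_pi2[of "sqrt a"] arccos_le_pi2[of "sqrt b"]
      order_trans[of "- 1" 0 "sqrt a"] order_trans[of "- 1" 0 "sqrt b"]
    by (simp_all add: \<alpha>_def \<gamma>_def)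
  have "\<alpha> \<le> \<beta>"
  proof -
    have "cos \<beta> \<le> cos \<alpha>" unfolding trig using type_one by (simp add: real_le_rsqrt a_def)
    then show ?thesis using rng ang cos_mono_le_eq[of \<beta> \<alpha>] by simp
  qed
  moreover have "\<gamma> - \<alpha> \<le> \<tau>"
  proof (cases "0 \<le> \<gamma> - \<alpha>")
    case True
    then show ?thesis using \<open>cos \<tau> \<le> cos (\<gamma> - \<alpha>)\<close> rng ang cos_mono_le_eq[of \<tau> "\<gamma> - \<alpha>"] by simp
  qed (use ang in simp)
  ultimately have "\<gamma> \<le> \<tau> + \<beta>" by simp
  then have "cos (\<tau> + \<beta>) \<le> sqrt b" unfolding trig(3)[symmetric] using rng ang
    by (intro cos_monotone_0_pi_le) auto
  moreover have "0 \<le> cos (\<tau> + \<beta>)" using ang by (intro cos_ge_zero) auto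
  ultimately have "cos (\<tau> + \<beta>) ^ 2 \<le> (sqrt b)\<^sup>2" by (intro power_mono)
  then show ?thesis using ab by (simp add: b_def)
qed

text \<open>The test \<open>A\<close> in the Heisenberg picture: dephasing with block length
  \<open>b\<close> and the partial trace over \<open>n\<close> dimensions are moved from the state
  to the test, which leaves a quadratic form on a pure vector.\<close>

definition block_form :: "nat \<Rightarrow> nat \<Rightarrow> complex mat \<Rightarrow> nat \<Rightarrow> nat \<Rightarrow> complex" where
  "block_form n b A p q = (if p mod n = q mod n \<and> p div n div b = q div n div b then A $$ (p div n, q div n) else 0)"

definition block_sum :: "nat \<Rightarrow> nat \<Rightarrow> nat \<Rightarrow> complex mat \<Rightarrow> (nat \<Rightarrow> complex) \<Rightarrow> complex" where
  "block_sum m n b A \<phi> = (\<Sum>p<m. \<Sum>q<m. \<Sum>k<n. if p div b = q div b then cnj (\<phi> (p * n + k)) * A $$ (p,q) * \<phi> (q * n + k) else 0)"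

lemma cip_block_form: "cip (m * n) \<phi> (mapp (m * n) (block_form n b A) \<phi>) = block_sum m n b A \<phi>"
proof -
  have "cip (m * n) \<phi> (mapp (m * n) (block_form n b A) \<phi>)
     = (\<Sum>p<m. \<Sum>k<n. \<Sum>q<m. \<Sum>k'<n. cnj (\<phi> (p * n + k)) * (block_form n b A (p * n + k) (q * n + k') * \<phi> (q * n + k')))"
    by (simp add: cip_def mapp_def sum_lessThan_mult sum_distrib_left)
  also have "\<dots> = (\<Sum>p<m. \<Sum>k<n. \<Sum>q<m. if p div b = q div b then cnj (\<phi> (p * n + k)) * A $$ (p,q) * \<phi> (q * n + k) else 0)"
  proof (intro sum.cong refl)
    fix p k q assume k: "k \<in> {..<n}"
    have "(\<Sum>k'<n. cnj (\<phi> (p * n + k)) * (block_form n b A (p * n + k) (q * n + k') * \<phi> (q * n + k')))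
       = (\<Sum>k'<n. if k = k' then (if p div b = q div b then cnj (\<phi> (p * n + k)) * A $$ (p,q) * \<phi> (q * n + k) else 0) else 0)"
      using k by (intro sum.cong refl) (auto simp: block_form_def)
    then show "(\<Sum>k'<n. cnj (\<phi> (p * n + k)) * (block_form n b A (p * n + k) (q * n + k') * \<phi> (q * n + k')))
       = (if p div b = q div b then cnj (\<phi> (p * n + k)) * A $$ (p,q) * \<phi> (q * n + k) else 0)"
      using k by simp
  qed
  also have "\<dots> = block_sum m n b A \<phi>" unfolding block_sum_def by (intro sum.cong refl sum.swap)
  finally show ?thesis .
qed

lemma trace_ptrace_block_state:
  assumes A: "A \<in> carrier_mat m m"
  shows "trace (A * ptrace_last m n (block_state (m * n) (b * n) \<phi>)) = block_sum m n b A \<phi>"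
proof -
  have "trace (A * ptrace_last m n (block_state (m * n) (b * n) \<phi>))
     = (\<Sum>p<m. \<Sum>q<m. A $$ (p,q) * (\<Sum>k<n. block_state (m * n) (b * n) \<phi> $$ (q * n + k, p * n + k)))"
    using A by (simp add: trace_def scalar_prod_def ptrace_last_def atLeast0LessThan)
  also have "\<dots> = (\<Sum>p<m. \<Sum>q<m. \<Sum>k<n. if p div b = q div b then cnj (\<phi> (p * n + k)) * A $$ (p,q) * \<phi> (q * n + k) else 0)"
  proof (intro sum.cong refl, unfold sum_distrib_left, intro sum.cong refl)
    fix p q k assume "p \<in> {..<m}" "q \<in> {..<m}" and k: "k \<in> {..<n}"
    then have "p * n + k < m * n" "q * n + k < m * n" by (simp_all add: mult_add_less)
    moreover have "(x * n + k) div (b * n) = x div b" for x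
      using k by (simp add: mult.commute[of b n] div_mult2_eq)
    ultimately show "A $$ (p,q) * block_state (m * n) (b * n) \<phi> $$ (q * n + k, p * n + k)
       = (if p div b = q div b then cnj (\<phi> (p * n + k)) * A $$ (p,q) * \<phi> (q * n + k) else 0)"
      by (auto simp: block_state_def)
  qed
  finally show ?thesis by (simp add: block_sum_def)
qed

lemma block_sum_nonneg:
  assumes A: "psd (K * b) A"
  shows "0 \<le> Re (block_sum (K * b) n b A \<phi>)"
proof -
  let ?m = "K * b"
  \<comment> \<open>The part of \<open>\<phi>\<close> in block \<open>x\<close> with traced index
    \<open>k\<close>; \<open>block_sum\<close> adds up the expectations of \<open>A\<close> in these
    vectors.\<close>
  define v where "v = (\<lambda>x k. vec ?m (\<lambda>p. if p div b = x then \<phi> (p * n + k) else 0))"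
  have Ac: "A \<in> carrier_mat ?m ?m" using A by (simp add: psd_def)
  have "(\<Sum>x<K. \<Sum>k<n. braket (v x k) A (v x k)) = (\<Sum>x<K. \<Sum>k<n. \<Sum>p<?m. \<Sum>q<?m.
      if p div b = x \<and> q div b = x then cnj (\<phi> (p * n + k)) * A $$ (p,q) * \<phi> (q * n + k) else 0)"
    using Ac unfolding braket_def v_def
    by (intro sum.cong refl) (auto simp: scalar_prod_def atLeast0LessThan sum_distrib_left intro!: sum.cong)
  also have "\<dots> = (\<Sum>p<?m. \<Sum>q<?m. \<Sum>k<n. \<Sum>x<K.
      if p div b = x \<and> q div b = x then cnj (\<phi> (p * n + k)) * A $$ (p,q) * \<phi> (q * n + k) else 0)" (is "sum ?L _ = _")
  proof -
    define F where "F = (\<lambda>x k p q. if p div b = x \<and> q div b = x then cnj (\<phi> (p * n + k)) * A $$ (p,q) * \<phi> (q * n + k) else 0)"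
    have "(\<Sum>x<K. \<Sum>k<n. \<Sum>p<?m. \<Sum>q<?m. F x k p q) = (\<Sum>x<K. \<Sum>p<?m. \<Sum>k<n. \<Sum>q<?m. F x k p q)"
      by (intro sum.cong refl sum.swap)
    also have "\<dots> = (\<Sum>x<K. \<Sum>p<?m. \<Sum>q<?m. \<Sum>k<n. F x k p q)" by (intro sum.cong refl sum.swap)
    also have "\<dots> = (\<Sum>p<?m. \<Sum>x<K. \<Sum>q<?m. \<Sum>k<n. F x k p q)" by (rule sum.swap)
    also have "\<dots> = (\<Sum>p<?m. \<Sum>q<?m. \<Sum>x<K. \<Sum>k<n. F x k p q)" by (intro sum.cong refl sum.swap)
    also have "\<dots> = (\<Sum>p<?m. \<Sum>q<?m. \<Sum>k<n. \<Sum>x<K. F x k p q)" by (intro sum.cong refl sum.swap)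
    finally show ?thesis by (simp only: F_def)
  qed
  also have "\<dots> = block_sum ?m n b A \<phi>" unfolding block_sum_def
  proof (intro sum.cong refl)
    fix p q k assume "p \<in> {..<?m}"
    then have p: "p div b < K" by (simp add: less_mult_imp_div_less)
    have "(\<Sum>x<K. if p div b = x \<and> q div b = x then cnj (\<phi> (p * n + k)) * A $$ (p,q) * \<phi> (q * n + k) else 0)
      = (\<Sum>x<K. if p div b = x then if p div b = q div b then cnj (\<phi> (p * n + k)) * A $$ (p,q) * \<phi> (q * n + k) else 0 else 0)"
      by (intro sum.cong refl) auto
    then show "(\<Sum>x<K. if p div b = x \<and> q div b = x then cnj (\<phi> (p * n + k)) * A $$ (p,q) * \<phi> (q * n + k) else 0)
      = (if p div b = q div b then cnj (\<phi> (p * n + k)) * A $$ (p,q) * \<phi> (q * n + k) else 0)" using p by simp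
  qed
  finally have "block_sum ?m n b A \<phi> = (\<Sum>x<K. \<Sum>k<n. braket (v x k) A (v x k))" ..
  moreover have "0 \<le> Re (braket (v x k) A (v x k))" for x k
    using A by (simp add: psd_def v_def less_eq_complex_def)
  ultimately show ?thesis by (simp add: sum_nonneg)
qed

lemma block_sum_one: "block_sum m n b (1\<^sub>m m) \<phi> = cip (m * n) \<phi> \<phi>"
proof -
  have "block_sum m n b (1\<^sub>m m) \<phi> = (\<Sum>p<m. \<Sum>q<m. if p = q then \<Sum>k<n. cnj (\<phi> (p * n + k)) * \<phi> (p * n + k) else 0)"
    unfolding block_sum_def by (intro sum.cong refl) (auto intro!: sum.neutral)
  also have "\<dots> = cip (m * n) \<phi> \<phi>" by (simp add: cip_lessThan_mult, simp add: cip_def)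
  finally show ?thesis .
qed

lemma block_sum_diff:
  assumes "A \<in> carrier_mat m m" "B \<in> carrier_mat m m"
  shows "block_sum m n b (A - B) \<phi> = block_sum m n b A \<phi> - block_sum m n b B \<phi>"
  unfolding block_sum_def sum_subtractf[symmetric] using assms
  by (intro sum.cong refl) (auto simp: algebra_simps)

section \<open>The lower bound for adaptive scenarios\<close>

fun adapt_vec :: "nat \<Rightarrow> nat \<Rightarrow> (nat \<Rightarrow> nat) \<Rightarrow> complex vec \<Rightarrow> (nat \<Rightarrow> nat \<Rightarrow> complex mat)
    \<Rightarrow> (nat \<Rightarrow> nat \<Rightarrow> complex) \<Rightarrow> nat \<Rightarrow> nat \<Rightarrow> complex" where
  "adapt_vec d N dims psi V Q 0 = (\<lambda>p. psi $ p)"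
| "adapt_vec d N dims psi V Q (Suc i) = meas_step d (d^(N - Suc i) * dims (Suc i)) Q
     (if i = 0 then adapt_vec d N dims psi V Q 0
      else ctrl_step (d^(N-i) * dims (Suc i)) (d^(N-i) * dims i) (V i) (adapt_vec d N dims psi V Q i))"

lemma power_diff_Suc: "i < N \<Longrightarrow> d ^ (N - i) = d * d ^ (N - Suc i)" for d :: nat
  by (metis Suc_diff_Suc power_Suc)

text \<open>The induction starts after the first use, which no controlled isometry precedes; each
  later use combines \<open>ctrl_block_state\<close> with
  \<open>lift_meas_block_state\<close>.\<close>

lemma adapt_state_block_state:
  assumes P: "P \<in> carrier_mat d d" and E: "\<And>i. cmod (E i) = 1"
    and Q: "\<And>j i. i < d \<Longrightarrow> j < d \<Longrightarrow> Q j i = P $$ (j,i) * E i"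
    and psi: "psi \<in> carrier_vec (d^N * dims 1)" and "i < N"
  shows "adapt_state d N dims psi V P (Suc i)
    = block_state (d^i * d * (d^(N - Suc i) * dims (Suc i))) (d^(N - Suc i) * dims (Suc i)) (adapt_vec d N dims psi V Q (Suc i))"
  using \<open>i < N\<close>
proof (induction i)
  case 0
  have "d^N * dims 1 = d ^ 0 * d * (d^(N - Suc 0) * dims (Suc 0))" "d^N * dims 1 = d * (d^(N - Suc 0) * dims (Suc 0))"
    using power_diff_Suc[OF 0, of d] by simp_all
  then have "outer psi psi = block_state (d ^ 0 * d * (d^(N - Suc 0) * dims (Suc 0))) (d * (d^(N - Suc 0) * dims (Suc 0))) (\<lambda>p. psi $ p)"
    using outer_block_state[OF psi] by metis
  then show ?case
    using lift_meas_block_state[where Q = Q and a = "d^0" and b = "d^(N - Suc 0) * dims (Suc 0)"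
        and \<phi> = "\<lambda>p. psi $ p", OF P E Q] by simp
next
  case (Suc i)
  let ?b = "d^(N - Suc (Suc i)) * dims (Suc (Suc i))" and ?c = "d^(N - Suc i) * dims (Suc i)"
  have r: "d^(N - Suc i) * dims (Suc (Suc i)) = d * ?b" using power_diff_Suc[OF Suc.prems, of d] by simp
  have n: "d^i * d * ?c = d^Suc i * ?c" by simp
  have IH: "adapt_state d N dims psi V P (Suc i) = block_state (d^Suc i * ?c) ?c (adapt_vec d N dims psi V Q (Suc i))"
    using Suc.IH Suc.prems unfolding n by simp
  have "adapt_state d N dims psi V P (Suc (Suc i)) = lift_mid (d^Suc i) d ?b (meas P)
      (block_state (d^Suc i * (d * ?b)) (d * ?b) (ctrl_step (d * ?b) ?c (V (Suc i)) (adapt_vec d N dims psi V Q (Suc i))))"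
    unfolding adapt_state.simps(2)[of _ _ _ _ _ _ "Suc i"] IH Let_def r ctrl_block_state by simp
  also have "\<dots> = block_state (d^Suc i * d * ?b) ?b (adapt_vec d N dims psi V Q (Suc (Suc i)))"
    unfolding adapt_vec.simps(2)[of _ _ _ _ _ _ "Suc i"] r mult.assoc[symmetric, of "d ^ Suc i" d ?b]
    using lift_meas_block_state[where Q = Q, OF P E Q] by simp
  finally show ?case .
qed

text \<open>The controlled isometries are common to both runs and keep the overlap, and the
  computational-basis run is not rotated at all. Thus one use adds at most the angle
  \<open>t\<close>. The bound by \<open>pi\<close> keeps the accumulated angle where the cosine is
  monotone.\<close>

lemma adapt_vec_overlap:
  fixes t :: real
  assumes u: "unitary_fun d Q" and t: "0 \<le> t" "N * t \<le> pi"
    and Q: "\<And>x. cos t * sqn d x \<le> Re (cip d x (mapp d Q x))"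
    and psi: "sqn (d^N * dims 1) (\<lambda>p. psi $ p) = 1"
    and V: "\<And>i k. 1 \<le> i \<Longrightarrow> i < N \<Longrightarrow> k < d^i \<Longrightarrow> isometry (d^(N-i) * dims (Suc i)) (d^(N-i) * dims i) (V i k)"
    and "i < N"
  defines "I \<equiv> \<lambda>j k :: nat. if j = k then 1 else 0"
  defines "n \<equiv> \<lambda>i. d^i * d * (d^(N - Suc i) * dims (Suc i))"
  shows "sqn (n i) (adapt_vec d N dims psi V I (Suc i)) = 1 \<and> sqn (n i) (adapt_vec d N dims psi V Q (Suc i)) = 1
    \<and> cos (Suc i * t) \<le> Re (cip (n i) (adapt_vec d N dims psi V I (Suc i)) (adapt_vec d N dims psi V Q (Suc i)))"
proof -
  have uI: "unitary_fun d I"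
    by (auto simp: unitary_fun_def I_def if_distrib[of "\<lambda>z. z * _"] if_distrib[of cnj] cong: if_cong)
  have I_id: "I j k = (if j = k then 1 else 0)" for j k by (simp add: I_def)
  have mI: "cip (a * d * b) (meas_step d b I \<phi>) \<chi> = cip (a * d * b) \<phi> \<chi>" for a b \<phi> \<chi>
    by (rule cip_cong) (simp_all only: meas_step_identity[where a = a, OF I_id])
  have step: "sqn (a * d * b) (meas_step d b I \<phi>) = 1 \<and> sqn (a * d * b) (meas_step d b Q \<chi>) = 1 \<and>
      cos (s + t) \<le> Re (cip (a * d * b) (meas_step d b I \<phi>) (meas_step d b Q \<chi>))"
    if 1: "sqn (a * d * b) \<phi> = 1" "sqn (a * d * b) \<chi> = 1" and c: "cos s \<le> Re (cip (a * d * b) \<phi> \<chi>)"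
      and s: "0 \<le> s" "s + t \<le> pi" for a b \<phi> \<chi> s
  proof -
    have sI: "sqn (a * d * b) (meas_step d b I \<phi>) = 1" and sQ: "sqn (a * d * b) (meas_step d b Q \<chi>) = 1"
      using cip_meas_step[OF uI, of a b \<phi> \<phi>] cip_meas_step[OF u, of a b \<chi> \<chi>] 1 unfolding cip_self by simp_all
    have "cos t \<le> Re (cip (a * d * b) \<chi> (meas_step d b Q \<chi>))"
      using Re_cip_meas_step_ge[OF Q, of a b \<chi>] 1 by simp
    then have "cos (s + t) \<le> Re (cip (a * d * b) \<phi> (meas_step d b Q \<chi>))"
      by (rule cos_angle_add_le[OF 1 sQ c _ s(1) t(1) s(2)])
    then show ?thesis using sI sQ mI by simp
  qed
  have le_pi: "real i * t + t \<le> pi" if "i < N" for i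
  proof -
    have "real (Suc i) * t \<le> real N * t" using that t(1) by (intro mult_right_mono) auto
    then show ?thesis using t(2) by (simp add: distrib_right)
  qed
  show ?thesis using \<open>i < N\<close>
  proof (induction i)
    case 0
    have n0: "d^N * dims 1 = n 0" using power_diff_Suc[OF 0, of d] by (simp add: n_def)
    have "sqn (n 0) (\<lambda>p. psi $ p) = 1" using psi n0 by simp
    moreover have "cos (0::real) \<le> Re (cip (n 0) (\<lambda>p. psi $ p) (\<lambda>p. psi $ p))"
      unfolding cip_self using calculation by simp
    ultimately show ?case
      using step[of "d^0" "d^(N - Suc 0) * dims (Suc 0)" "\<lambda>p. psi $ p" "\<lambda>p. psi $ p" 0] le_pi[OF 0]
      unfolding n_def by simp
  next
    case (Suc i)
    let ?b = "d^(N - Suc (Suc i)) * dims (Suc (Suc i))" and ?c = "d^(N - Suc i) * dims (Suc i)"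
    let ?W = "ctrl_step (d^(N - Suc i) * dims (Suc (Suc i))) ?c (V (Suc i))"
    have r: "d^Suc i * (d^(N - Suc i) * dims (Suc (Suc i))) = n (Suc i)"
      using power_diff_Suc[OF Suc.prems, of d] by (simp add: n_def)
    have nS: "d^Suc i * d * ?b = n (Suc i)" by (simp add: n_def)
    have ni: "n i = d^Suc i * ?c" by (simp add: n_def)
    have W: "cip (n (Suc i)) (?W \<phi>) (?W \<chi>) = cip (n i) \<phi> \<chi>" for \<phi> \<chi>
      unfolding r[symmetric] ni by (rule cip_ctrl_step) (use V[of "Suc i"] Suc.prems in simp)
    have Ws: "sqn (n (Suc i)) (?W \<phi>) = sqn (n i) \<phi>" for \<phi>
      using W[of \<phi> \<phi>] unfolding cip_self by simp
    have IH: "sqn (n i) (adapt_vec d N dims psi V I (Suc i)) = 1" "sqn (n i) (adapt_vec d N dims psi V Q (Suc i)) = 1"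
      "cos (Suc i * t) \<le> Re (cip (n i) (adapt_vec d N dims psi V I (Suc i)) (adapt_vec d N dims psi V Q (Suc i)))"
      using Suc.IH Suc.prems by simp_all
    have "real (Suc (Suc i)) * t = Suc i * t + t" by (simp add: algebra_simps)
    moreover have "0 \<le> real (Suc i) * t" using t(1) by simp
    ultimately show ?case
      using step[of "d^Suc i" ?b "?W (adapt_vec d N dims psi V I (Suc i))" "?W (adapt_vec d N dims psi V Q (Suc i))" "real (Suc i) * t",
          unfolded nS Ws W, OF IH] le_pi[OF Suc.prems]
      unfolding adapt_vec.simps(2)[of _ _ _ _ _ _ "Suc i"] by simp
  qed
qed

lemma adapt_output_block_state:
  assumes N: "1 \<le> N" and P: "P \<in> carrier_mat d d" and E: "\<And>i. cmod (E i) = 1"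
    and Q: "\<And>j i. i < d \<Longrightarrow> j < d \<Longrightarrow> Q j i = P $$ (j,i) * E i"
    and sc: "adaptive_scenario d N dims d1 d2 psi0 V"
  shows "adapt_output d N dims d1 d2 psi0 V P
    = ptrace_last (d^N * d1) d2 (block_state (d^N * d1 * d2) (d1 * d2) (adapt_vec d N dims psi0 V Q N))"
proof -
  obtain i where i: "N = Suc i" using N by (cases N) auto
  then have iN: "i < N" by simp
  have dN: "dims N = d1 * d2" and psi: "psi0 \<in> carrier_vec (d^N * dims 1)"
    using sc by (simp_all add: adaptive_scenario_def unit_vec_def)
  have dim: "d^(N - Suc i) * dims (Suc i) = d1 * d2" "d^i * d * (d1 * d2) = d^N * d1 * d2"
    using i dN by simp_all
  have "adapt_state d N dims psi0 V P N = block_state (d^N * d1 * d2) (d1 * d2) (adapt_vec d N dims psi0 V Q N)"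
    by (rule adapt_state_block_state[where Q = Q and E = E and N = N and dims = dims and V = V,
          OF P E _ psi iN, unfolded dim(1), unfolded dim(2) i[symmetric]]) (rule Q)
  then show ?thesis by (simp only: adapt_output_def)
qed

lemma adaptive_type_two_nonneg:
  assumes "1 \<le> N" and "U \<in> carrier_mat d d" and "adaptive_scenario d N dims d1 d2 psi0 V" and \<Omega>: "effect (d^N * d1) \<Omega>"
  shows "0 \<le> Re (trace (\<Omega> * adapt_output d N dims d1 d2 psi0 V U))"
proof -
  have p: "psd (d^N * d1) \<Omega>" and c: "\<Omega> \<in> carrier_mat (d^N * d1) (d^N * d1)" using \<Omega> by (simp_all add: effect_def psd_def)
  have "adapt_output d N dims d1 d2 psi0 V U = ptrace_last (d^N * d1) d2 (block_state (d^N * d1 * d2) (d1 * d2)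
      (adapt_vec d N dims psi0 V (\<lambda>j i. U $$ (j,i)) N))"
    by (rule adapt_output_block_state[where E = "\<lambda>_. 1"]) (use assms in simp_all)
  then show ?thesis using block_sum_nonneg[OF p] trace_ptrace_block_state[OF c] by simp
qed

lemma adaptive_type_two_ge:
  fixes t \<beta> :: real
  assumes N: "1 \<le> N" and U: "U \<in> carrier_mat d d"
    and E: "\<And>i. cmod (E i) = 1" and u: "unitary_fun d (\<lambda>j i. U $$ (j,i) * E i)"
    and ge: "\<And>x. cos t * sqn d x \<le> Re (cip d x (mapp d (\<lambda>j i. U $$ (j,i) * E i) x))"
    and ang: "0 \<le> t" "0 \<le> \<beta>" "N * t + \<beta> \<le> pi / 2"
    and sc: "adaptive_scenario d N dims d1 d2 psi0 V"
    and \<Omega>: "effect (d^N * d1) \<Omega>"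
    and type_one: "Re (trace ((1\<^sub>m (d^N * d1) - \<Omega>) * adapt_output d N dims d1 d2 psi0 V (1\<^sub>m d))) \<le> (sin \<beta>)\<^sup>2"
  shows "(cos (N * t + \<beta>))\<^sup>2 \<le> Re (trace (\<Omega> * adapt_output d N dims d1 d2 psi0 V U))"
proof -
  define Q I where "Q = (\<lambda>j i. U $$ (j,i) * E i)" and "I = (\<lambda>j k :: nat. if j = k then 1 else 0 :: complex)"
  define m where "m = d^N * d1"
  have dN: "dims N = d1 * d2" and psi: "unit_vec (d^N * dims 1) psi0"
    and V: "\<And>i k. 1 \<le> i \<Longrightarrow> i < N \<Longrightarrow> k < d^i \<Longrightarrow> isometry (d^(N-i) * dims (Suc i)) (d^(N-i) * dims i) (V i k)"
    using sc by (simp_all add: adaptive_scenario_def)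
  obtain i where i: "N = Suc i" using N by (cases N) auto
  then have iN: "i < N" by simp
  have dim: "d^i * d * (d^(N - Suc i) * dims (Suc i)) = m * d2" "d^(N - Suc i) * dims (Suc i) = d1 * d2"
    "d^i * d * (d1 * d2) = m * d2"
    using i dN by (simp_all add: m_def)
  have psi': "psi0 \<in> carrier_vec (d^N * dims 1)" "sqn (d^N * dims 1) (\<lambda>p. psi0 $ p) = 1"
    using psi by (simp_all add: unit_vec_def sqn_def)
  define \<phi> \<chi> where "\<phi> = adapt_vec d N dims psi0 V I N" and "\<chi> = adapt_vec d N dims psi0 V Q N"
  have out\<phi>: "adapt_output d N dims d1 d2 psi0 V (1\<^sub>m d) = ptrace_last m d2 (block_state (m * d2) (d1 * d2) \<phi>)"
    unfolding \<phi>_def m_def by (rule adapt_output_block_state[where E = "\<lambda>_. 1"]) (use N sc in \<open>auto simp: I_def\<close>)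
  have out\<chi>: "adapt_output d N dims d1 d2 psi0 V U = ptrace_last m d2 (block_state (m * d2) (d1 * d2) \<chi>)"
    unfolding \<chi>_def m_def by (rule adapt_output_block_state[where E = E, OF N U E _ sc]) (simp add: Q_def)
  have Nt: "real N * t \<le> pi" using ang pi_gt_zero by linarith
  have "sqn (m * d2) \<phi> = 1 \<and> sqn (m * d2) \<chi> = 1 \<and> cos (N * t) \<le> Re (cip (m * d2) \<phi> \<chi>)"
    unfolding \<phi>_def \<chi>_def I_def
    by (rule adapt_vec_overlap[where Q = Q and V = V and dims = dims and N = N, OF _ ang(1) Nt _ psi'(2) _ iN,
          unfolded dim(2), unfolded dim(3) i[symmetric]]) (use u ge V in \<open>auto simp: Q_def\<close>)
  then have ov: "sqn (m * d2) \<phi> = 1" "sqn (m * d2) \<chi> = 1" "cos (N * t) \<le> Re (cip (m * d2) \<phi> \<chi>)"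
    by simp_all
  have \<Omega>c: "\<Omega> \<in> carrier_mat m m" and p1: "psd (d^N * d1) \<Omega>" and p2: "psd (d^N * d1) (1\<^sub>m m - \<Omega>)"
    using \<Omega> by (simp_all add: effect_def psd_def m_def)
  \<comment> \<open>Both type errors become values of this form or of its complement on the pure
    vectors \<open>\<phi>\<close> and \<open>\<chi>\<close>, where the angle argument
    applies.\<close>
  define G where "G = block_form d2 d1 \<Omega>"
  have G: "cip (m * d2) x (mapp (m * d2) G x) = block_sum m d2 d1 \<Omega> x" for x
    unfolding G_def by (rule cip_block_form)
  have G': "block_sum m d2 d1 (1\<^sub>m m - \<Omega>) x = sqn (m * d2) x - cip (m * d2) x (mapp (m * d2) G x)" for x
    unfolding block_sum_diff[OF one_carrier_mat \<Omega>c] block_sum_one G cip_self ..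
  have "(cos (N * t + \<beta>))\<^sup>2 \<le> Re (cip (m * d2) \<chi> (mapp (m * d2) G \<chi>))"
  proof (rule type_two_error_ge[OF _ _ ov _ _ ang(2,3)])
    show "0 \<le> Re (cip (m * d2) x (mapp (m * d2) G x))" for x
      unfolding G unfolding m_def by (rule block_sum_nonneg[OF p1])
    show "Re (cip (m * d2) x (mapp (m * d2) G x)) \<le> sqn (m * d2) x" for x
      using block_sum_nonneg[OF p2, of d2 x] G'[of x] unfolding m_def by simp
    have "Re (block_sum m d2 d1 (1\<^sub>m m - \<Omega>) \<phi>) \<le> (sin \<beta>)\<^sup>2"
      using type_one unfolding out\<phi> m_def[symmetric] trace_ptrace_block_state[OF minus_carrier_mat[OF \<Omega>c]] .
    then show "(cos \<beta>)\<^sup>2 \<le> Re (cip (m * d2) \<phi> (mapp (m * d2) G \<phi>))"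
      unfolding G' cos_squared_eq using ov by simp
    show "0 \<le> real N * t" using ang by simp
  qed
  then show ?thesis unfolding out\<chi> trace_ptrace_block_state[OF \<Omega>c] G .
qed

section \<open>Product vectors and block tests\<close>

text \<open>Counted from the least significant digit, whereas registers are ordered from the most
  significant one: the register measured in step \<open>i\<close> is digit
  \<open>N - Suc i\<close>.\<close>

definition digit :: "nat \<Rightarrow> nat \<Rightarrow> nat \<Rightarrow> nat" where
  "digit m e A = A div m ^ e mod m"

lemma digit_less: "0 < m \<Longrightarrow> digit m e A < m"
  by (simp add: digit_def)

lemma digit_replace:
  assumes y: "y < d ^ e0" and j: "j < d"
  shows "digit d e ((x * d + j) * d ^ e0 + y)
    = (if e < e0 then digit d e y else if e = e0 then j else digit d (e - Suc e0) x)"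
proof -
  have d: "0 < d" using j by simp
  consider (lt) "e < e0" | (eq) "e = e0" | (gt) "e0 < e" by linarith
  then show ?thesis
  proof cases
    case lt
    then have "d ^ e0 = d ^ e * (d * d ^ (e0 - Suc e))"
      by (metis Suc_diff_Suc add_diff_inverse_nat less_imp_le_nat not_less power_Suc power_add)
    then have E: "(x * d + j) * d ^ e0 + y = y + d ^ e * (d * ((x * d + j) * d ^ (e0 - Suc e)))"
      by (simp add: mult_ac)
    show ?thesis using lt d unfolding digit_def E by simp
  next
    case eq
    then show ?thesis using y j d by (simp add: digit_def)
  next
    case gt
    then have "d ^ e = d ^ e0 * (d * d ^ (e - Suc e0))"
      by (metis Suc_diff_Suc add_diff_inverse_nat less_imp_le_nat not_less power_Suc power_add)
    then show ?thesis using gt y j d by (simp add: digit_def div_mult2_eq)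
  qed
qed

text \<open>Digits identify the indices below \<open>m ^ N\<close> with \<open>N\<close>-tuples, so
  this is distributivity.\<close>

lemma sum_prod_digit:
  fixes f :: "nat \<Rightarrow> nat \<Rightarrow> 'a::comm_ring_1"
  shows "(\<Sum>A<m ^ N. \<Prod>e<N. f e (digit m e A)) = (\<Prod>e<N. \<Sum>a<m. f e a)"
proof (induction N)
  case (Suc N)
  have "(\<Sum>A<m ^ Suc N. \<Prod>e<Suc N. f e (digit m e A))
      = (\<Sum>a<m. \<Sum>A<m ^ N. \<Prod>e<Suc N. f e (digit m e (a * m ^ N + A)))"
    unfolding power_Suc by (rule sum_lessThan_mult)
  also have "\<dots> = (\<Sum>a<m. \<Sum>A<m ^ N. f N a * (\<Prod>e<N. f e (digit m e A)))"
  proof (intro sum.cong refl)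
    fix a A assume "a \<in> {..<m}" "A \<in> {..<m ^ N}"
    then have "digit m e (a * m ^ N + A) = (if e < N then digit m e A else a)" if "e < Suc N" for e
      using digit_replace[of A m N a e 0] that by auto
    then show "(\<Prod>e<Suc N. f e (digit m e (a * m ^ N + A))) = f N a * (\<Prod>e<N. f e (digit m e A))"
      by (simp add: mult.commute)
  qed
  also have "\<dots> = (\<Prod>e<Suc N. \<Sum>a<m. f e a)"
    by (simp add: Suc.IH[symmetric] sum_distrib_left[symmetric] sum_distrib_right[symmetric] mult.commute)
  finally show ?case .
qed simp

lemma mult_add_div: "x < n \<Longrightarrow> (l * n + x) div n = l" for n :: nat
  by simp

lemma cip_prod_digit:
  fixes X Z :: "nat \<Rightarrow> nat \<Rightarrow> nat \<Rightarrow> nat \<Rightarrow> complex" and k :: "nat \<Rightarrow> nat"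
  shows "cip (L * m ^ N) (\<lambda>y. g (y div m ^ N) * (\<Prod>e<N. X (y div m ^ N) e (digit m e (y mod m ^ N)) (k e)))
      (\<lambda>y. h (y div m ^ N) * (\<Prod>e<N. Z (y div m ^ N) e (digit m e (y mod m ^ N)) (k e)))
    = (\<Sum>l<L. cnj (g l) * h l * (\<Prod>e<N. \<Sum>a<m. cnj (X l e a (k e)) * Z l e a (k e)))"
  unfolding cip_lessThan_mult
proof (intro sum.cong refl)
  fix l
  have "cip (m ^ N) (\<lambda>s. g ((l * m ^ N + s) div m ^ N) * (\<Prod>e<N. X ((l * m ^ N + s) div m ^ N) e (digit m e ((l * m ^ N + s) mod m ^ N)) (k e)))
      (\<lambda>s. h ((l * m ^ N + s) div m ^ N) * (\<Prod>e<N. Z ((l * m ^ N + s) div m ^ N) e (digit m e ((l * m ^ N + s) mod m ^ N)) (k e)))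
    = (\<Sum>A<m ^ N. cnj (g l) * h l * (\<Prod>e<N. cnj (X l e (digit m e A) (k e)) * Z l e (digit m e A) (k e)))"
    unfolding cip_def by (intro sum.cong refl) (simp add: mult_add_div prod.distrib mult_ac)
  also have "\<dots> = cnj (g l) * h l * (\<Prod>e<N. \<Sum>a<m. cnj (X l e a (k e)) * Z l e a (k e))"
    unfolding sum_distrib_left[symmetric] sum_prod_digit[where f = "\<lambda>e a. cnj (X l e a (k e)) * Z l e a (k e)"] ..
  finally show "cip (m ^ N) (\<lambda>s. g ((l * m ^ N + s) div m ^ N) * (\<Prod>e<N. X ((l * m ^ N + s) div m ^ N) e (digit m e ((l * m ^ N + s) mod m ^ N)) (k e)))
      (\<lambda>s. h ((l * m ^ N + s) div m ^ N) * (\<Prod>e<N. Z ((l * m ^ N + s) div m ^ N) e (digit m e ((l * m ^ N + s) mod m ^ N)) (k e)))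
    = cnj (g l) * h l * (\<Prod>e<N. \<Sum>a<m. cnj (X l e a (k e)) * Z l e a (k e))" .
qed

section \<open>Tests of rank one in each block\<close>

lemma cip_Cauchy_Schwarz: "(cmod (cip n x y))\<^sup>2 \<le> sqn n x * sqn n y"
proof (cases "cip n x y = 0")
  case False
  define c where "c = cip n x y"
  have c: "0 < (cmod c)\<^sup>2" using False by (simp add: c_def)
  \<comment> \<open>Multiplying \<open>y\<close> by \<open>cnj c\<close> makes the inner product
    real, which reduces the claim to the real-part version.\<close>
  have "cip n x (\<lambda>k. cnj c * y k) = complex_of_real ((cmod c)\<^sup>2)"
    unfolding cip_scale_right c_def[symmetric] complex_norm_square by simp
  then have "((cmod c)\<^sup>2)\<^sup>2 \<le> sqn n x * ((cmod c)\<^sup>2 * sqn n y)"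
    using Re_cip_Cauchy_Schwarz[of n x "\<lambda>k. cnj c * y k"] unfolding sqn_scale by simp
  then have "(cmod c)\<^sup>2 * (cmod c)\<^sup>2 \<le> (cmod c)\<^sup>2 * (sqn n x * sqn n y)" by (simp add: power2_eq_square mult_ac)
  then show ?thesis using mult_le_cancel_left_pos[OF c] unfolding c_def by blast
qed simp

lemma braket_block_state:
  assumes v: "v \<in> carrier_vec (K * b)"
  shows "braket v (block_state (K * b) b w) v
    = complex_of_real (\<Sum>x<K. (cmod (cip b (\<lambda>y. w (x * b + y)) (\<lambda>y. v $ (x * b + y))))\<^sup>2)"
proof -
  have "braket v (block_state (K * b) b w) v = (\<Sum>p<K * b. cnj (v $ p) * (\<Sum>q<K * b. (if p div b = q div b then w p * cnj (w q) else 0) * v $ q))"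
    unfolding braket_def using v by (simp add: scalar_prod_def atLeast0LessThan block_state_def)
  also have "\<dots> = (\<Sum>x<K. \<Sum>y<b. cnj (v $ (x * b + y)) * (\<Sum>x'<K. \<Sum>y'<b. (if x = x' then w (x * b + y) * cnj (w (x' * b + y')) else 0) * v $ (x' * b + y')))"
    unfolding sum_lessThan_mult by (intro sum.cong refl arg_cong2[where f = "(*)"]) simp_all
  also have "\<dots> = (\<Sum>x<K. \<Sum>y<b. cnj (v $ (x * b + y)) * (\<Sum>y'<b. w (x * b + y) * cnj (w (x * b + y')) * v $ (x * b + y')))"
  proof (intro sum.cong refl, rule arg_cong2[where f = "(*)", OF refl])
    fix x y assume "x \<in> {..<K}"
    have "(\<Sum>x'<K. \<Sum>y'<b. (if x = x' then w (x * b + y) * cnj (w (x' * b + y')) else 0) * v $ (x' * b + y'))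
      = (\<Sum>x'<K. if x = x' then \<Sum>y'<b. w (x * b + y) * cnj (w (x * b + y')) * v $ (x * b + y') else 0)"
      by (intro sum.cong refl) auto
    then show "(\<Sum>x'<K. \<Sum>y'<b. (if x = x' then w (x * b + y) * cnj (w (x' * b + y')) else 0) * v $ (x' * b + y'))
      = (\<Sum>y'<b. w (x * b + y) * cnj (w (x * b + y')) * v $ (x * b + y'))" using \<open>x \<in> {..<K}\<close> by simp
  qed
  also have "\<dots> = (\<Sum>x<K. cnj (cip b (\<lambda>y. w (x * b + y)) (\<lambda>y. v $ (x * b + y))) * cip b (\<lambda>y. w (x * b + y)) (\<lambda>y. v $ (x * b + y)))"
    unfolding cip_def cnj_sum sum_product by (intro sum.cong refl) (simp add: sum_distrib_left mult_ac)
  also have "\<dots> = complex_of_real (\<Sum>x<K. (cmod (cip b (\<lambda>y. w (x * b + y)) (\<lambda>y. v $ (x * b + y))))\<^sup>2)"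
    unfolding of_real_sum complex_norm_square by (simp add: mult.commute)
  finally show ?thesis .
qed

lemma sqn_lessThan_mult: "sqn (K * b) \<phi> = (\<Sum>x<K. sqn b (\<lambda>y. \<phi> (x * b + y)))"
  unfolding sqn_def by (rule sum_lessThan_mult)

text \<open>Read as a test, a block state applies a rank-one operator chosen by the outcome. Each
  block vector has norm at most one, so Cauchy-Schwarz bounds each block by the identity.\<close>

lemma effect_block_state:
  assumes w: "\<And>x. x < K \<Longrightarrow> sqn b (\<lambda>y. w (x * b + y)) \<le> 1"
  shows "effect (K * b) (block_state (K * b) b w)"
proof -
  let ?B = "block_state (K * b) b w"
  have B: "?B \<in> carrier_mat (K * b) (K * b)" by (simp add: block_state_def)
  have "0 \<le> braket v (1\<^sub>m (K * b) - ?B) v" if v: "v \<in> carrier_vec (K * b)" for v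
  proof -
    have "braket v (1\<^sub>m (K * b) - ?B) v = cip (K * b) (\<lambda>p. v $ p) (\<lambda>p. v $ p) - braket v ?B v"
      unfolding braket_def cip_def minus_mult_distrib_mat_vec[OF one_carrier_mat B v] using v B
      by (simp add: right_diff_distrib sum_subtractf del: index_mult_mat_vec)
    also have "\<dots> = complex_of_real (sqn (K * b) (\<lambda>p. v $ p) - (\<Sum>x<K. (cmod (cip b (\<lambda>y. w (x * b + y)) (\<lambda>y. v $ (x * b + y))))\<^sup>2))"
      unfolding cip_self braket_block_state[OF v] by simp
    finally have eq: "braket v (1\<^sub>m (K * b) - ?B) v = \<dots>" .
    have "(\<Sum>x<K. (cmod (cip b (\<lambda>y. w (x * b + y)) (\<lambda>y. v $ (x * b + y))))\<^sup>2) \<le> sqn (K * b) (\<lambda>p. v $ p)"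
      unfolding sqn_lessThan_mult
    proof (intro sum_mono)
      fix x assume "x \<in> {..<K}"
      then have "sqn b (\<lambda>y. w (x * b + y)) * sqn b (\<lambda>y. v $ (x * b + y)) \<le> 1 * sqn b (\<lambda>y. v $ (x * b + y))"
        by (intro mult_right_mono w) auto
      then show "(cmod (cip b (\<lambda>y. w (x * b + y)) (\<lambda>y. v $ (x * b + y))))\<^sup>2 \<le> sqn b (\<lambda>y. v $ (x * b + y))"
        by (intro order_trans[OF cip_Cauchy_Schwarz]) simp
    qed
    then show ?thesis unfolding eq by (simp add: less_eq_complex_def)
  qed
  moreover have "0 \<le> braket v ?B v" if "v \<in> carrier_vec (K * b)" for v
    unfolding braket_block_state[OF that] by (simp add: less_eq_complex_def sum_nonneg)
  ultimately show ?thesis using B minus_carrier_mat[OF B] by (simp add: effect_def psd_def)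
qed

lemma trace_block_state:
  "Re (trace (block_state (K * b) b w * block_state (K * b) b \<phi>))
    = (\<Sum>x<K. (cmod (cip b (\<lambda>y. w (x * b + y)) (\<lambda>y. \<phi> (x * b + y))))\<^sup>2)"
proof -
  let ?v = "vec (K * b) \<phi>" and ?B = "block_state (K * b) b w"
  have "trace (?B * block_state (K * b) b \<phi>) = (\<Sum>p<K * b. \<Sum>q<K * b.
      (if p div b = q div b then w p * cnj (w q) else 0) * (if q div b = p div b then \<phi> q * cnj (\<phi> p) else 0))"
    by (simp add: trace_def scalar_prod_def block_state_def atLeast0LessThan)
  also have "\<dots> = braket ?v ?B ?v"
    unfolding braket_def by (simp add: scalar_prod_def block_state_def atLeast0LessThan sum_distrib_left)
      (intro sum.cong refl, auto)
  also have "\<dots> = complex_of_real (\<Sum>x<K. (cmod (cip b (\<lambda>y. w (x * b + y)) (\<lambda>y. ?v $ (x * b + y))))\<^sup>2)"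
    by (rule braket_block_state) simp
  also have "(\<Sum>x<K. (cmod (cip b (\<lambda>y. w (x * b + y)) (\<lambda>y. ?v $ (x * b + y))))\<^sup>2)
      = (\<Sum>x<K. (cmod (cip b (\<lambda>y. w (x * b + y)) (\<lambda>y. \<phi> (x * b + y))))\<^sup>2)"
    by (intro sum.cong refl arg_cong[where f = "\<lambda>z. (cmod z)\<^sup>2"] cip_cong) (simp_all add: mult_add_less)
  finally show ?thesis by simp
qed

section \<open>Parallel scenarios\<close>

lemma block_state_cong: "(\<And>p. p < n \<Longrightarrow> \<phi> p = \<chi> p) \<Longrightarrow> block_state n b \<phi> = block_state n b \<chi>"
  by (intro eq_matI) (auto simp: block_state_def)

lemma meas_step_cong:
  assumes "\<And>p. p < a * d * b \<Longrightarrow> \<phi> p = \<chi> p" "p < a * d * b"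
  shows "meas_step d b Q \<phi> p = meas_step d b Q \<chi> p"
proof -
  have pos: "0 < b" "0 < d" using assms(2) by (auto intro!: Nat.gr0I)
  then have "p div b div d < a" using assms(2) by (simp add: less_mult_imp_div_less)
  then show ?thesis unfolding meas_step_def using pos
    by (intro mapp_cong assms(1) mult_add_less) simp_all
qed

fun par_vec :: "nat \<Rightarrow> nat \<Rightarrow> nat \<Rightarrow> (nat \<Rightarrow> nat \<Rightarrow> complex) \<Rightarrow> (nat \<Rightarrow> complex) \<Rightarrow> nat \<Rightarrow> nat \<Rightarrow> complex" where
  "par_vec d N d' Q \<psi> 0 = \<psi>"
| "par_vec d N d' Q \<psi> (Suc i) = meas_step d (d^(N - Suc i) * d') Q (par_vec d N d' Q \<psi> i)"

lemma power_split: "i < N \<Longrightarrow> d ^ N * d' = d ^ i * d * (d ^ (N - Suc i) * d')" for d :: nat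
proof -
  assume "i < N"
  then have "N = i + Suc (N - Suc i)" by simp
  then have "d ^ N = d ^ i * (d * d ^ (N - Suc i))" by (metis power_Suc power_add)
  then show ?thesis by simp
qed

lemma par_apply_block_state:
  assumes P: "P \<in> carrier_mat d d" and E: "\<And>i. cmod (E i) = 1"
    and Q: "\<And>j i. i < d \<Longrightarrow> j < d \<Longrightarrow> Q j i = P $$ (j,i) * E i"
    and psi: "psi \<in> carrier_vec (d^N * d')" and "i \<le> N"
  shows "par_apply d N d' P i (outer psi psi)
    = block_state (d^N * d') (d^(N - i) * d') (par_vec d N d' Q (\<lambda>p. psi $ p) i)"
  using \<open>i \<le> N\<close>
proof (induction i)
  case 0
  then show ?case using outer_block_state[OF psi] by simp
next
  case (Suc i)
  then have i: "i < N" by simp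
  let ?b = "d ^ (N - Suc i) * d'"
  have b: "d ^ (N - i) * d' = d * ?b" using i by (metis Suc_diff_Suc mult.assoc power_Suc)
  have IH: "par_apply d N d' P i (outer psi psi)
     = block_state (d^i * d * ?b) (d * ?b) (par_vec d N d' Q (\<lambda>p. psi $ p) i)"
    using Suc.IH i unfolding b power_split[OF i] by simp
  have "par_apply d N d' P (Suc i) (outer psi psi) = lift_mid (d^i) d ?b (meas P) (par_apply d N d' P i (outer psi psi))"
    by simp
  also have "\<dots> = block_state (d^i * d * ?b) ?b (meas_step d ?b Q (par_vec d N d' Q (\<lambda>p. psi $ p) i))"
    unfolding IH by (rule lift_meas_block_state[where Q = Q, OF P E]) (rule Q)
  finally show ?case unfolding power_split[OF i] by simp
qed

lemma par_output_block_state: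
  assumes "P \<in> carrier_mat d d" and "\<And>i. cmod (E i) = 1"
    and "\<And>j i. i < d \<Longrightarrow> j < d \<Longrightarrow> Q j i = P $$ (j,i) * E i"
    and "psi \<in> carrier_vec (d^N * d')"
  shows "par_output d N d' P psi = block_state (d^N * d') d' (par_vec d N d' Q (\<lambda>p. psi $ p) N)"
  unfolding par_output_def using par_apply_block_state[where Q = Q and E = E and i = N, OF assms(1,2) _ assms(4)] assms(3) by simp

lemma parallel_type_two_nonneg:
  assumes U: "U \<in> carrier_mat d d" and psi: "psi \<in> carrier_vec (d^N * d')" and \<Omega>: "effect (d^N * d') \<Omega>"
  shows "0 \<le> Re (trace (\<Omega> * par_output d N d' U psi))"
proof -
  define \<chi> where "\<chi> = par_vec d N d' (\<lambda>j i. U $$ (j,i)) (\<lambda>p. psi $ p) N"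
  have p: "psd (d^N * d') \<Omega>" and c: "\<Omega> \<in> carrier_mat (d^N * d') (d^N * d')"
    using \<Omega> by (simp_all add: effect_def psd_def)
  have "par_output d N d' U psi = block_state (d^N * d') d' \<chi>"
    unfolding \<chi>_def by (rule par_output_block_state[where E = "\<lambda>_. 1"]) (use U psi in simp_all)
  also have "\<dots> = ptrace_last (d^N * d') 1 (block_state (d^N * d' * 1) (d' * 1) \<chi>)"
    by (intro eq_matI) (simp_all add: ptrace_last_def block_state_def)
  finally show ?thesis using trace_ptrace_block_state[OF c] block_sum_nonneg[OF p] by metis
qed

lemma p2_parallel_le:
  assumes U: "U \<in> carrier_mat d d" and "unit_vec (d^N * d') psi" "effect (d^N * d') \<Omega>"
    "Re (trace ((1\<^sub>m (d^N * d') - \<Omega>) * par_output d N d' (1\<^sub>m d) psi)) \<le> \<delta>"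
  shows "p2_parallel \<delta> U d N \<le> Re (trace (\<Omega> * par_output d N d' U psi))"
  unfolding p2_parallel_def
proof (rule cInf_lower)
  show "bdd_below {Re (trace (\<Omega> * par_output d N d' U psi)) | d' psi \<Omega>.
      unit_vec (d^N * d') psi \<and> effect (d^N * d') \<Omega> \<and>
      Re (trace ((1\<^sub>m (d^N * d') - \<Omega>) * par_output d N d' (1\<^sub>m d) psi)) \<le> \<delta>}"
    by (rule bdd_belowI[of _ 0]) (auto simp: unit_vec_def intro!: parallel_type_two_nonneg[OF U])
qed (use assms in blast)

lemma par_vec_identity:
  fixes I :: "nat \<Rightarrow> nat \<Rightarrow> complex"
  assumes I: "\<And>j k. I j k = (if j = k then 1 else 0)" and "i \<le> N" "p < d^N * d'"
  shows "par_vec d N d' I \<psi> i p = \<psi> p"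
  using \<open>i \<le> N\<close> \<open>p < d^N * d'\<close>
proof (induction i arbitrary: p)
  case (Suc i)
  let ?b = "d ^ (N - Suc i) * d'"
  have n: "d ^ N * d' = d ^ i * d * ?b" using power_split Suc.prems by simp
  have p: "p < d ^ i * d * ?b" using Suc.prems(2) unfolding n .
  have "par_vec d N d' I \<psi> (Suc i) p = meas_step d ?b I \<psi> p"
    unfolding par_vec.simps(2) by (rule meas_step_cong[OF _ p]) (use Suc n in simp)
  also have "\<dots> = \<psi> p" by (rule meas_step_identity[OF I p])
  finally show ?case .
qed simp

text \<open>The ancilla holds a label \<open>l\<close> and \<open>N\<close> purifying indices in
  base \<open>m\<close>. Tracing it out leaves the mixture, with weights
  \<open>(cmod (g l))\<^sup>2\<close>, of the products over \<open>e\<close> of the matrices with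
  columns \<open>X l e\<close>.\<close>

definition prod_vec :: "nat \<Rightarrow> nat \<Rightarrow> nat \<Rightarrow> nat \<Rightarrow> (nat \<Rightarrow> complex)
    \<Rightarrow> (nat \<Rightarrow> nat \<Rightarrow> nat \<Rightarrow> nat \<Rightarrow> complex) \<Rightarrow> nat \<Rightarrow> complex" where
  "prod_vec d N L m g X p = g (p mod (L * m ^ N) div m ^ N) * (\<Prod>e<N. X (p mod (L * m ^ N) div m ^ N) e
     (digit m e (p mod (L * m ^ N) mod m ^ N)) (digit d e (p div (L * m ^ N))))"

lemma meas_step_prod_vec:
  assumes i: "i < N" and p: "p < d ^ N * (L * m ^ N)"
  shows "meas_step d (d ^ (N - Suc i) * (L * m ^ N)) Q (prod_vec d N L m g X) p
    = prod_vec d N L m g (\<lambda>l e. if e = N - Suc i then \<lambda>a. mapp d (madj Q) (X l e a) else X l e) p"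
proof -
  define e0 d' b where "e0 = N - Suc i" and "d' = L * m ^ N" and "b = d ^ e0 * d'"
  have e0: "e0 < N" using i by (simp add: e0_def)
  define x j y where "x = p div b div d" and "j = p div b mod d" and "y = p mod b"
  have "p < d ^ i * d * b" using p unfolding power_split[OF i] b_def e0_def d'_def .
  then have pos: "0 < d" "0 < b" by (auto intro!: Nat.gr0I)
  have d': "0 < d'" using pos by (simp add: b_def)
  have j: "j < d" and y: "y < b" using pos by (simp_all add: j_def y_def)
  have pe: "p = (x * d + j) * b + y" by (simp add: x_def j_def y_def)
  define y1 y2 where "y1 = y div d'" and "y2 = y mod d'"
  have y1: "y1 < d ^ e0" using y by (simp add: y1_def b_def less_mult_imp_div_less)
  have q: "((x * d + k) * b + y) div d' = (x * d + k) * d ^ e0 + y1" "((x * d + k) * b + y) mod d' = y2" for k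
  proof -
    have *: "(x * d + k) * b + y = y + d' * ((x * d + k) * d ^ e0)" by (simp add: b_def mult_ac)
    show "((x * d + k) * b + y) div d' = (x * d + k) * d ^ e0 + y1" "((x * d + k) * b + y) mod d' = y2"
      unfolding * y1_def y2_def using d' by simp_all
  qed
  define l A where "l = y2 div m ^ N" and "A = y2 mod m ^ N"
  define D where "D = (\<lambda>e. if e < e0 then digit d e y1 else digit d (e - Suc e0) x)"
  have dig: "digit d e ((x * d + k) * d ^ e0 + y1) = (if e = e0 then k else D e)" if "k < d" for e k
    using digit_replace[OF y1 that, of e x] by (simp add: D_def)
  have pv: "prod_vec d N L m g Z ((x * d + k) * b + y)
      = Z l e0 (digit m e0 A) k * (g l * (\<Prod>e\<in>{..<N} - {e0}. Z l e (digit m e A) (D e)))" if "k < d" for k Z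
  proof -
    have "prod_vec d N L m g Z ((x * d + k) * b + y) = g l * (\<Prod>e<N. Z l e (digit m e A) (if e = e0 then k else D e))"
      unfolding prod_vec_def d'_def[symmetric] q l_def[symmetric] A_def[symmetric] dig[OF that] ..
    also have "(\<Prod>e<N. Z l e (digit m e A) (if e = e0 then k else D e))
      = Z l e0 (digit m e0 A) k * (\<Prod>e\<in>{..<N} - {e0}. Z l e (digit m e A) (D e))"
      using e0 by (subst prod.remove[of _ e0]) (auto intro!: prod.cong)
    finally show ?thesis by (simp add: mult_ac)
  qed
  let ?C = "g l * (\<Prod>e\<in>{..<N} - {e0}. X l e (digit m e A) (D e))"
  have "meas_step d b Q (prod_vec d N L m g X) p = mapp d (madj Q) (\<lambda>k. prod_vec d N L m g X ((x * d + k) * b + y)) j"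
    by (simp add: meas_step_def x_def j_def y_def)
  also have "\<dots> = mapp d (madj Q) (\<lambda>k. ?C * X l e0 (digit m e0 A) k) j"
    by (rule mapp_cong) (subst pv, simp_all add: mult_ac)
  also have "\<dots> = ?C * mapp d (madj Q) (X l e0 (digit m e0 A)) j" by (rule mapp_scale)
  also have "\<dots> = prod_vec d N L m g (\<lambda>l e. if e = e0 then \<lambda>a. mapp d (madj Q) (X l e a) else X l e) p"
    unfolding pe pv[OF j] by (simp add: mult_ac)
  finally show ?thesis by (simp only: b_def e0_def d'_def)
qed

text \<open>Each use rotates one factor of the product; after \<open>i\<close> uses these are the
  \<open>i\<close> most significant digits.\<close>

lemma par_vec_prod_vec:
  assumes "i \<le> N" "p < d ^ N * (L * m ^ N)"
  shows "par_vec d N (L * m ^ N) Q (prod_vec d N L m g X) i p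
    = prod_vec d N L m g (\<lambda>l e. if N - i \<le> e \<and> e < N then \<lambda>a. mapp d (madj Q) (X l e a) else X l e) p"
  using assms
proof (induction i arbitrary: p)
  case 0
  have "(\<lambda>l e. if N - 0 \<le> e \<and> e < N then \<lambda>a. mapp d (madj Q) (X l e a) else X l e) = X" by (intro ext) auto
  then show ?case by simp
next
  case (Suc i)
  then have i: "i < N" by simp
  let ?d' = "L * m ^ N"
  let ?Z = "\<lambda>i l e. if N - i \<le> e \<and> e < N then \<lambda>a. mapp d (madj Q) (X l e a) else X l e"
  have "par_vec d N ?d' Q (prod_vec d N L m g X) (Suc i) p = meas_step d (d ^ (N - Suc i) * ?d') Q (prod_vec d N L m g (?Z i)) p"
    unfolding par_vec.simps(2) using Suc power_split[OF i, of d ?d']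
    by (intro meas_step_cong[where a = "d ^ i"]) simp_all
  also have "\<dots> = prod_vec d N L m g (\<lambda>l e. if e = N - Suc i then \<lambda>a. mapp d (madj Q) (?Z i l e a) else ?Z i l e) p"
    by (rule meas_step_prod_vec[OF i Suc.prems(2)])
  also have "(\<lambda>l e. if e = N - Suc i then \<lambda>a. mapp d (madj Q) (?Z i l e a) else ?Z i l e) = ?Z (Suc i)"
    using i by (intro ext) auto
  finally show ?case .
qed

section \<open>Product inputs\<close>

text \<open>Every label has the same outcome distribution, and the two conditional vectors of a
  label overlap in \<open>\<zeta> l e\<close> at each register regardless of the outcome. The label
  amplitude \<open>f\<close> therefore yields the same conditional acceptance probability for every
  outcome string, and the sum over strings is trivial.\<close>

lemma parallel_product_bound:
  fixes X :: "nat \<Rightarrow> nat \<Rightarrow> nat \<Rightarrow> nat \<Rightarrow> complex" and \<zeta> :: "nat \<Rightarrow> nat \<Rightarrow> complex"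
    and f :: "nat \<Rightarrow> complex" and w p :: "nat \<Rightarrow> real"
  assumes U: "U \<in> carrier_mat d d" and E: "\<And>i. cmod (E i) = 1"
    and Q: "\<And>j i. i < d \<Longrightarrow> j < d \<Longrightarrow> Q j i = U $$ (j,i) * E i"
    and d: "0 < d" and w: "\<And>l. 0 \<le> w l" "(\<Sum>l<L. w l) = 1" and p: "(\<Sum>k<d. p k) = 1"
    and X: "\<And>l e k. k < d \<Longrightarrow> (\<Sum>a<m. (cmod (X l e a k))\<^sup>2) = p k"
    and \<zeta>: "\<And>l e k. k < d \<Longrightarrow> (\<Sum>a<m. cnj (X l e a k) * mapp d (madj Q) (X l e a) k) = p k * \<zeta> l e"
    and f: "(\<Sum>l<L. w l * (cmod (f l))\<^sup>2) \<le> 1"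
    and type_one: "1 - \<delta> \<le> (cmod (\<Sum>l<L. w l * cnj (f l)))\<^sup>2"
  shows "p2_parallel \<delta> U d N \<le> (cmod (\<Sum>l<L. w l * cnj (f l) * (\<Prod>e<N. \<zeta> l e)))\<^sup>2"
proof -
  define d' where "d' = L * m ^ N"
  define g where "g = (\<lambda>l. complex_of_real (sqrt (w l)))"
  have gg: "cnj (g l) * g l = w l" for l
    using w(1)[of l] by (simp add: g_def of_real_mult[symmetric] del: of_real_mult)
  define Y where "Y = (\<lambda>l e a. mapp d (madj Q) (X l e a))"
  define \<psi> \<chi> where "\<psi> = prod_vec d N L m g X" and "\<chi> = prod_vec d N L m g Y"
  define pr where "pr = (\<lambda>K. \<Prod>e<N. p (digit d e K))"
  \<comment> \<open>For each outcome string, the conditional vector of the first hypothesis,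
    normalised and reweighted by \<open>f\<close> on the label. Strings of probability
    \<open>0\<close> receive the zero test, because division by \<open>0\<close> gives
    \<open>0\<close>.\<close>
  define tst where "tst = (\<lambda>x. f (x mod d' div m ^ N) * \<psi> x / sqrt (pr (x div d')))"
  have p0: "0 \<le> p k" if "k < d" for k using X[OF that, of 0 0] by (metis sum_nonneg zero_le_power2)
  have dl: "digit d e K < d" for e K using d by (rule digit_less)
  have pr0: "0 \<le> pr K" for K unfolding pr_def by (intro prod_nonneg ballI p0 dl)
  have prsum: "(\<Sum>K<d ^ N. pr K) = 1"
    unfolding pr_def sum_prod_digit[where f = "\<lambda>e. p"] p by simp
  have ip: "cip d' (\<lambda>y. h (y div m ^ N) * prod_vec d N L m g A (K * d' + y)) (\<lambda>y. prod_vec d N L m g B (K * d' + y))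
      = (\<Sum>l<L. cnj (h l) * w l * (\<Prod>e<N. \<Sum>a<m. cnj (A l e a (digit d e K)) * B l e a (digit d e K)))" for h K A B
  proof -
    have "cip d' (\<lambda>y. h (y div m ^ N) * prod_vec d N L m g A (K * d' + y)) (\<lambda>y. prod_vec d N L m g B (K * d' + y))
      = cip (L * m ^ N) (\<lambda>y. (\<lambda>l. h l * g l) (y div m ^ N) * (\<Prod>e<N. A (y div m ^ N) e (digit m e (y mod m ^ N)) (digit d e K)))
      (\<lambda>y. g (y div m ^ N) * (\<Prod>e<N. B (y div m ^ N) e (digit m e (y mod m ^ N)) (digit d e K)))"
      unfolding d'_def by (rule cip_cong) (simp_all add: prod_vec_def mult_add_div)
    also have "\<dots> = (\<Sum>l<L. cnj (h l * g l) * g l * (\<Prod>e<N. \<Sum>a<m. cnj (A l e a (digit d e K)) * B l e a (digit d e K)))"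
      by (rule cip_prod_digit)
    also have "\<dots> = (\<Sum>l<L. cnj (h l) * w l * (\<Prod>e<N. \<Sum>a<m. cnj (A l e a (digit d e K)) * B l e a (digit d e K)))"
    proof -
      have "cnj (h l * g l) * g l = cnj (h l) * w l" for l by (simp add: gg mult.assoc)
      then show ?thesis by (simp only:)
    qed
    finally show ?thesis .
  qed
  have XX: "(\<Prod>e<N. \<Sum>a<m. cnj (X l e a (digit d e K)) * X l e a (digit d e K)) = pr K" for l K
  proof -
    have "(\<Sum>a<m. cnj (X l e a (digit d e K)) * X l e a (digit d e K)) = complex_of_real (p (digit d e K))" for e
    proof -
      have "(\<Sum>a<m. cnj (X l e a (digit d e K)) * X l e a (digit d e K)) = complex_of_real (\<Sum>a<m. (cmod (X l e a (digit d e K)))\<^sup>2)"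
        by (simp only: of_real_sum complex_norm_square mult.commute)
      then show ?thesis by (simp only: X[OF dl])
    qed
    then show ?thesis by (simp add: pr_def)
  qed
  have XY: "(\<Prod>e<N. \<Sum>a<m. cnj (X l e a (digit d e K)) * Y l e a (digit d e K)) = pr K * (\<Prod>e<N. \<zeta> l e)" for l K
    unfolding Y_def using \<zeta>[OF dl] by (simp add: pr_def prod.distrib)
  have tst: "tst (K * d' + y) = (\<lambda>l. f l / sqrt (pr K)) (y div m ^ N) * \<psi> (K * d' + y)" if "y < d'" for K y
    using that by (simp add: tst_def mult_add_div)
  have norm: "sqn (d ^ N * d') \<psi> = 1"
  proof -
    have "complex_of_real (sqn d' (\<lambda>y. \<psi> (K * d' + y))) = complex_of_real (pr K)" for K
      unfolding cip_self[symmetric] using ip[of "\<lambda>_. 1" X K X] w(2)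
      unfolding XX \<psi>_def by (simp add: sum_distrib_right[symmetric] of_real_sum[symmetric] del: of_real_sum)
    then have "sqn d' (\<lambda>y. \<psi> (K * d' + y)) = pr K" for K using of_real_eq_iff by blast
    then show ?thesis unfolding sqn_lessThan_mult using prsum by simp
  qed
  have s1: "cip d' (\<lambda>y. tst (K * d' + y)) (\<lambda>y. \<psi> (K * d' + y)) = sqrt (pr K) * (\<Sum>l<L. w l * cnj (f l))" for K
  proof -
    have "cip d' (\<lambda>y. tst (K * d' + y)) (\<lambda>y. \<psi> (K * d' + y))
      = cip d' (\<lambda>y. (\<lambda>l. f l / sqrt (pr K)) (y div m ^ N) * \<psi> (K * d' + y)) (\<lambda>y. \<psi> (K * d' + y))"
      by (rule cip_cong) (simp_all only: tst)
    also have "\<dots> = (\<Sum>l<L. complex_of_real (pr K / sqrt (pr K)) * (w l * cnj (f l)))"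
      using ip[of "\<lambda>l. f l / complex_of_real (sqrt (pr K))" X K X] unfolding XX \<psi>_def by (simp add: mult_ac)
    finally show ?thesis using pr0[of K] by (simp add: sum_distrib_left real_div_sqrt)
  qed
  have s2: "cip d' (\<lambda>y. tst (K * d' + y)) (\<lambda>y. \<chi> (K * d' + y)) = sqrt (pr K) * (\<Sum>l<L. w l * cnj (f l) * (\<Prod>e<N. \<zeta> l e))" for K
  proof -
    have "cip d' (\<lambda>y. tst (K * d' + y)) (\<lambda>y. \<chi> (K * d' + y))
      = cip d' (\<lambda>y. (\<lambda>l. f l / sqrt (pr K)) (y div m ^ N) * \<psi> (K * d' + y)) (\<lambda>y. \<chi> (K * d' + y))"
      by (rule cip_cong) (simp_all only: tst)
    also have "\<dots> = (\<Sum>l<L. complex_of_real (pr K / sqrt (pr K)) * (w l * cnj (f l) * (\<Prod>e<N. \<zeta> l e)))"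
      using ip[of "\<lambda>l. f l / complex_of_real (sqrt (pr K))" X K Y] unfolding XY \<psi>_def \<chi>_def by (simp add: mult_ac)
    finally show ?thesis using pr0[of K] by (simp add: sum_distrib_left real_div_sqrt)
  qed
  \<comment> \<open>Rewrites a weighted squared modulus as an inner-product term, so that
    \<open>ip\<close> also evaluates the norm of the test.\<close>
  have aux: "(cmod (F / complex_of_real (sqrt r) * z))\<^sup>2 = Re (cnj (complex_of_real ((cmod F)\<^sup>2 / r) * z) * z)"
    if "0 \<le> r" for F z :: complex and r :: real
  proof -
    have "cnj (complex_of_real a * z) * z = complex_of_real (a * (cmod z)\<^sup>2)" for a
      unfolding of_real_mult complex_norm_square by (simp add: mult_ac)
    then show ?thesis using that by (simp only: Re_complex_of_real) (simp add: norm_mult norm_divide power_mult_distrib power_divide)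
  qed
  have s3: "sqn d' (\<lambda>y. tst (K * d' + y)) \<le> 1" for K
  proof -
    have "sqn d' (\<lambda>y. tst (K * d' + y)) = sqn d' (\<lambda>y. f (y div m ^ N) / sqrt (pr K) * \<psi> (K * d' + y))"
      unfolding sqn_def by (intro sum.cong refl) (simp add: tst)
    also have "\<dots> = Re (cip d' (\<lambda>y. (\<lambda>l. complex_of_real ((cmod (f l))\<^sup>2 / pr K)) (y div m ^ N) * \<psi> (K * d' + y)) (\<lambda>y. \<psi> (K * d' + y)))"
      unfolding sqn_def cip_def Re_sum using pr0[of K]
      by (intro sum.cong refl) (simp only: aux)
    also have "\<dots> = (\<Sum>l<L. (cmod (f l))\<^sup>2 / pr K * w l * pr K)"
      using ip[of "\<lambda>l. complex_of_real ((cmod (f l))\<^sup>2 / pr K)" X K X] unfolding XX \<psi>_def by (simp del: of_real_power add: if_distrib[of Re] cong: if_cong)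
    \<comment> \<open>Only an inequality, since for \<open>pr K = 0\<close> the left-hand side is
      \<open>0\<close>.\<close>
    also have "\<dots> \<le> (\<Sum>l<L. w l * (cmod (f l))\<^sup>2)"
      using w(1) by (intro sum_mono) (simp add: mult.commute)
    finally show ?thesis using f by simp
  qed
  define \<Omega> where "\<Omega> = block_state (d ^ N * d') d' tst"
  define psi where "psi = vec (d ^ N * d') \<psi>"
  have psi: "unit_vec (d ^ N * d') psi" using norm by (simp add: unit_vec_def psi_def sqn_def)
  have eff: "effect (d ^ N * d') \<Omega>" unfolding \<Omega>_def by (rule effect_block_state) (rule s3)
  define I where "I = (\<lambda>j k :: nat. if j = k then 1 else 0 :: complex)"
  have I_id: "I j k = (if j = k then 1 else 0)" for j k by (simp add: I_def)
  have start: "par_vec d N d' R (\<lambda>p. psi $ p) i p = par_vec d N d' R \<psi> i p" if "i \<le> N" "p < d ^ N * d'" for R i p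
    using that
  proof (induction i arbitrary: p)
    case (Suc i)
    then have i: "i < N" by simp
    show ?case unfolding par_vec.simps(2) using Suc power_split[OF i, of d d']
      by (intro meas_step_cong[where a = "d ^ i"]) simp_all
  qed (simp add: psi_def)
  have psic: "psi \<in> carrier_vec (d ^ N * d')" by (simp add: psi_def)
  have out1: "par_output d N d' (1\<^sub>m d) psi = block_state (d ^ N * d') d' \<psi>"
  proof -
    have "par_output d N d' (1\<^sub>m d) psi = block_state (d ^ N * d') d' (par_vec d N d' I (\<lambda>p. psi $ p) N)"
      by (rule par_output_block_state[where E = "\<lambda>_. 1"]) (auto simp: psic I_def)
    also have "\<dots> = block_state (d ^ N * d') d' \<psi>"
      by (rule block_state_cong) (simp add: start par_vec_identity[OF I_id] psi_def)
    finally show ?thesis .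
  qed
  have out2: "par_output d N d' U psi = block_state (d ^ N * d') d' \<chi>"
  proof -
    have "par_output d N d' U psi = block_state (d ^ N * d') d' (par_vec d N d' Q (\<lambda>p. psi $ p) N)"
      by (rule par_output_block_state[where E = E]) (use U E Q psic in auto)
    also have "\<dots> = block_state (d ^ N * d') d' \<chi>"
    proof (rule block_state_cong)
      fix q assume q: "q < d ^ N * d'"
      have "par_vec d N d' Q (\<lambda>p. psi $ p) N q
        = prod_vec d N L m g (\<lambda>l e. if N - N \<le> e \<and> e < N then \<lambda>a. mapp d (madj Q) (X l e a) else X l e) q"
        unfolding start[OF order_refl q] unfolding \<psi>_def d'_def by (rule par_vec_prod_vec) (use q in \<open>simp_all add: d'_def\<close>)
      also have "\<dots> = \<chi> q" unfolding prod_vec_def \<chi>_def Y_def by simp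
      finally show "par_vec d N d' Q (\<lambda>p. psi $ p) N q = \<chi> q" .
    qed
    finally show ?thesis .
  qed
  have tr: "Re (trace (\<Omega> * block_state (d ^ N * d') d' \<phi>)) = (cmod z)\<^sup>2"
    if "\<And>K. cip d' (\<lambda>y. tst (K * d' + y)) (\<lambda>y. \<phi> (K * d' + y)) = sqrt (pr K) * z" for \<phi> and z :: complex
  proof -
    have "Re (trace (\<Omega> * block_state (d ^ N * d') d' \<phi>)) = (\<Sum>K<d ^ N. pr K * (cmod z)\<^sup>2)"
      unfolding \<Omega>_def trace_block_state that using pr0 by (simp add: norm_mult power_mult_distrib)
    then show ?thesis unfolding sum_distrib_right[symmetric] prsum by simp
  qed
  have "Re (trace ((1\<^sub>m (d ^ N * d') - \<Omega>) * par_output d N d' (1\<^sub>m d) psi)) \<le> \<delta>"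
  proof -
    let ?n = "d ^ N * d'"
    have c: "\<Omega> \<in> carrier_mat ?n ?n" "block_state ?n d' \<psi> \<in> carrier_mat ?n ?n"
      by (simp_all add: \<Omega>_def block_state_def)
    have "(1\<^sub>m ?n - \<Omega>) * block_state ?n d' \<psi> = block_state ?n d' \<psi> - \<Omega> * block_state ?n d' \<psi>"
      unfolding minus_mult_distrib_mat[OF one_carrier_mat c] left_mult_one_mat[OF c(2)] ..
    then have "trace ((1\<^sub>m ?n - \<Omega>) * block_state ?n d' \<psi>) = trace (block_state ?n d' \<psi>) - trace (\<Omega> * block_state ?n d' \<psi>)"
      using c by (simp add: trace_def sum_subtractf)
    moreover have "trace (block_state ?n d' \<psi>) = cip ?n \<psi> \<psi>"
      by (simp add: trace_def block_state_def cip_def mult.commute)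
    ultimately show ?thesis unfolding out1 cip_self using tr[OF s1] norm type_one by simp
  qed
  from p2_parallel_le[OF U psi eff this] show ?thesis unfolding out2 tr[OF s2] .
qed

text \<open>A product with \<open>l\<close> factors of phase \<open>- t\<close> has total phase
  \<open>(N - 2 l) t\<close>. Pairing \<open>l\<close> with \<open>N - l\<close> leaves cosines, so
  it suffices to enclose the target between two of them and interpolate.\<close>

lemma phase_mixture:
  fixes t :: real
  assumes t: "0 \<le> t" "t < pi / 2"
  obtains w :: "nat \<Rightarrow> real" where "\<And>l. 0 \<le> w l" "(\<Sum>l<Suc N. w l) = 1"
    "(\<Sum>l<Suc N. w l * cis ((real N - 2 * real l) * t)) = cos (min (N * t) (pi / 2))"
proof -
  define c where "c = (\<lambda>l. cos ((real N - 2 * real l) * t))"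
  define c0 where "c0 = cos (min (N * t) (pi / 2))"
  have "\<exists>l1\<le>N. \<exists>l2\<le>N. c l1 \<le> c0 \<and> c0 \<le> c l2"
  proof (cases "N * t \<le> pi / 2")
    case True
    then have "c 0 = c0" by (simp add: c_def c0_def)
    then show ?thesis by (intro exI[of _ 0]) auto
  next
    case False
    then have c0: "c0 = 0" by (simp add: c0_def)
    have t0: "0 < t" using False t pi_gt_zero by (cases "t = 0") auto
    \<comment> \<open>The last index whose angle is still at least \<open>pi / 2\<close>.
      Consecutive angles differ by \<open>2 * t < pi\<close>, so this one is below
      \<open>3 * pi / 2\<close> and its cosine is not positive.\<close>
    define k where "k = nat \<lfloor>(N * t - pi / 2) / (2 * t)\<rfloor>"
    have "0 \<le> (N * t - pi / 2) / (2 * t)" using False t0 by simp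
    then have "real k \<le> (N * t - pi / 2) / (2 * t)" "(N * t - pi / 2) / (2 * t) < real k + 1"
      unfolding k_def by linarith+
    then have k: "pi / 2 \<le> (real N - 2 * real k) * t" "(real N - 2 * real k) * t < pi / 2 + 2 * t"
      using t0 by (simp_all add: field_simps)
    have "0 \<le> (real N - 2 * real k) * t" using k(1) pi_gt_zero by linarith
    then have kN: "k \<le> N" using t0 by (simp add: zero_le_mult_iff)
    have "c k \<le> 0"
    proof -
      have "0 \<le> cos ((real N - 2 * real k) * t - pi)" using k t by (intro cos_ge_zero) auto
      then show ?thesis by (simp add: c_def)
    qed
    \<comment> \<open>The central angle is \<open>0\<close> or \<open>t\<close>, which gives a
      nonnegative cosine.\<close>
    moreover have "0 \<le> c (N div 2)"
    proof -
      have "real N - 2 * real (N div 2) = real (N mod 2)" using mult_div_mod_eq[of 2 N] by (metis add_diff_cancel_left' of_nat_add of_nat_mult of_nat_numeral)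
      moreover have "N mod 2 = 0 \<or> N mod 2 = 1" by auto
      ultimately show ?thesis unfolding c_def using t by (auto intro!: cos_ge_zero)
    qed
    ultimately show ?thesis using kN c0 by (intro exI[of _ k] conjI exI[of _ "N div 2"]) auto
  qed
  then obtain l1 l2 where l: "l1 \<le> N" "l2 \<le> N" and b: "c l1 \<le> c0" "c0 \<le> c l2" by blast
  obtain u where u: "0 \<le> u" "u \<le> 1" "u * c l1 + (1 - u) * c l2 = c0"
  proof (cases "c l1 = c l2")
    case True
    then show thesis using b that[of 0] by simp
  next
    case False
    then have "c l1 < c l2" using b by simp
    define v where "v = (c l2 - c0) / (c l2 - c l1)"
    have "v * (c l2 - c l1) = c l2 - c0" using \<open>c l1 < c l2\<close> by (simp add: v_def)
    then have "v * c l1 + (1 - v) * c l2 = c0" by (simp add: algebra_simps)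
    moreover have "0 \<le> v" "v \<le> 1" using b \<open>c l1 < c l2\<close> by (simp_all add: v_def)
    ultimately show thesis using that by blast
  qed
  \<comment> \<open>The interpolation weights, shared equally between each index and its mirror
    image so that the imaginary parts cancel.\<close>
  define w where "w = (\<lambda>l. u / 2 * ((if l = l1 then 1 else 0) + (if l = N - l1 then 1 else 0))
      + (1 - u) / 2 * ((if l = l2 then 1 else 0) + (if l = N - l2 then 1 else 0)) :: real)"
  have w_sum: "(\<Sum>l<Suc N. w l * h l) = u / 2 * (h l1 + h (N - l1)) + (1 - u) / 2 * (h l2 + h (N - l2))"
    for h :: "nat \<Rightarrow> complex"
  proof -
    have d: "(\<Sum>l<Suc N. complex_of_real (if l = k then 1 else 0) * h l) = h k" if "k \<le> N" for k
      using that by (simp add: if_distrib[of "\<lambda>z. z * _"] if_distrib[of complex_of_real] del: sum.lessThan_Suc cong: if_cong)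
    have "(\<Sum>l<Suc N. w l * h l) = u / 2 * ((\<Sum>l<Suc N. complex_of_real (if l = l1 then 1 else 0) * h l) + (\<Sum>l<Suc N. complex_of_real (if l = N - l1 then 1 else 0) * h l))
      + (1 - u) / 2 * ((\<Sum>l<Suc N. complex_of_real (if l = l2 then 1 else 0) * h l) + (\<Sum>l<Suc N. complex_of_real (if l = N - l2 then 1 else 0) * h l))"
      unfolding sum.distrib[symmetric] sum_distrib_left w_def by (intro sum.cong refl) (simp add: algebra_simps)
    then show ?thesis using l by (simp only: d diff_le_self)
  qed
  have sym: "cis ((real N - 2 * real k) * t) + cis ((real N - 2 * real (N - k)) * t) = 2 * c k" if "k \<le> N" for k
  proof -
    have "(real N - 2 * real (N - k)) * t = - ((real N - 2 * real k) * t)" using that by (simp add: of_nat_diff algebra_simps)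
    then show ?thesis by (simp only: c_def) (simp add: complex_eq_iff)
  qed
  show thesis
  proof (rule that[of w])
    show "0 \<le> w l" for l using u by (simp add: w_def)
    have "complex_of_real (\<Sum>l<Suc N. w l) = 1"
      using w_sum[of "\<lambda>_. 1"] by (simp add: field_simps del: sum.lessThan_Suc)
    then show "(\<Sum>l<Suc N. w l) = 1" using of_real_eq_1_iff by blast
    show "(\<Sum>l<Suc N. w l * cis ((real N - 2 * real l) * t)) = cos (min (N * t) (pi / 2))"
      unfolding w_sum sym[OF l(1)] sym[OF l(2)] c0_def[symmetric] u(3)[symmetric] by simp
  qed
qed

section \<open>Optimality of the parallel scenario\<close>

lemma unitary_imp_unitary_fun:
  assumes "unitary d U"
  shows "unitary_fun d (\<lambda>i j. U $$ (i,j))"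
proof -
  have U: "U \<in> carrier_mat d d" "adj U * U = 1\<^sub>m d" "U * adj U = 1\<^sub>m d" using assms by (simp_all add: unitary_def)
  have "(\<Sum>j<d. cnj (U $$ (j,i)) * U $$ (j,k)) = (adj U * U) $$ (i,k)" if "i < d" "k < d" for i k
    using that U(1) by (simp add: scalar_prod_def adj_def atLeast0LessThan)
  moreover have "(\<Sum>j<d. U $$ (i,j) * cnj (U $$ (k,j))) = (U * adj U) $$ (i,k)" if "i < d" "k < d" for i k
    using that U(1) by (simp add: scalar_prod_def adj_def atLeast0LessThan)
  ultimately show ?thesis unfolding unitary_fun_def U(2,3) by simp
qed

text \<open>In the plane spanned by \<open>1\<close> and \<open>z\<close> inside \<open>L\<^sup>2(w)\<close>, which meet at the angle \<open>\<tau>\<close>,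
  \<open>f\<close> is the unit vector at angle \<open>\<beta>\<close> from \<open>1\<close> on the side away from \<open>z\<close>.\<close>

lemma optimal_test_vector:
  fixes w :: "nat \<Rightarrow> real" and z :: "nat \<Rightarrow> complex" and \<tau> \<beta> :: real
  assumes w: "\<And>l. 0 \<le> w l" "(\<Sum>l<L. w l) = 1" and z: "\<And>l. cmod (z l) = 1"
    and wz: "(\<Sum>l<L. w l * z l) = complex_of_real (cos \<tau>)" and \<tau>: "0 \<le> \<tau>" "\<tau> \<le> pi / 2"
  obtains f where "(\<Sum>l<L. w l * (cmod (f l))\<^sup>2) \<le> 1" "(\<Sum>l<L. w l * cnj (f l)) = complex_of_real (cos \<beta>)"
    "(\<Sum>l<L. w l * cnj (f l) * z l) = complex_of_real (cos (\<tau> + \<beta>))"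
proof (cases "\<tau> = 0")
  case True
  show thesis
  \<comment> \<open>For \<open>\<tau> = 0\<close> the plane collapses to the line of constants,
    where no unit vector has inner product \<open>cos \<beta>\<close> with \<open>1\<close> in
    general. A shorter constant vector has both required inner products, which is why the norm is
    only bounded.\<close>
  proof (rule that[of "\<lambda>_. complex_of_real (cos \<beta>)"])
    show "(\<Sum>l<L. w l * (cmod (complex_of_real (cos \<beta>)))\<^sup>2) \<le> 1"
      unfolding sum_distrib_right[symmetric] w by (simp add: abs_square_le_1)
    show "(\<Sum>l<L. w l * cnj (complex_of_real (cos \<beta>))) = complex_of_real (cos \<beta>)"
      unfolding sum_distrib_right[symmetric] of_real_sum[symmetric] w by simp
    have "(\<Sum>l<L. w l * cnj (complex_of_real (cos \<beta>)) * z l) = complex_of_real (cos \<beta>) * (\<Sum>l<L. w l * z l)"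
      unfolding sum_distrib_left by (simp add: mult_ac)
    then show "(\<Sum>l<L. w l * cnj (complex_of_real (cos \<beta>)) * z l) = complex_of_real (cos (\<tau> + \<beta>))"
      unfolding wz using True by simp
  qed
next
  case False
  then have s: "0 < sin \<tau>" using \<tau> pi_gt_zero by (intro sin_gt_zero) auto
  \<comment> \<open>The coefficients of \<open>f\<close> in the oblique basis formed by
    \<open>1\<close> and \<open>- z\<close>, as given by the law of sines.\<close>
  define a b where "a = sin (\<tau> + \<beta>) / sin \<tau>" and "b = sin \<beta> / sin \<tau>"
  define f where "f = (\<lambda>l. complex_of_real a - complex_of_real b * z l)"
  have zz: "cnj (z l) * z l = 1" for l
    using z[of l] complex_norm_square[of "z l"] by (simp add: mult.commute)
  have w1: "(\<Sum>l<L. complex_of_real (w l)) = 1" unfolding of_real_sum[symmetric] w by simp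
  have wz': "(\<Sum>l<L. w l * cnj (z l)) = complex_of_real (cos \<tau>)" using arg_cong[OF wz, of cnj] by simp
  have ab: "a - b * cos \<tau> = cos \<beta>" "a * cos \<tau> - b = cos (\<tau> + \<beta>)"
  proof -
    have "a - b * cos \<tau> = (sin (\<tau> + \<beta>) - sin \<beta> * cos \<tau>) / sin \<tau>"
      by (simp add: a_def b_def diff_divide_distrib)
    also have "\<dots> = cos \<beta>" using s by (simp add: sin_add)
    finally show "a - b * cos \<tau> = cos \<beta>" .
    have "a * cos \<tau> - b = (sin (\<tau> + \<beta>) * cos \<tau> - sin ((\<tau> + \<beta>) - \<tau>)) / sin \<tau>"
      by (simp add: a_def b_def diff_divide_distrib)
    also have "\<dots> = cos (\<tau> + \<beta>)" using s unfolding sin_diff by simp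
    finally show "a * cos \<tau> - b = cos (\<tau> + \<beta>)" .
  qed
  have f1: "(\<Sum>l<L. w l * cnj (f l)) = complex_of_real (cos \<beta>)"
  proof -
    have "(\<Sum>l<L. w l * cnj (f l)) = a * (\<Sum>l<L. complex_of_real (w l)) - b * (\<Sum>l<L. w l * cnj (z l))"
      unfolding sum_distrib_left sum_subtractf[symmetric] by (intro sum.cong refl) (simp add: f_def algebra_simps)
    then show ?thesis unfolding w1 wz' ab(1)[symmetric] by simp
  qed
  have f2: "(\<Sum>l<L. w l * cnj (f l) * z l) = complex_of_real (cos (\<tau> + \<beta>))"
  proof -
    have "(\<Sum>l<L. w l * cnj (f l) * z l) = (\<Sum>l<L. a * (w l * z l) - b * (w l * (cnj (z l) * z l)))"
      by (intro sum.cong refl) (simp add: f_def algebra_simps)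
    also have "\<dots> = a * (\<Sum>l<L. w l * z l) - b * (\<Sum>l<L. complex_of_real (w l))"
      unfolding zz sum_distrib_left sum_subtractf[symmetric] by simp
    finally show ?thesis unfolding w1 wz ab(2)[symmetric] by simp
  qed
  have "complex_of_real (\<Sum>l<L. w l * (cmod (f l))\<^sup>2) = (\<Sum>l<L. w l * (f l * cnj (f l)))"
    unfolding of_real_sum of_real_mult complex_norm_square ..
  also have "\<dots> = (\<Sum>l<L. a * (w l * cnj (f l)) - b * (w l * cnj (f l) * z l))"
    by (intro sum.cong refl) (simp add: f_def algebra_simps)
  also have "\<dots> = complex_of_real (a * cos \<beta> - b * cos (\<tau> + \<beta>))"
    unfolding sum_subtractf sum_distrib_left[symmetric] f1 f2 by simp
  finally have "(\<Sum>l<L. w l * (cmod (f l))\<^sup>2) = a * cos \<beta> - b * cos (\<tau> + \<beta>)" using of_real_eq_iff by blast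
  also have "\<dots> = sin ((\<tau> + \<beta>) - \<beta>) / sin \<tau>" unfolding sin_diff by (simp add: a_def b_def diff_divide_distrib mult.commute)
  also have "\<dots> = 1" using s by simp
  finally show thesis by (intro that[OF _ f1 f2]) simp
qed

lemma p2_parallel_le_zero:
  fixes \<Psi> :: "nat \<Rightarrow> nat \<Rightarrow> complex"
  assumes U: "U \<in> carrier_mat d d" and d: "0 < d" and N: "1 \<le> N" and \<delta>: "0 \<le> \<delta>"
    and \<Psi>: "(\<Sum>a<m. sqn d (\<Psi> a)) = 1"
    and orth: "\<And>k. k < d \<Longrightarrow> (\<Sum>a<m. cnj (\<Psi> a k) * mapp d (madj (\<lambda>i j. U $$ (i,j))) (\<Psi> a) k) = 0"
  shows "p2_parallel \<delta> U d N \<le> 0"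
proof -
  \<comment> \<open>One label and the constant test amplitude suffice. The conditional vectors are
    already orthogonal at each register, and \<open>N \<ge> 1\<close> keeps the product of zeros
    from being empty.\<close>
  have "p2_parallel \<delta> U d N \<le> (cmod (\<Sum>l<1::nat. complex_of_real 1 * cnj 1 * (\<Prod>e<N. 0)))\<^sup>2"
  proof (rule parallel_product_bound[where X = "\<lambda>_ _. \<Psi>" and p = "\<lambda>k. \<Sum>a<m. (cmod (\<Psi> a k))\<^sup>2" and L = 1 and m = m
        and w = "\<lambda>_. 1" and f = "\<lambda>_. 1" and \<zeta> = "\<lambda>_ _. 0" and E = "\<lambda>_. 1" and Q = "\<lambda>i j. U $$ (i,j)", OF U _ _ d])
    show "(\<Sum>k<d. \<Sum>a<m. (cmod (\<Psi> a k))\<^sup>2) = 1" using \<Psi> unfolding sqn_def by (subst sum.swap)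
  qed (use \<delta> orth in simp_all)
  then show ?thesis using N by (simp add: power_0_left)
qed

lemma p2_parallel_le_cos:
  fixes t \<beta> :: real and X :: "bool \<Rightarrow> nat \<Rightarrow> nat \<Rightarrow> complex"
  assumes U: "U \<in> carrier_mat d d" and d: "0 < d" and E: "\<And>k. cmod (E k) = 1" and t: "0 \<le> t" "t < pi / 2"
    and p: "(\<Sum>k<d. p k) = 1" and X: "\<And>b k. k < d \<Longrightarrow> (\<Sum>a<m. (cmod (X b a k))\<^sup>2) = p k"
    and eig: "\<And>b a k. k < d \<Longrightarrow> mapp d (madj (\<lambda>i j. U $$ (i,j) * E j)) (X b a) k = cis (if b then - t else t) * X b a k"
    and \<delta>: "(sin \<beta>)\<^sup>2 \<le> \<delta>"
  shows "p2_parallel \<delta> U d N \<le> (cos (min (N * t) (pi / 2) + \<beta>))\<^sup>2"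
proof -
  define \<tau> where "\<tau> = min (N * t) (pi / 2)"
  have \<tau>: "0 \<le> \<tau>" "\<tau> \<le> pi / 2" using t pi_gt_zero by (simp_all add: \<tau>_def)
  obtain w :: "nat \<Rightarrow> real" where w: "\<And>l. 0 \<le> w l" "(\<Sum>l<Suc N. w l) = 1"
    "(\<Sum>l<Suc N. w l * cis ((real N - 2 * real l) * t)) = cos \<tau>"
    using phase_mixture[OF t, of N] unfolding \<tau>_def by blast
  obtain f where f: "(\<Sum>l<Suc N. w l * (cmod (f l))\<^sup>2) \<le> 1" "(\<Sum>l<Suc N. w l * cnj (f l)) = cos \<beta>"
    "(\<Sum>l<Suc N. w l * cnj (f l) * cis ((real N - 2 * real l) * t)) = cos (\<tau> + \<beta>)"
    using optimal_test_vector[where z = "\<lambda>l. cis ((real N - 2 * real l) * t)" and \<beta> = \<beta>, OF w(1,2) _ w(3) \<tau>] by auto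
  \<comment> \<open>Under label \<open>l\<close>, the digits below \<open>l\<close> carry the part
    of phase \<open>- t\<close> and the others that of phase \<open>t\<close>.\<close>
  define \<zeta> where "\<zeta> = (\<lambda>(l::nat) e. cis (if e < l then - t else t))"
  have prod: "(\<Prod>e<N. \<zeta> l e) = cis ((real N - 2 * real l) * t)" if "l \<le> N" for l
  proof -
    have "(\<Prod>e<N. \<zeta> l e) = (\<Prod>e<l. \<zeta> l e) * (\<Prod>e\<in>{l..<N}. \<zeta> l e)"
      using that by (metis atLeast0LessThan le0 prod.atLeastLessThan_concat)
    also have "\<dots> = cis (- t) ^ l * cis t ^ (N - l)" by (simp add: \<zeta>_def)
    also have "\<dots> = cis ((real N - 2 * real l) * t)"
      using that by (simp add: Complex.DeMoivre cis_mult of_nat_diff algebra_simps)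
    finally show ?thesis .
  qed
  have "p2_parallel \<delta> U d N \<le> (cmod (\<Sum>l<Suc N. w l * cnj (f l) * (\<Prod>e<N. \<zeta> l e)))\<^sup>2"
  proof (rule parallel_product_bound[where X = "\<lambda>l e. X (e < l)" and p = p and L = "Suc N" and m = m and w = w and f = f
        and \<zeta> = \<zeta> and E = E and Q = "\<lambda>i j. U $$ (i,j) * E j", OF U E _ d w(1,2) p _ _ f(1)])
    show "(\<Sum>a<m. cnj (X (e < l) a k) * mapp d (madj (\<lambda>i j. U $$ (i,j) * E j)) (X (e < l) a) k) = p k * \<zeta> l e"
      if "k < d" for l e k
    proof -
      have "(\<Sum>a<m. cnj (X (e < l) a k) * mapp d (madj (\<lambda>i j. U $$ (i,j) * E j)) (X (e < l) a) k)
        = (\<Sum>a<m. complex_of_real ((cmod (X (e < l) a k))\<^sup>2) * \<zeta> l e)"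
        unfolding eig[OF that] \<zeta>_def complex_norm_square by (intro sum.cong refl) (simp add: mult_ac)
      also have "\<dots> = p k * \<zeta> l e"
        unfolding sum_distrib_right[symmetric] of_real_sum[symmetric] X[OF that] ..
      finally show ?thesis .
    qed
    show "1 - \<delta> \<le> (cmod (\<Sum>l<Suc N. w l * cnj (f l)))\<^sup>2"
      unfolding f(2) using \<delta> by (simp add: cos_squared_eq)
  qed (simp_all add: X)
  also have "(\<Sum>l<Suc N. w l * cnj (f l) * (\<Prod>e<N. \<zeta> l e)) = cos (\<tau> + \<beta>)"
    unfolding f(3)[symmetric] by (intro sum.cong refl) (simp add: prod)
  finally show ?thesis by (simp add: \<tau>_def)
qed

theorem theorem5:
  fixes d N d1 d2 :: nat and U :: "complex mat" and \<delta> :: real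
    and dims :: "nat \<Rightarrow> nat" and psi0 :: "complex vec" and V :: "nat \<Rightarrow> nat \<Rightarrow> complex mat"
  assumes "d \<ge> 1" and "N \<ge> 1"
    and "unitary d U"
    and "0 \<le> \<delta>" and "\<delta> \<le> 1"
    and "adaptive_scenario d N dims d1 d2 psi0 V"
  shows "p2_adaptive \<delta> U d N dims d1 d2 psi0 V \<ge> p2_parallel \<delta> U d N"
  unfolding p2_adaptive_def
proof (rule cInf_greatest)
  have U: "U \<in> carrier_mat d d" and u: "unitary_fun d (\<lambda>i j. U $$ (i,j))"
    using assms(3) unitary_imp_unitary_fun by (auto simp: unitary_def)
  have d: "0 < d" using assms(1) by simp
  let ?n = "d^N * d1"
  have zero: "1\<^sub>m ?n - 1\<^sub>m ?n = (0\<^sub>m ?n ?n :: complex mat)" by (intro eq_matI) auto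
  have "psd ?n (1\<^sub>m ?n)"
    by (auto simp: psd_def braket_def less_eq_complex_def intro!: sum_nonneg)
  moreover have "psd ?n (0\<^sub>m ?n ?n)" by (auto simp: psd_def braket_def)
  ultimately have one: "effect ?n (1\<^sub>m ?n)" unfolding effect_def zero by simp
  \<comment> \<open>The infimum is over a nonempty set: the test that always accepts has type I
    error \<open>0\<close>.\<close>
  have "trace ((1\<^sub>m ?n - 1\<^sub>m ?n) * adapt_output d N dims d1 d2 psi0 V (1\<^sub>m d)) = 0"
    unfolding zero by (auto simp: trace_def adapt_output_def ptrace_last_def)
  then show "{Re (trace (\<Omega> * adapt_output d N dims d1 d2 psi0 V U)) | \<Omega>.
      effect ?n \<Omega> \<and> Re (trace ((1\<^sub>m ?n - \<Omega>) * adapt_output d N dims d1 d2 psi0 V (1\<^sub>m d))) \<le> \<delta>} \<noteq> {}"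
    using one assms(4) by fastforce
  fix v assume "v \<in> {Re (trace (\<Omega> * adapt_output d N dims d1 d2 psi0 V U)) | \<Omega>.
      effect ?n \<Omega> \<and> Re (trace ((1\<^sub>m ?n - \<Omega>) * adapt_output d N dims d1 d2 psi0 V (1\<^sub>m d))) \<le> \<delta>}"
  then obtain \<Omega> where v: "v = Re (trace (\<Omega> * adapt_output d N dims d1 d2 psi0 V U))" and \<Omega>: "effect ?n \<Omega>"
    and t1: "Re (trace ((1\<^sub>m ?n - \<Omega>) * adapt_output d N dims d1 d2 psi0 V (1\<^sub>m d))) \<le> \<delta>" by blast
  have v0: "0 \<le> v" unfolding v by (rule adaptive_type_two_nonneg[OF assms(2) U assms(6) \<Omega>])
  from d u show "p2_parallel \<delta> U d N \<le> v"
  proof (cases rule: unitary_alternative)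
    case (orthogonal \<Psi>)
    then show ?thesis using p2_parallel_le_zero[OF U d assms(2,4)] v0 by fastforce
  next
    case (extremal E t X p)
    \<comment> \<open>The angle by which the test may be tilted away from the first hypothesis, at
      type I error \<open>(sin \<beta>)\<^sup>2\<close>.\<close>
    define \<beta> where "\<beta> = arcsin (sqrt \<delta>)"
    define \<tau> where "\<tau> = min (N * t) (pi / 2)"
    have s\<delta>: "- 1 \<le> sqrt \<delta>" "0 \<le> sqrt \<delta>" "sqrt \<delta> \<le> 1" using assms(4,5) order_trans[of "- 1" 0 "sqrt \<delta>"] by simp_all
    have \<beta>: "0 \<le> \<beta>" "\<beta> \<le> pi / 2" "(sin \<beta>)\<^sup>2 = \<delta>"
      using arcsin_le_arcsin[of 0 "sqrt \<delta>"] arcsin_ubound[OF s\<delta>(1,3)] sin_arcsin[OF s\<delta>(1,3)] s\<delta>(2,3) assms(4)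
      by (simp_all add: \<beta>_def)
    have up: "p2_parallel \<delta> U d N \<le> (cos (\<tau> + b))\<^sup>2" if "(sin b)\<^sup>2 \<le> \<delta>" for b
      unfolding \<tau>_def by (rule p2_parallel_le_cos[OF U d extremal(1-3,5) extremal(6,7) that])
    have \<tau>: "0 \<le> \<tau>" "\<tau> \<le> pi / 2" using extremal(2) pi_gt_zero by (simp_all add: \<tau>_def)
    show ?thesis
    proof (cases "\<tau> + \<beta> < pi / 2")
      case True
      then have N: "\<tau> = N * t" using \<beta>(1) by (auto simp: \<tau>_def min_def split: if_splits)
      have "(cos (N * t + \<beta>))\<^sup>2 \<le> v"
        unfolding v
        by (rule adaptive_type_two_ge[OF assms(2) U extremal(1) unitary_fun_phase[OF u extremal(1)] extremal(4,2) \<beta>(1) _ assms(6) \<Omega>])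
          (use True N t1 \<beta>(3) in simp_all)
      then show ?thesis using up[of \<beta>] \<beta>(3) N by simp
    next
      case False
      \<comment> \<open>A tilt by the full \<open>\<beta>\<close> could overshoot the right angle.
        The smaller tilt \<open>pi / 2 - \<tau>\<close> is still admissible and makes the type II
        error of the parallel scenario vanish.\<close>
      have "(sin (pi / 2 - \<tau>))\<^sup>2 \<le> (sin \<beta>)\<^sup>2"
        using False \<tau> \<beta> pi_gt_zero by (intro power_mono sin_monotone_2pi_le sin_ge_zero) auto
      then show ?thesis using up[of "pi / 2 - \<tau>"] \<beta>(3) v0 by simp
    qed
  qed
qed

end
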